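(* Let $P\in\mathbb C[x]$ with $\deg(P)=k$ and let $f\in\widehat{\rm span}(\mathcal D_+^\prime(\mathbb R))$. Then the initial value problem $$P(d/dt)y=f(t),\qquad y(0)=y^\prime(0)=\dots=y^{(k-1)}(0)=0,$$ has a unique solution $y$ in the algebra $\widehat{\mathcal E(\mathbb R)}$, given by the formula $$y=\sum_{n=1}^k c_n\,\iota(y_n)+G\star f,$$ where $y_1,\dots,y_k$ are linearly independent solutions of the homogeneous equation $P(d/dt)y=0$ in $\mathcal E(\mathbb R)$, $G\in\mathcal D_+^\prime(\mathbb R)$ is the Green function of the operator $P(d/dt)$, and the generalized constants $c_n\in\widehat{\mathbb C}$ are determined by $$c_n=-\frac{W\big(y_1,\dots,y_{n-1},\,G\star f,\,y_{n+1},\dots,y_k\big)(0)}{W(y_1,\dots,y_{n-1},y_n,y_{n+1},\dots,y_k)(0)},\qquad n=1,\dots,k.$$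
   Context: Notation: $\mathcal E(\mathbb R)=\mathcal C^\infty(\mathbb R)$ (complex-valued smooth functions), $\mathcal D(\mathbb R)$ = test functions (smooth, compactly supported, complex-valued), $\mathcal D^\prime(\mathbb R)$ = Schwartz distributions, $\mathcal D_+^\prime(\mathbb R)$ = distributions supported in $[0,\infty)$. The algebra $\widehat{\mathcal E(\mathbb R)}$ (Todorov and Vernaeve). For $\varphi\in\mathcal D(\mathbb R)$ let $R_\varphi=\sup\{|x|:\varphi(x)\neq0\}$ if $\varphi\ne0$ and $R_\varphi=1$ if $\varphi=0$. Let $\mathcal D_0=\mathcal D(\mathbb R)$ and for $n\ge1$ let $\mathcal D_n$ be the set of real-valued even $\varphi\in\mathcal D(\mathbb R)$ with $R_\varphi\le 1/n$, $\int\varphi=1$, $\int x^j\varphi(x)\,dx=0$ for $1\le j\le n$, $\int|\varphi|\le 1+\frac1n$, and $\sup_x|\varphi^{(j)}(x)|\le R_\varphi^{-2(j+1)}$ for $0\le j\le n$. Fix an ultrafilter $\mathcal U$ on the set $\mathcal D(\mathbb R)$ which contains every $\mathcal D_n$ and is $\mathfrak c^+$-good, $\mathfrak c={\rm card}(\mathbb R)$. A property of $\varphi$ holds "a.e." if the set of $\varphi$ satisfying it belongs to $\mathcal U$. A $\varphi$-net in a set $S$ is a map $\mathcal D(\mathbb R)\to S$, written $(f_\varphi)$. A $\varphi$-net $(A_\varphi)$ in $\mathbb C$ is moderate if $|A_\varphi|\le R_\varphi^{-m}$ a.e. for some $m\in\mathbb N$, and negligible if for all $p\in\mathbb N$, $|A_\varphi|\le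 R_\varphi^{p}$ a.e. A $\varphi$-net $(f_\varphi)$ in $\mathcal E(\mathbb R)$ is moderate if for every compact $K\subset\mathbb R$ and $j\in\mathbb N_0$ there is $m\in\mathbb N$ with $\sup_{K}|f_\varphi^{(j)}|\le R_\varphi^{-m}$ a.e., and negligible if for every compact $K$, every $j\in\mathbb N_0$ and every $p\in\mathbb N$, $\sup_K|f^{(j)}_\varphi|\le R_\varphi^p$ a.e. $\widehat{\mathbb C}$ and $\widehat{\mathcal E(\mathbb R)}$ are the quotients of moderate nets by negligible nets, with class $q(\cdot)$ and componentwise operations (including differentiation in $\widehat{\mathcal E(\mathbb R)}$). $\widehat{\mathbb C}$ is a field, identified with $\{f\in\widehat{\mathcal E(\mathbb R)}:f^\prime=0\}$. For $f=q(f_\varphi)\in\widehat{\mathcal E(\mathbb R)}$ and $x\in\mathbb R$, $f(x)=q(f_\varphi(x))\in\widehat{\mathbb C}$. The embedding $\iota:\mathcal D^\prime(\mathbb R)\to\widehat{\mathcal E(\mathbb R)}$ is $\iota(T)=q(T\star\varphi)$ (distributional convolution with $\varphi$). For $h\in\mathcal E(\mathbb R)$, $\iota(h)(x)=h(x)$ for $x\in\mathbb R$. For $S\subseteq\mathcal D^\prime(\mathbb R)$, $\widehat{\rm span}(S)=\{\sum_{n=1}^m\alpha_n\,\iota(T_n): m\in\mathbb N,\ T_n\in S,\ \alpha_n\in\widehat{\mathbb C}\}\subseteq\widehat{\mathcal E(\mathbb R)}$. For $T\in\mathcal D_+^\prime(\mathbb R)$ and $f=\sum_{n=1}^m\alpha_n\,\iota(T_n)\in\widehat{\rm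 span}(\mathcal D_+^\prime(\mathbb R))$, $T\star f:=\sum_{n=1}^m\alpha_n\,\iota(T\star T_n)\in\widehat{\rm span}(\mathcal D_+^\prime(\mathbb R))$, where $T\star T_n$ is the usual convolution in $\mathcal D_+^\prime(\mathbb R)$. For a polynomial $P\in\mathbb C[x]$, the Green function of $P(d/dt)$ is the distribution $G\in\mathcal D^\prime(\mathbb R)$ with $P(d/dt)G=\delta$ and $G=0$ on $(-\infty,0)$. $W(f_1,\dots,f_k)$ denotes the Wronskian determinant and $W(f_1,\dots,f_k)(x)$ its value at $x$; in Wronskians, each smooth $y_i$ is identified with $\iota(y_i)\in\widehat{\mathcal E(\mathbb R)}$. *)

theory Defs
  imports
    "HOL-Analysis.Analysis"
    "HOL-Computational_Algebra.Polynomial"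
    "HOL-Combinatorics.Permutations"
    "HOL-Algebra.QuotRing"
begin

section \<open>Smooth functions and test functions\<close>

definition dx :: "(real \<Rightarrow> complex) \<Rightarrow> real \<Rightarrow> complex" where
  "dx h = (\<lambda>x. vector_derivative h (at x))"

definition smooth :: "(real \<Rightarrow> complex) \<Rightarrow> bool" where
  "smooth h \<longleftrightarrow> (\<forall>j x. (dx ^^ j) h differentiable (at x))"

definition supp :: "(real \<Rightarrow> complex) \<Rightarrow> real set" where
  "supp h = closure {x. h x \<noteq> 0}"

typedef test_fun = "{h :: real \<Rightarrow> complex. smooth h \<and> compact (supp h)}"
  morphisms tf mk_tf
proof -
  have "dx (\<lambda>_. 0) = (\<lambda>_. 0)"
    by (simp add: dx_def)
  then have "(dx ^^ j) (\<lambda>_. 0) = (\<lambda>_. 0)" for j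
    by (induction j) simp_all
  then have "smooth (\<lambda>_. 0)"
    by (simp add: smooth_def)
  then show ?thesis
    by (auto simp: supp_def intro!: exI[of _ "\<lambda>_. 0"])
qed


section \<open>Distributions\<close>

text \<open>Continuity is the usual seminorm estimate on the test functions supported in a fixed
  compact set.\<close>

definition distributions :: "(test_fun \<Rightarrow> complex) set" where
  "distributions = {T.
     (\<forall>a b \<phi> \<psi>. T (mk_tf (\<lambda>x. a * tf \<phi> x + b * tf \<psi> x)) = a * T \<phi> + b * T \<psi>) \<and>
     (\<forall>K. compact K \<longrightarrow> (\<exists>C N. \<forall>\<phi>. supp (tf \<phi>) \<subseteq> K \<longrightarrow>
        cmod (T \<phi>) \<le> C * (\<Sum>j\<le>N. SUP x. cmod ((dx ^^ j) (tf \<phi>) x))))}"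

definition vanishes_on :: "(test_fun \<Rightarrow> complex) \<Rightarrow> real set \<Rightarrow> bool" where
  "vanishes_on T \<Omega> \<longleftrightarrow> (\<forall>\<phi>. supp (tf \<phi>) \<subseteq> \<Omega> \<longrightarrow> T \<phi> = 0)"

text \<open>A distribution is supported in a closed set iff it vanishes on the open complement.\<close>

definition dist_plus :: "(test_fun \<Rightarrow> complex) set" where
  "dist_plus = {T \<in> distributions. vanishes_on T (- {0..})}"

definition dist_deriv :: "(test_fun \<Rightarrow> complex) \<Rightarrow> test_fun \<Rightarrow> complex" where
  "dist_deriv T = (\<lambda>\<phi>. - T (mk_tf (dx (tf \<phi>))))"

definition dirac :: "test_fun \<Rightarrow> complex" where
  "dirac \<phi> = tf \<phi> 0"

definition regular_dist :: "(real \<Rightarrow> complex) \<Rightarrow> test_fun \<Rightarrow> complex" where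
  "regular_dist h \<phi> = (LINT x|lborel. h x * tf \<phi> x)"

definition conv_tf :: "(test_fun \<Rightarrow> complex) \<Rightarrow> test_fun \<Rightarrow> real \<Rightarrow> complex" where
  "conv_tf T \<phi> = (\<lambda>x. T (mk_tf (\<lambda>y. tf \<phi> (x - y))))"

text \<open>The convolution of \<open>S\<close> and \<open>T\<close> sends \<open>\<phi>\<close> to \<open>S\<close> applied to \<open>x \<mapsto> T (\<phi> (x + \<cdot>))\<close>. For \<open>T\<close>
  supported in \<open>[0, \<infinity>)\<close> this function of \<open>x\<close> is smooth and vanishes for large \<open>x\<close>, but its
  support need not be bounded below. As \<open>S\<close> is also supported in \<open>[0, \<infinity>)\<close>, one may multiply it
  by any smooth function that is 1 on a neighbourhood of \<open>[0, \<infinity>)\<close> and 0 far to the left; the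
  value does not depend on the choice.\<close>

definition cutoff :: "real \<Rightarrow> complex" where
  "cutoff = (SOME h. smooth h \<and> (\<forall>x\<ge>- 1. h x = 1) \<and> (\<forall>x\<le>- 2. h x = 0))"

definition dist_conv ::
    "(test_fun \<Rightarrow> complex) \<Rightarrow> (test_fun \<Rightarrow> complex) \<Rightarrow> test_fun \<Rightarrow> complex" where
  "dist_conv S T = (\<lambda>\<phi>. S (mk_tf (\<lambda>x. cutoff x * T (mk_tf (\<lambda>y. tf \<phi> (x + y))))))"


section \<open>The differential operator P(d/dt) on smooth functions and distributions\<close>

definition pdt :: "complex poly \<Rightarrow> (real \<Rightarrow> complex) \<Rightarrow> real \<Rightarrow> complex" where
  "pdt P h = (\<lambda>x. \<Sum>i\<le>degree P. coeff P i * (dx ^^ i) h x)"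

definition pdt_dist :: "complex poly \<Rightarrow> (test_fun \<Rightarrow> complex) \<Rightarrow> test_fun \<Rightarrow> complex" where
  "pdt_dist P T = (\<lambda>\<phi>. \<Sum>i\<le>degree P. coeff P i * (dist_deriv ^^ i) T \<phi>)"

definition green :: "complex poly \<Rightarrow> test_fun \<Rightarrow> complex" where
  "green P = (THE G. G \<in> distributions \<and> pdt_dist P G = dirac \<and> vanishes_on G {..<0})"

definition fundamental_system :: "complex poly \<Rightarrow> nat \<Rightarrow> (nat \<Rightarrow> real \<Rightarrow> complex) \<Rightarrow> bool" where
  "fundamental_system P k ys \<longleftrightarrow>
     (\<forall>n\<in>{1..k}. smooth (ys n) \<and> (\<forall>x. pdt P (ys n) x = 0)) \<and>
     (\<forall>a :: nat \<Rightarrow> complex. (\<forall>x. (\<Sum>n=1..k. a n * ys n x) = 0) \<longrightarrow> (\<forall>n\<in>{1..k}. a n = 0))"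


section \<open>The ultrafilter on the space of test functions\<close>

definition radius :: "test_fun \<Rightarrow> real" where
  "radius \<phi> = (if \<forall>x. tf \<phi> x = 0 then 1 else Sup {\<bar>x\<bar> | x. tf \<phi> x \<noteq> 0})"

definition DD :: "nat \<Rightarrow> test_fun set" where
  "DD n = (if n = 0 then UNIV else {\<phi>.
     (\<forall>x. tf \<phi> x \<in> \<real>) \<and> (\<forall>x. tf \<phi> (- x) = tf \<phi> x) \<and>
     radius \<phi> \<le> 1 / real n \<and>
     (LINT x|lborel. tf \<phi> x) = 1 \<and>
     (\<forall>j\<in>{1..n}. (LINT x|lborel. of_real (x ^ j) * tf \<phi> x) = 0) \<and>
     (LINT x|lborel. cmod (tf \<phi> x)) \<le> 1 + 1 / real n \<and>
     (\<forall>j\<le>n. \<forall>x. cmod ((dx ^^ j) (tf \<phi>) x) \<le> 1 / radius \<phi> ^ (2 * (j + 1)))})"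

text \<open>An ultrafilter is represented by an Isabelle filter, so that "a.e." is \<^const>\<open>eventually\<close>;
  Isabelle filters may be improper, hence the condition \<open>U \<noteq> bot\<close>.\<close>

definition ultrafilter :: "'a filter \<Rightarrow> bool" where
  "ultrafilter U \<longleftrightarrow> U \<noteq> bot \<and> (\<forall>A. eventually A U \<or> eventually (\<lambda>\<phi>. \<not> A \<phi>) U)"

text \<open>\<open>\<kappa>\<close>-goodness for \<open>\<kappa>\<close> the successor of the continuum: for every index set \<open>\<Gamma>\<close> of cardinality
  at most the continuum (up to bijection, every set of reals), each order-reversing map from the
  finite subsets of \<open>\<Gamma>\<close> to the ultrafilter has a refinement that turns unions into
  intersections.\<close>

definition c_plus_good :: "'a filter \<Rightarrow> bool" where
  "c_plus_good U \<longleftrightarrow> (\<forall>(\<Gamma> :: real set) (R :: real set \<Rightarrow> 'a set).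
     (\<forall>X \<in> Fpow \<Gamma>. \<forall>\<^sub>F \<phi> in U. \<phi> \<in> R X) \<and>
     (\<forall>X \<in> Fpow \<Gamma>. \<forall>Y \<in> Fpow \<Gamma>. X \<subseteq> Y \<longrightarrow> R Y \<subseteq> R X) \<longrightarrow>
     (\<exists>S :: real set \<Rightarrow> 'a set.
        (\<forall>X \<in> Fpow \<Gamma>. (\<forall>\<^sub>F \<phi> in U. \<phi> \<in> S X) \<and> S X \<subseteq> R X) \<and>
        (\<forall>X \<in> Fpow \<Gamma>. \<forall>Y \<in> Fpow \<Gamma>. S (X \<union> Y) = S X \<inter> S Y)))"

definition tv_ultrafilter :: "test_fun filter \<Rightarrow> bool" where
  "tv_ultrafilter U \<longleftrightarrow>
     ultrafilter U \<and> (\<forall>n. \<forall>\<^sub>F \<phi> in U. \<phi> \<in> DD n) \<and> c_plus_good U"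


section \<open>Generalized constants and generalized functions\<close>

definition C_moderate :: "test_fun filter \<Rightarrow> (test_fun \<Rightarrow> complex) set" where
  "C_moderate U = {A. \<exists>m::nat. \<forall>\<^sub>F \<phi> in U. cmod (A \<phi>) \<le> 1 / radius \<phi> ^ m}"

definition C_negligible :: "test_fun filter \<Rightarrow> (test_fun \<Rightarrow> complex) set" where
  "C_negligible U = {A. \<forall>p::nat. \<forall>\<^sub>F \<phi> in U. cmod (A \<phi>) \<le> radius \<phi> ^ p}"

text \<open>The suprema over compact sets are written as pointwise bounds, because \<open>Sup {}\<close> is
  unspecified for the reals and \<open>K\<close> may be empty.\<close>

definition E_moderate :: "test_fun filter \<Rightarrow> (test_fun \<Rightarrow> real \<Rightarrow> complex) set" where
  "E_moderate U = {f. (\<forall>\<phi>. smooth (f \<phi>)) \<and>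
     (\<forall>K j. compact K \<longrightarrow>
        (\<exists>m::nat. \<forall>\<^sub>F \<phi> in U. \<forall>x\<in>K. cmod ((dx ^^ j) (f \<phi>) x) \<le> 1 / radius \<phi> ^ m))}"

definition E_negligible :: "test_fun filter \<Rightarrow> (test_fun \<Rightarrow> real \<Rightarrow> complex) set" where
  "E_negligible U = {f. (\<forall>\<phi>. smooth (f \<phi>)) \<and>
     (\<forall>K j. compact K \<longrightarrow>
        (\<forall>p::nat. \<forall>\<^sub>F \<phi> in U. \<forall>x\<in>K. cmod ((dx ^^ j) (f \<phi>) x) \<le> radius \<phi> ^ p))}"

definition C_nets :: "test_fun filter \<Rightarrow> (test_fun \<Rightarrow> complex) ring" where
  "C_nets U = \<lparr>carrier = C_moderate U,
     mult = (\<lambda>A B \<phi>. A \<phi> * B \<phi>), one = (\<lambda>\<phi>. 1),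
     zero = (\<lambda>\<phi>. 0), add = (\<lambda>A B \<phi>. A \<phi> + B \<phi>)\<rparr>"

definition E_nets :: "test_fun filter \<Rightarrow> (test_fun \<Rightarrow> real \<Rightarrow> complex) ring" where
  "E_nets U = \<lparr>carrier = E_moderate U,
     mult = (\<lambda>f g \<phi> x. f \<phi> x * g \<phi> x), one = (\<lambda>\<phi> x. 1),
     zero = (\<lambda>\<phi> x. 0), add = (\<lambda>f g \<phi> x. f \<phi> x + g \<phi> x)\<rparr>"

definition C_hat :: "test_fun filter \<Rightarrow> (test_fun \<Rightarrow> complex) set ring" where
  "C_hat U = C_nets U Quot C_negligible U"

definition E_hat :: "test_fun filter \<Rightarrow> (test_fun \<Rightarrow> real \<Rightarrow> complex) set ring" where
  "E_hat U = E_nets U Quot E_negligible U"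

definition C_class :: "test_fun filter \<Rightarrow> (test_fun \<Rightarrow> complex) \<Rightarrow> (test_fun \<Rightarrow> complex) set" where
  "C_class U A = C_negligible U +>\<^bsub>C_nets U\<^esub> A"

definition E_class ::
    "test_fun filter \<Rightarrow> (test_fun \<Rightarrow> real \<Rightarrow> complex) \<Rightarrow> (test_fun \<Rightarrow> real \<Rightarrow> complex) set" where
  "E_class U f = E_negligible U +>\<^bsub>E_nets U\<^esub> f"

definition rep :: "'a set \<Rightarrow> 'a" where
  "rep F = (SOME f. f \<in> F)"

definition E_deriv ::
    "test_fun filter \<Rightarrow> (test_fun \<Rightarrow> real \<Rightarrow> complex) set \<Rightarrow> (test_fun \<Rightarrow> real \<Rightarrow> complex) set" where
  "E_deriv U F = E_class U (\<lambda>\<phi>. dx (rep F \<phi>))"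

definition E_eval ::
    "test_fun filter \<Rightarrow> (test_fun \<Rightarrow> real \<Rightarrow> complex) set \<Rightarrow> real \<Rightarrow> (test_fun \<Rightarrow> complex) set" where
  "E_eval U F x = C_class U (\<lambda>\<phi>. rep F \<phi> x)"

text \<open>The identification of generalized constants with generalized functions of derivative 0.\<close>

definition const_E ::
    "test_fun filter \<Rightarrow> (test_fun \<Rightarrow> complex) set \<Rightarrow> (test_fun \<Rightarrow> real \<Rightarrow> complex) set" where
  "const_E U \<alpha> = E_class U (\<lambda>\<phi> x. rep \<alpha> \<phi>)"

definition iota ::
    "test_fun filter \<Rightarrow> (test_fun \<Rightarrow> complex) \<Rightarrow> (test_fun \<Rightarrow> real \<Rightarrow> complex) set" where
  "iota U T = E_class U (conv_tf T)"

definition pdt_E ::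
    "test_fun filter \<Rightarrow> complex poly \<Rightarrow>
      (test_fun \<Rightarrow> real \<Rightarrow> complex) set \<Rightarrow> (test_fun \<Rightarrow> real \<Rightarrow> complex) set" where
  "pdt_E U P F = (\<Oplus>\<^bsub>E_hat U\<^esub> i\<in>{..degree P}.
     const_E U (C_class U (\<lambda>\<phi>. coeff P i)) \<otimes>\<^bsub>E_hat U\<^esub> (E_deriv U ^^ i) F)"

definition lin_comb ::
    "test_fun filter \<Rightarrow> nat \<Rightarrow> (nat \<Rightarrow> (test_fun \<Rightarrow> complex) set) \<Rightarrow>
      (nat \<Rightarrow> test_fun \<Rightarrow> complex) \<Rightarrow> (test_fun \<Rightarrow> real \<Rightarrow> complex) set" where
  "lin_comb U m \<alpha> T =
     (\<Oplus>\<^bsub>E_hat U\<^esub> n\<in>{1..m}. const_E U (\<alpha> n) \<otimes>\<^bsub>E_hat U\<^esub> iota U (T n))"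

definition hat_span ::
    "test_fun filter \<Rightarrow> (test_fun \<Rightarrow> complex) set \<Rightarrow> (test_fun \<Rightarrow> real \<Rightarrow> complex) set set" where
  "hat_span U S = {lin_comb U m \<alpha> T | m \<alpha> T.
     \<forall>n\<in>{1..m}. \<alpha> n \<in> carrier (C_hat U) \<and> T n \<in> S}"

text \<open>The definite description is legitimate because the result does not depend on the
  representation of \<open>f\<close> as a linear combination.\<close>

definition conv_hat ::
    "test_fun filter \<Rightarrow> (test_fun \<Rightarrow> complex) \<Rightarrow>
      (test_fun \<Rightarrow> real \<Rightarrow> complex) set \<Rightarrow> (test_fun \<Rightarrow> real \<Rightarrow> complex) set" where
  "conv_hat U T f = (THE g. \<exists>m \<alpha> S.
     (\<forall>n\<in>{1..m}. \<alpha> n \<in> carrier (C_hat U) \<and> S n \<in> dist_plus) \<and>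
     f = lin_comb U m \<alpha> S \<and>
     g = lin_comb U m \<alpha> (\<lambda>n. dist_conv T (S n)))"


section \<open>Wronskians\<close>

definition ring_det :: "('a, 'b) ring_scheme \<Rightarrow> nat \<Rightarrow> (nat \<Rightarrow> nat \<Rightarrow> 'a) \<Rightarrow> 'a" where
  "ring_det R k A = (\<Oplus>\<^bsub>R\<^esub> p\<in>{p. p permutes {1..k}}.
     [sign p] \<cdot>\<^bsub>R\<^esub> (\<Otimes>\<^bsub>R\<^esub> i\<in>{1..k}. A i (p i)))"

definition wronskian ::
    "test_fun filter \<Rightarrow> nat \<Rightarrow> (nat \<Rightarrow> (test_fun \<Rightarrow> real \<Rightarrow> complex) set) \<Rightarrow>
      (test_fun \<Rightarrow> real \<Rightarrow> complex) set" where
  "wronskian U k F = ring_det (E_hat U) k (\<lambda>i n. (E_deriv U ^^ (i - 1)) (F n))"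


section \<open>The initial value problem and its solution formula\<close>

definition ivp_solution ::
    "test_fun filter \<Rightarrow> complex poly \<Rightarrow> (test_fun \<Rightarrow> real \<Rightarrow> complex) set \<Rightarrow>
      (test_fun \<Rightarrow> real \<Rightarrow> complex) set \<Rightarrow> bool" where
  "ivp_solution U P f y \<longleftrightarrow>
     y \<in> carrier (E_hat U) \<and> pdt_E U P y = f \<and>
     (\<forall>j<degree P. E_eval U ((E_deriv U ^^ j) y) 0 = \<zero>\<^bsub>C_hat U\<^esub>)"

definition cramer_coeff ::
    "test_fun filter \<Rightarrow> nat \<Rightarrow> (nat \<Rightarrow> real \<Rightarrow> complex) \<Rightarrow>
      (test_fun \<Rightarrow> real \<Rightarrow> complex) set \<Rightarrow> nat \<Rightarrow> (test_fun \<Rightarrow> complex) set" where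
  "cramer_coeff U k ys g n = (let Y = (\<lambda>i. iota U (regular_dist (ys i))) in
     \<ominus>\<^bsub>C_hat U\<^esub> (E_eval U (wronskian U k (Y(n := g))) 0
       \<otimes>\<^bsub>C_hat U\<^esub> inv\<^bsub>C_hat U\<^esub> (E_eval U (wronskian U k Y) 0)))"

end

theory Submission
  imports
    Defs
    "HOL-Computational_Algebra.Fundamental_Theorem_Algebra"
    "HOL-Library.Function_Algebras"
    "Jordan_Normal_Form.Determinant"
begin

text \<open>A net of smooth functions is a smooth function for every test function \<open>\<phi>\<close>, so the initial value
problem can be solved separately for every \<open>\<phi>\<close>; what has to be controlled is the growth in
\<open>radius \<phi>\<close>. Splitting \<open>P\<close> into linear factors reduces everything to \<open>z' - l z = g\<close>, where an
integrating factor and the mean value inequality bound every derivative of \<open>z\<close> on a compact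
interval by the initial value and the derivatives of \<open>g\<close>, with a constant that does not depend on
\<open>z\<close> and \<open>g\<close> (lemma \<open>ode_bound\<close>). The constant being uniform, the bound can be applied for all
\<open>\<phi>\<close> at once. With a right-hand side and initial data bounded by negative powers of the radius it
shows that the solution net is moderate, which gives existence (\<open>ivp_exists\<close>); with bounds by
arbitrary positive powers it shows that the difference of two solutions is negligible, which
gives uniqueness (\<open>ivp_unique\<close>).

For the formula, a distribution \<open>T\<close> is studied through its regularizations \<open>T \<star> \<phi>\<close>, which
determine it. On smooth functions that vanish far to the left, \<open>P(d/dt)\<close> has exactly one inverse
with values in functions of the same kind, called \<open>causal_solution\<close> here. The Green function is
the distribution with \<open>G \<star> \<phi> = causal_solution P \<phi>\<close>, and for every \<open>S\<close> supported in
\<open>[0, \<infinity>)\<close> the convolution satisfies \<open>(G \<star> S) \<star> \<phi> = causal_solution P (S \<star> \<phi>)\<close>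
(\<open>conv_tf_dist_conv_green\<close>). Consequently \<open>G \<star> f\<close> has a representative \<open>h\<close> such that
\<open>P(d/dt) h\<close> is exactly a representative of \<open>f\<close> and \<open>h\<close> vanishes to the left of \<open>-1\<close> for almost
every \<open>\<phi>\<close>. Two representations of \<open>f\<close> as linear combinations therefore lead to functions that
solve the same equation with zero initial data at \<open>-2\<close>, and uniqueness makes them equal; this is
why \<open>G \<star> f\<close> is well defined (\<open>conv_hat_green\<close>).

The homogeneous solutions satisfy \<open>P(d/dt) (y\<^sub>n \<star> \<phi>) = (P(d/dt) y\<^sub>n) \<star> \<phi> = 0\<close>, so that
\<open>\<Sum> c\<^sub>n (y\<^sub>n \<star> \<phi>) + h\<close> solves the equation for all constants \<open>c\<^sub>n\<close>. The regularizations and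
their derivatives converge at \<open>0\<close> along the ultrafilter, hence the Wronskian of the
\<open>y\<^sub>n \<star> \<phi>\<close> at \<open>0\<close> converges to the Wronskian of the \<open>y\<^sub>n\<close>, which is not zero. It
is therefore bounded away from \<open>0\<close> almost everywhere and invertible as a generalized constant, and
Cramer's rule, applied for each \<open>\<phi>\<close> to complex matrices, shows that the stated constants cancel the
initial values of \<open>h\<close> (\<open>solution_formula\<close>). Uniqueness then identifies this solution
with any other.\<close>

section \<open>Calculus of smooth functions on the line\<close>

lemma dx_eqI: "(h has_vector_derivative h') (at x) \<Longrightarrow> dx h x = h'"
  by (simp add: dx_def vector_derivative_at)

lemma dx_funeqI: "(\<And>x. (h has_vector_derivative h' x) (at x)) \<Longrightarrow> dx h = h'"
  by (auto simp: dx_eqI)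

text \<open>Smoothness is reached through finite orders of differentiability. An induction over all
  derivatives of a product cannot keep the factors fixed: it passes from \<open>f * g\<close> to
  \<open>f * g' + f' * g\<close>, and it is the order that decreases.\<close>

definition Ck :: "nat \<Rightarrow> (real \<Rightarrow> complex) \<Rightarrow> bool" where
  "Ck n h \<longleftrightarrow> (\<forall>j\<le>n. \<forall>x. (dx ^^ j) h differentiable (at x))"

lemma smooth_iff_Ck: "smooth h \<longleftrightarrow> (\<forall>n. Ck n h)"
  by (auto simp: smooth_def Ck_def)

lemma Ck_0: "Ck 0 h \<longleftrightarrow> (\<forall>x. h differentiable (at x))"
  by (simp add: Ck_def)

lemma Ck_Suc: "Ck (Suc n) h \<longleftrightarrow> (\<forall>x. h differentiable (at x)) \<and> Ck n (dx h)"
proof -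
  have "(\<forall>j\<le>Suc n. Q j) \<longleftrightarrow> Q 0 \<and> (\<forall>j\<le>n. Q (Suc j))" for Q :: "nat \<Rightarrow> bool"
    by (metis Suc_le_mono le0 not0_implies_Suc)
  from this[of "\<lambda>j. \<forall>x. (dx ^^ j) h differentiable (at x)"]
  show ?thesis
    by (simp add: Ck_def funpow_Suc_right del: funpow.simps)
qed

lemma Ck_mono: "Ck (Suc n) h \<Longrightarrow> Ck n h"
  by (simp add: Ck_def)

lemma Ck_has_dx: "Ck n h \<Longrightarrow> (h has_vector_derivative dx h x) (at x)"
  unfolding Ck_def dx_def
  by (metis funpow_0 le0 vector_derivative_works)

lemma Ck_SucI:
  assumes "\<And>x. (h has_vector_derivative h' x) (at x)" and "Ck n h'"
  shows "Ck (Suc n) h"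
  using assms dx_funeqI[OF assms(1)]
  by (auto simp: Ck_Suc intro: differentiableI_vector)

lemma Ck_0I: "(\<And>x. (h has_vector_derivative h' x) (at x)) \<Longrightarrow> Ck 0 h"
  by (auto simp: Ck_0 intro: differentiableI_vector)

lemma Ck_add: "Ck n f \<Longrightarrow> Ck n g \<Longrightarrow> Ck n (\<lambda>x. f x + g x)"
proof (induction n arbitrary: f g)
  case 0
  show ?case
    by (rule Ck_0I) (rule has_vector_derivative_add[OF Ck_has_dx[OF 0(1)] Ck_has_dx[OF 0(2)]])
next
  case (Suc n)
  show ?case
    by (rule Ck_SucI, rule has_vector_derivative_add[OF Ck_has_dx[OF Suc(2)] Ck_has_dx[OF Suc(3)]])
      (use Suc in \<open>simp add: Ck_Suc\<close>)
qed

lemma Ck_mult: "Ck n f \<Longrightarrow> Ck n g \<Longrightarrow> Ck n (\<lambda>x. f x * g x)"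
proof (induction n arbitrary: f g)
  case 0
  show ?case
    by (rule Ck_0I) (rule has_vector_derivative_mult[OF Ck_has_dx[OF 0(1)] Ck_has_dx[OF 0(2)]])
next
  case (Suc n)
  show ?case
    by (rule Ck_SucI, rule has_vector_derivative_mult[OF Ck_has_dx[OF Suc(2)] Ck_has_dx[OF Suc(3)]])
      (intro Ck_add Suc.IH, use Suc(2,3) in \<open>auto simp: Ck_Suc intro: Ck_mono[OF Suc(2)] Ck_mono[OF Suc(3)]\<close>)
qed

lemma dx_const: "dx (\<lambda>_. c) = (\<lambda>_. 0)"
  by (simp add: dx_def)

lemma Ck_const: "Ck n (\<lambda>_. c)"
  by (induction n arbitrary: c) (auto simp: Ck_0 Ck_Suc dx_const)

lemma smooth_const [simp]: "smooth (\<lambda>_. c)"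
  by (simp add: smooth_iff_Ck Ck_const)

lemma smooth_add: "smooth f \<Longrightarrow> smooth g \<Longrightarrow> smooth (\<lambda>x. f x + g x)"
  by (simp add: smooth_iff_Ck Ck_add)

lemma smooth_mult: "smooth f \<Longrightarrow> smooth g \<Longrightarrow> smooth (\<lambda>x. f x * g x)"
  by (simp add: smooth_iff_Ck Ck_mult)

lemma smooth_cmult: "smooth f \<Longrightarrow> smooth (\<lambda>x. c * f x)"
  by (simp add: smooth_mult)

lemma smooth_uminus: "smooth f \<Longrightarrow> smooth (\<lambda>x. - f x)"
  using smooth_cmult[of f "-1"] by simp

lemma smooth_diff: "smooth f \<Longrightarrow> smooth g \<Longrightarrow> smooth (\<lambda>x. f x - g x)"
  using smooth_add[OF _ smooth_uminus, of f g] by simp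

lemma smooth_sum: "(\<And>i. i \<in> I \<Longrightarrow> smooth (f i)) \<Longrightarrow> smooth (\<lambda>x. \<Sum>i\<in>I. f i x)"
  by (induction I rule: infinite_finite_induct) (auto intro: smooth_add)

lemma smooth_has_dx: "smooth h \<Longrightarrow> (h has_vector_derivative dx h x) (at x)"
  using Ck_has_dx smooth_iff_Ck by blast

lemma smooth_dx_pow: "smooth h \<Longrightarrow> smooth ((dx ^^ j) h)"
  unfolding smooth_def by (metis comp_apply funpow_add)

lemma smooth_dx: "smooth h \<Longrightarrow> smooth (dx h)"
  using smooth_dx_pow[of h 1] by simp

lemma smooth_cont: "smooth h \<Longrightarrow> isCont h x"
  using smooth_has_dx has_vector_derivative_continuous by blast

lemma smooth_continuous_on: "smooth h \<Longrightarrow> continuous_on A h"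
  by (simp add: continuous_at_imp_continuous_on smooth_cont)

lemma dx_add: "smooth f \<Longrightarrow> smooth g \<Longrightarrow> dx (\<lambda>x. f x + g x) = (\<lambda>x. dx f x + dx g x)"
  by (rule dx_funeqI) (intro has_vector_derivative_add smooth_has_dx)

lemma dx_mult: "smooth f \<Longrightarrow> smooth g \<Longrightarrow> dx (\<lambda>x. f x * g x) = (\<lambda>x. f x * dx g x + dx f x * g x)"
  by (rule dx_funeqI) (intro has_vector_derivative_mult smooth_has_dx)

lemma dx_cmult: "smooth f \<Longrightarrow> dx (\<lambda>x. c * f x) = (\<lambda>x. c * dx f x)"
  using dx_mult[of "\<lambda>_. c" f] by (simp add: dx_const)

lemma dx_pow_add:
  "smooth f \<Longrightarrow> smooth g \<Longrightarrow> (dx ^^ j) (\<lambda>x. f x + g x) = (\<lambda>x. (dx ^^ j) f x + (dx ^^ j) g x)"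
  by (induction j) (simp_all add: dx_add smooth_dx_pow)

lemma dx_pow_cmult: "smooth f \<Longrightarrow> (dx ^^ j) (\<lambda>x. c * f x) = (\<lambda>x. c * (dx ^^ j) f x)"
  by (induction j) (simp_all add: dx_cmult smooth_dx_pow)

lemma dx_pow_const: "(dx ^^ j) (\<lambda>_. c) = (\<lambda>_. if j = 0 then c else 0)"
  by (induction j) (simp_all add: dx_const)

lemma dx_pow_uminus: "smooth f \<Longrightarrow> (dx ^^ j) (\<lambda>x. - f x) = (\<lambda>x. - (dx ^^ j) f x)"
  using dx_pow_cmult[of f j "-1"] by simp

lemma dx_pow_diff:
  "smooth f \<Longrightarrow> smooth g \<Longrightarrow> (dx ^^ j) (\<lambda>x. f x - g x) = (\<lambda>x. (dx ^^ j) f x - (dx ^^ j) g x)"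
  using dx_pow_add[OF _ smooth_uminus, of f g j] by (simp add: dx_pow_uminus)

lemma dx_pow_sum:
  assumes "\<And>i. i \<in> I \<Longrightarrow> smooth (f i)"
  shows "(dx ^^ j) (\<lambda>x. \<Sum>i\<in>I. f i x) = (\<lambda>x. \<Sum>i\<in>I. (dx ^^ j) (f i) x)"
  using assms
  by (induction I rule: infinite_finite_induct) (simp_all add: dx_pow_add smooth_sum dx_pow_const)

lemma has_dx_affine:
  fixes a b :: real
  assumes "smooth h"
  shows "((\<lambda>x. h (a + b * x)) has_vector_derivative of_real b * dx h (a + b * x)) (at x)"
proof -
  have "((\<lambda>x. a + b * x) has_vector_derivative b) (at x)"
    by (auto intro!: derivative_eq_intros)
  from vector_diff_chain_at[OF this smooth_has_dx[OF assms]]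
  show ?thesis by (simp add: o_def scaleR_conv_of_real)
qed

lemma smooth_affine:
  assumes "smooth h"
  shows "smooth (\<lambda>x. h (a + b * x))"
proof -
  have "Ck n (\<lambda>x. h (a + b * x))" if "smooth h" for n h
    using that
  proof (induction n arbitrary: h)
    case 0
    show ?case by (rule Ck_0I[OF has_dx_affine[OF 0]])
  next
    case (Suc n)
    show ?case
      by (rule Ck_SucI[OF has_dx_affine[OF Suc(2)] Ck_mult[OF Ck_const Suc(1)]])
        (rule smooth_dx[OF Suc(2)])
  qed
  then show ?thesis using assms by (simp add: smooth_iff_Ck)
qed

lemma dx_pow_affine:
  assumes "smooth h"
  shows "(dx ^^ j) (\<lambda>x. h (a + b * x)) = (\<lambda>x. of_real b ^ j * (dx ^^ j) h (a + b * x))"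
proof (induction j)
  case (Suc j)
  have "dx (\<lambda>x. (dx ^^ j) h (a + b * x)) = (\<lambda>x. of_real b * (dx ^^ Suc j) h (a + b * x))"
    using dx_funeqI[OF has_dx_affine[OF smooth_dx_pow[OF assms]]] by simp
  then show ?case
    by (simp add: Suc dx_cmult[OF smooth_affine[OF smooth_dx_pow[OF assms]]] mult.assoc mult.left_commute)
qed simp

lemma smooth_translate: "smooth h \<Longrightarrow> smooth (\<lambda>x. h (a + x))"
  using smooth_affine[of h a 1] by simp

lemma smooth_reflect: "smooth h \<Longrightarrow> smooth (\<lambda>x. h (a - x))"
  using smooth_affine[of h a "-1"] by simp

lemma dx_pow_translate: "smooth h \<Longrightarrow> (dx ^^ j) (\<lambda>x. h (a + x)) = (\<lambda>x. (dx ^^ j) h (a + x))"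
  using dx_pow_affine[of h j a 1] by simp

lemma dx_pow_reflect: "smooth h \<Longrightarrow> (dx ^^ j) (\<lambda>x. h (a - x)) = (\<lambda>x. (- 1) ^ j * (dx ^^ j) h (a - x))"
  using dx_pow_affine[of h j a "-1"] by simp

text \<open>Vanishing on an open half-line passes to derivatives; it turns vanishing far to the left
  into zero initial data of every order.\<close>

lemma smooth_zero_dx_pow_left:
  assumes "\<And>x. x < b \<Longrightarrow> h x = 0" and "x < b"
  shows "(dx ^^ j) h x = 0"
  using assms(2)
proof (induction j arbitrary: x)
  case (Suc j)
  have "((\<lambda>_. 0) has_vector_derivative 0) (at x)" by simp
  then have "((dx ^^ j) h has_vector_derivative 0) (at x)"
    by (rule has_vector_derivative_transform_within_open[where S = "{..<b}"])
      (use Suc in auto)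
  then show ?case by (simp add: dx_eqI)
qed (use assms in auto)

lemma mean_value_bound:
  fixes w :: "real \<Rightarrow> complex"
  assumes "\<And>s. s \<in> closed_segment a t \<Longrightarrow> (w has_vector_derivative w' s) (at s)"
    and "\<And>s. s \<in> closed_segment a t \<Longrightarrow> cmod (w' s) \<le> B"
  shows "cmod (w t - w a) \<le> B * \<bar>t - a\<bar>"
proof -
  have "cmod (w t - w a) \<le> B * norm (t - a)"
  proof (rule differentiable_bound[of "closed_segment a t" w "\<lambda>s h. h *\<^sub>R w' s"])
    show "(w has_derivative (\<lambda>h. h *\<^sub>R w' s)) (at s within closed_segment a t)"
      if "s \<in> closed_segment a t" for s
      using assms(1)[OF that] has_vector_derivative_at_within unfolding has_vector_derivative_def
      by (blast intro: has_derivative_at_withinI)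
    show "onorm (\<lambda>h. h *\<^sub>R w' s) \<le> B" if "s \<in> closed_segment a t" for s
      using assms(2)[OF that] by (intro onorm_le) (simp add: mult.commute[of B] mult_left_mono)
  qed auto
  then show ?thesis by simp
qed

section \<open>Differential operators with constant coefficients\<close>

lemma pdt_upto: "degree P \<le> N \<Longrightarrow> pdt P h x = (\<Sum>i\<le>N. coeff P i * (dx ^^ i) h x)"
  unfolding pdt_def by (rule sum.mono_neutral_left) (auto simp: coeff_eq_0)

lemma pdt_pCons: "pdt (pCons a P) h x = a * h x + pdt P (dx h) x"
proof -
  have "pdt (pCons a P) h x = (\<Sum>i\<le>Suc (degree P). coeff (pCons a P) i * (dx ^^ i) h x)"
    by (rule pdt_upto) (rule degree_pCons_le)
  also have "\<dots> = a * h x + pdt P (dx h) x"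
    by (subst sum.atMost_Suc_shift)
      (simp add: pdt_def funpow_Suc_right del: funpow.simps)
  finally show ?thesis .
qed

lemma pdt_add_poly: "pdt (P + Q) h x = pdt P h x + pdt Q h x"
  using pdt_upto[of P "max (degree P) (degree Q)" h x] pdt_upto[of Q "max (degree P) (degree Q)" h x]
    pdt_upto[OF degree_add_le_max, of P Q h x]
  by (simp add: sum.distrib distrib_right)

lemma pdt_smult_poly: "pdt (Polynomial.smult c P) h x = c * pdt P h x"
  by (subst pdt_upto[OF degree_smult_le]) (simp add: pdt_def sum_distrib_left mult.assoc)

lemma pdt_const_poly: "pdt [:c:] h = (\<lambda>x. c * h x)"
  by (rule ext) (simp add: pdt_def)

lemma smooth_pdt: "smooth h \<Longrightarrow> smooth (pdt P h)"
  unfolding pdt_def by (intro smooth_sum smooth_cmult smooth_dx_pow)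

text \<open>Derivatives of a solution solve the equation with the differentiated right-hand side.\<close>

lemma dx_pow_pdt: "smooth h \<Longrightarrow> (dx ^^ j) (pdt P h) = pdt P ((dx ^^ j) h)"
proof -
  assume h: "smooth h"
  have *: "(dx ^^ j) ((dx ^^ i) h) = (dx ^^ i) ((dx ^^ j) h)" for i
    by (metis add.commute comp_apply funpow_add)
  show ?thesis
    unfolding pdt_def
    by (simp add: dx_pow_sum dx_pow_cmult h smooth_cmult smooth_dx_pow *)
qed

lemma pdt_add: "smooth f \<Longrightarrow> smooth g \<Longrightarrow> pdt P (\<lambda>x. f x + g x) = (\<lambda>x. pdt P f x + pdt P g x)"
  by (simp add: pdt_def dx_pow_add sum.distrib distrib_left)

lemma pdt_cmult: "smooth f \<Longrightarrow> pdt P (\<lambda>x. c * f x) = (\<lambda>x. c * pdt P f x)"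
  by (simp add: pdt_def dx_pow_cmult sum_distrib_left mult.left_commute)

lemma pdt_diff: "smooth f \<Longrightarrow> smooth g \<Longrightarrow> pdt P (\<lambda>x. f x - g x) = (\<lambda>x. pdt P f x - pdt P g x)"
  by (simp add: pdt_def dx_pow_diff sum_subtractf right_diff_distrib)

lemma pdt_sum:
  assumes "\<And>i. i \<in> I \<Longrightarrow> smooth (f i)"
  shows "pdt P (\<lambda>x. \<Sum>i\<in>I. f i x) = (\<lambda>x. \<Sum>i\<in>I. pdt P (f i) x)"
proof
  show "pdt P (\<lambda>x. \<Sum>i\<in>I. f i x) x = (\<Sum>i\<in>I. pdt P (f i) x)" for x
    unfolding pdt_def using assms
    by (simp add: dx_pow_sum sum_distrib_left) (rule sum.swap)
qed

lemma pdt_translate: "smooth h \<Longrightarrow> pdt P (\<lambda>x. h (a + x)) = (\<lambda>x. pdt P h (a + x))"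
  by (simp add: pdt_def dx_pow_translate)

text \<open>A linear factor of \<open>P\<close> splits off a first-order operator. Together with the induction rule
  below this reduces statements about \<open>P(d/dt)\<close> to first-order equations.\<close>

lemma pdt_linear_factor:
  assumes "smooth h"
  shows "pdt ([:- l, 1:] * Q) h = (\<lambda>x. dx (pdt Q h) x - l * pdt Q h x)"
proof
  fix x
  have eq: "[:- l, 1:] * Q = Polynomial.smult (- l) Q + pCons 0 Q" by simp
  show "pdt ([:- l, 1:] * Q) h x = dx (pdt Q h) x - l * pdt Q h x"
    unfolding eq pdt_add_poly pdt_smult_poly pdt_pCons
    using dx_pow_pdt[OF assms, of 1 Q] by simp
qed

text \<open>The fundamental theorem of algebra, as an induction rule.\<close>

lemma complex_poly_linear_induct [consumes 1, case_names const factor]: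
  fixes P :: "complex poly"
  assumes "P \<noteq> 0"
    and const: "\<And>c. c \<noteq> 0 \<Longrightarrow> R [:c:]"
    and factor: "\<And>l Q. Q \<noteq> 0 \<Longrightarrow> R Q \<Longrightarrow> R ([:- l, 1:] * Q)"
  shows "R P"
  using assms(1)
proof (induction "degree P" arbitrary: P)
  case 0
  then obtain c where "P = [:c:]" by (metis degree_eq_zeroE)
  with 0 show ?case using const by auto
next
  case (Suc n)
  then have "\<not> constant (poly P)" by (simp add: constant_degree)
  then obtain l where "poly P l = 0" using fundamental_theorem_of_algebra by blast
  then obtain Q where Q: "P = [:- l, 1:] * Q" by (auto simp: poly_eq_0_iff_dvd dvd_def)
  then have "Q \<noteq> 0" using Suc by auto
  moreover from this have "degree P = Suc (degree Q)"
    unfolding Q by (subst degree_mult_eq) auto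
  ultimately show ?case using Suc factor Q by auto
qed

lemma degree_linear_factor: "Q \<noteq> 0 \<Longrightarrow> degree ([:- l, 1:] * Q) = Suc (degree Q)"
  for Q :: "complex poly"
  by (subst degree_mult_eq) auto

lemma exp_has_vector_derivative:
  "((\<lambda>s. exp (c * of_real (s - a))) has_vector_derivative c * exp (c * of_real (s - a))) (at s)"
  for c :: complex
proof -
  have "((\<lambda>z. exp (c * (z - of_real a))) has_field_derivative c * exp (c * of_real (s - a))) (at (of_real s))"
    by (auto intro!: derivative_eq_intros)
  from has_vector_derivative_real_field[OF this] show ?thesis by simp
qed

lemma cmod_exp_le: "\<bar>s\<bar> \<le> L \<Longrightarrow> cmod (exp (c * of_real s)) \<le> exp (cmod c * L)"
proof -
  assume s: "\<bar>s\<bar> \<le> L"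
  have "cmod (exp (c * of_real s)) \<le> exp (cmod (c * of_real s))" by (rule norm_exp)
  also have "\<dots> \<le> exp (cmod c * L)" using s by (simp add: norm_mult mult_left_mono)
  finally show ?thesis .
qed

section \<open>A priori bounds and solvability\<close>

text \<open>The integrating factor \<open>exp (- l (s - a))\<close> turns \<open>z' - l z\<close> into the derivative of
  \<open>w = exp (- l (s - a)) z\<close>, to which the mean value inequality applies. Neither \<open>z\<close> nor the
  position of the interval enters the constant, only \<open>l\<close> and the length.\<close>

lemma first_order_bound:
  "\<exists>C\<ge>0. \<forall>z a t B. smooth z \<longrightarrow> \<bar>t - a\<bar> \<le> L \<longrightarrow>
      (\<forall>s\<in>closed_segment a t. cmod (dx z s - l * z s) \<le> B) \<longrightarrow> cmod (z a) \<le> B \<longrightarrow>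
      cmod (z t) \<le> C * B"
proof -
  define E where "E = exp (cmod l * L)"
  have E: "E > 0" by (simp add: E_def)
  have "cmod (z t) \<le> (E * (1 + E * \<bar>L\<bar>)) * B"
    if z: "smooth z" and L: "\<bar>t - a\<bar> \<le> L"
      and rhs: "\<And>s. s \<in> closed_segment a t \<Longrightarrow> cmod (dx z s - l * z s) \<le> B"
      and init: "cmod (z a) \<le> B" for z :: "real \<Rightarrow> complex" and a t B
  proof -
    have B: "B \<ge> 0" using init norm_ge_zero order_trans by blast
    define w where "w = (\<lambda>s. exp (- l * of_real (s - a)) * z s)"
    have "cmod (w t - w a) \<le> (E * B) * \<bar>t - a\<bar>"
    proof (rule mean_value_bound)
      show "(w has_vector_derivative exp (- l * of_real (s - a)) * (dx z s - l * z s)) (at s)" for s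
        unfolding w_def
        using has_vector_derivative_mult[OF exp_has_vector_derivative smooth_has_dx[OF z], of "- l" a s]
        by (simp add: algebra_simps)
      show "cmod (exp (- l * of_real (s - a)) * (dx z s - l * z s)) \<le> E * B"
        if s: "s \<in> closed_segment a t" for s
      proof -
        have "\<bar>s - a\<bar> \<le> L" using s L by (auto simp: closed_segment_eq_real_ivl split: if_splits)
        from cmod_exp_le[OF this, of "- l"] show ?thesis
          unfolding norm_mult using rhs[OF s] by (intro mult_mono) (auto simp: E_def)
      qed
    qed
    also have "\<dots> \<le> (E * B) * \<bar>L\<bar>" using L E B by (intro mult_left_mono) auto
    finally have "cmod (w t - w a) \<le> (E * B) * \<bar>L\<bar>" .
    moreover have "cmod (w t) \<le> cmod (w t - w a) + cmod (w a)"
      using norm_triangle_ineq[of "w t - w a" "w a"] by simp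
    moreover have "w a = z a" by (simp add: w_def)
    ultimately have "cmod (w t) \<le> (1 + E * \<bar>L\<bar>) * B" using init by (simp add: algebra_simps)
    moreover have "z t = exp (l * of_real (t - a)) * w t"
      by (simp add: w_def mult.assoc[symmetric] exp_add[symmetric])
    ultimately show ?thesis
      using cmod_exp_le[OF L, of l] B E
      by (simp add: norm_mult E_def[symmetric] mult.assoc mult_mono)
  qed
  then show ?thesis using E by (intro exI[of _ "E * (1 + E * \<bar>L\<bar>)"]) auto
qed

lemma closed_segment_abs_le: "s \<in> closed_segment a t \<Longrightarrow> \<bar>s - a\<bar> \<le> \<bar>t - a\<bar>" for s :: real
  by (auto simp: closed_segment_eq_real_ivl split: if_splits)

lemma closed_segment_sub: "s \<in> closed_segment a t \<Longrightarrow> closed_segment a s \<subseteq> closed_segment a t"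
  for s :: real
  by (simp add: subset_closed_segment)

text \<open>The differentiated equation expresses the derivative of order \<open>j + 1\<close> of \<open>z\<close> by the one of
  order \<open>j\<close> and the right-hand side.\<close>

lemma first_order_bound_derivs:
  "\<exists>C\<ge>0. \<forall>z a t B. smooth z \<longrightarrow> \<bar>t - a\<bar> \<le> L \<longrightarrow>
      (\<forall>s\<in>closed_segment a t. \<forall>i\<le>j. cmod ((dx ^^ i) (\<lambda>x. dx z x - l * z x) s) \<le> B) \<longrightarrow>
      cmod (z a) \<le> B \<longrightarrow> (\<forall>i\<le>j. cmod ((dx ^^ i) z t) \<le> C * B)"
proof (induction j)
  case 0
  show ?case using first_order_bound[of L l] by simp
next
  case (Suc j)
  then obtain C where C: "C \<ge> 0" and bound: "\<And>z a t B i. smooth z \<Longrightarrow> \<bar>t - a\<bar> \<le> L \<Longrightarrow>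
      (\<forall>s\<in>closed_segment a t. \<forall>i\<le>j. cmod ((dx ^^ i) (\<lambda>x. dx z x - l * z x) s) \<le> B) \<Longrightarrow>
      cmod (z a) \<le> B \<Longrightarrow> i \<le> j \<Longrightarrow> cmod ((dx ^^ i) z t) \<le> C * B"
    by blast
  have "cmod ((dx ^^ i) z t) \<le> (1 + cmod l * C + C) * B"
    if z: "smooth z" and L: "\<bar>t - a\<bar> \<le> L"
      and rhs: "\<forall>s\<in>closed_segment a t. \<forall>i\<le>Suc j. cmod ((dx ^^ i) (\<lambda>x. dx z x - l * z x) s) \<le> B"
      and init: "cmod (z a) \<le> B" and i: "i \<le> Suc j" for z a t B i
  proof -
    have B: "B \<ge> 0" using init norm_ge_zero order_trans by blast
    have IH: "cmod ((dx ^^ i) z t) \<le> C * B" if "i \<le> j" for i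
      by (rule bound[OF z L _ init that]) (use rhs in auto)
    have pos: "0 \<le> B + cmod l * C * B" using B C by simp
    show ?thesis
    proof (cases "i \<le> j")
      case True
      with IH[OF True] pos show ?thesis by (simp add: algebra_simps)
    next
      case False
      then have i: "i = Suc j" using i by simp
      have "(dx ^^ j) (\<lambda>x. dx z x - l * z x) t = (dx ^^ i) z t - l * (dx ^^ j) z t"
        by (simp add: dx_pow_diff smooth_dx z smooth_cmult dx_pow_cmult i funpow_swap1)
      moreover have "cmod ((dx ^^ j) (\<lambda>x. dx z x - l * z x) t) \<le> B" using rhs by simp
      moreover have "cmod (l * (dx ^^ j) z t) \<le> cmod l * (C * B)"
        using IH[of j] by (simp add: norm_mult mult_left_mono)
      ultimately have "cmod ((dx ^^ i) z t) \<le> B + cmod l * (C * B)"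
        using norm_triangle_ineq[of "(dx ^^ i) z t - l * (dx ^^ j) z t" "l * (dx ^^ j) z t"] by simp
      then show ?thesis using mult_nonneg_nonneg[OF C B] by (simp add: algebra_simps)
    qed
  qed
  then show ?case using C by (intro exI[of _ "1 + cmod l * C + C"]) auto
qed

text \<open>The central estimate. For \<open>P = (x - l) Q\<close> put \<open>z = Q(d/dt) u\<close>: then \<open>z' - l z = P(d/dt) u\<close>,
  and \<open>z a\<close> is a combination of the initial values of \<open>u\<close>, so the first-order bound controls \<open>z\<close>,
  which is the right-hand side in the induction hypothesis for \<open>Q\<close>.
  One bound \<open>B\<close> serves for the data and the solution, and the constant depends only on \<open>P\<close>, \<open>j\<close>
  and \<open>L\<close>. So \<open>B\<close> may be any function of the net parameter; \<open>B = 0\<close> yields uniqueness.\<close>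

lemma ode_bound:
  assumes "P \<noteq> 0"
  shows "\<exists>C\<ge>0. \<forall>u a t B. smooth u \<longrightarrow> \<bar>t - a\<bar> \<le> L \<longrightarrow>
      (\<forall>s\<in>closed_segment a t. \<forall>i\<le>j. cmod ((dx ^^ i) (pdt P u) s) \<le> B) \<longrightarrow>
      (\<forall>i<degree P. cmod ((dx ^^ i) u a) \<le> B) \<longrightarrow> cmod ((dx ^^ j) u t) \<le> C * B"
  using assms
proof (induction P rule: complex_poly_linear_induct)
  case (const c)
  have "cmod ((dx ^^ j) u t) \<le> inverse (cmod c) * B"
    if "smooth u" "\<forall>s\<in>closed_segment a t. \<forall>i\<le>j. cmod ((dx ^^ i) (pdt [:c:] u) s) \<le> B" for u a t B
  proof -
    have "cmod c * cmod ((dx ^^ j) u t) \<le> B"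
      using that by (auto simp: pdt_const_poly dx_pow_cmult norm_mult)
    then show ?thesis using const by (simp add: field_simps)
  qed
  then show ?case by (intro exI[of _ "inverse (cmod c)"]) auto
next
  case (factor l Q)
  then obtain C2 where C2: "C2 \<ge> 0" and bound2: "\<And>u a t B. smooth u \<Longrightarrow> \<bar>t - a\<bar> \<le> L \<Longrightarrow>
      (\<forall>s\<in>closed_segment a t. \<forall>i\<le>j. cmod ((dx ^^ i) (pdt Q u) s) \<le> B) \<Longrightarrow>
      (\<forall>i<degree Q. cmod ((dx ^^ i) u a) \<le> B) \<Longrightarrow> cmod ((dx ^^ j) u t) \<le> C2 * B"
    by blast
  obtain C1 where C1: "C1 \<ge> 0" and bound1: "\<And>z a t B i. smooth z \<Longrightarrow> \<bar>t - a\<bar> \<le> L \<Longrightarrow>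
      (\<forall>s\<in>closed_segment a t. \<forall>i\<le>j. cmod ((dx ^^ i) (\<lambda>x. dx z x - l * z x) s) \<le> B) \<Longrightarrow>
      cmod (z a) \<le> B \<Longrightarrow> i \<le> j \<Longrightarrow> cmod ((dx ^^ i) z t) \<le> C1 * B"
    using first_order_bound_derivs[of L j l] by blast
  define M where "M = (\<Sum>i\<le>degree Q. cmod (coeff Q i))"
  have M: "M \<ge> 0" by (simp add: M_def sum_nonneg)
  have "cmod ((dx ^^ j) u t) \<le> (C2 * ((1 + C1) * (1 + M))) * B"
    if u: "smooth u" and L: "\<bar>t - a\<bar> \<le> L"
      and rhs: "\<forall>s\<in>closed_segment a t. \<forall>i\<le>j. cmod ((dx ^^ i) (pdt ([:- l, 1:] * Q) u) s) \<le> B"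
      and init: "\<forall>i<degree ([:- l, 1:] * Q). cmod ((dx ^^ i) u a) \<le> B" for u a t B
  proof -
    note init' = init[unfolded degree_linear_factor[OF factor(1)]]
    have B: "B \<ge> 0" using init'[rule_format, of 0] norm_ge_zero order_trans by blast
    have B1: "B \<le> (1 + M) * B" using M B by (simp add: algebra_simps)
    have B2: "(1 + M) * B \<le> (1 + C1) * ((1 + M) * B)"
      using C1 M B by (simp add: algebra_simps)
    have za: "cmod (pdt Q u a) \<le> (1 + M) * B"
    proof -
      have "cmod (pdt Q u a) \<le> (\<Sum>i\<le>degree Q. cmod (coeff Q i) * cmod ((dx ^^ i) u a))"
        unfolding pdt_def by (rule order_trans[OF norm_sum]) (simp add: norm_mult)
      also have "\<dots> \<le> (\<Sum>i\<le>degree Q. cmod (coeff Q i) * B)"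
        using init' by (intro sum_mono mult_left_mono) auto
      also have "\<dots> = M * B" by (simp add: M_def sum_distrib_right)
      finally show ?thesis using B by (simp add: algebra_simps)
    qed
    have zs: "cmod ((dx ^^ i) (pdt Q u) s) \<le> (1 + C1) * ((1 + M) * B)"
      if s: "s \<in> closed_segment a t" and i: "i \<le> j" for s i
    proof -
      have "cmod ((dx ^^ i) (pdt Q u) s) \<le> C1 * ((1 + M) * B)"
      proof (rule bound1[OF smooth_pdt[OF u] _ _ za i])
        show "\<bar>s - a\<bar> \<le> L" using closed_segment_abs_le[OF s] L by simp
        show "\<forall>r\<in>closed_segment a s. \<forall>i\<le>j.
            cmod ((dx ^^ i) (\<lambda>x. dx (pdt Q u) x - l * pdt Q u x) r) \<le> (1 + M) * B"
        proof (intro ballI allI impI)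
          fix r i assume "r \<in> closed_segment a s" "i \<le> j"
          then have "cmod ((dx ^^ i) (\<lambda>x. dx (pdt Q u) x - l * pdt Q u x) r) \<le> B"
            using closed_segment_sub[OF s] rhs unfolding pdt_linear_factor[OF u] by blast
          then show "cmod ((dx ^^ i) (\<lambda>x. dx (pdt Q u) x - l * pdt Q u x) r) \<le> (1 + M) * B"
            using B1 by linarith
        qed
      qed
      also have "\<dots> \<le> (1 + C1) * ((1 + M) * B)"
        using M B by (intro mult_right_mono) auto
      finally show ?thesis .
    qed
    have "cmod ((dx ^^ j) u t) \<le> C2 * ((1 + C1) * ((1 + M) * B))"
    proof (intro bound2[OF u L] ballI allI impI zs)
      fix i assume "i < degree Q"
      then have "cmod ((dx ^^ i) u a) \<le> B" using init' by simp
      then show "cmod ((dx ^^ i) u a) \<le> (1 + C1) * ((1 + M) * B)" using B1 B2 by linarith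
    qed
    then show ?thesis by (simp add: mult.assoc)
  qed
  then show ?case using C1 C2 M
    by (intro exI[of _ "C2 * ((1 + C1) * (1 + M))"]) auto
qed

lemma ode_boundE:
  assumes "P \<noteq> 0"
  obtains C where "C \<ge> 0" "\<And>u a t B. smooth u \<Longrightarrow> \<bar>t - a\<bar> \<le> L \<Longrightarrow>
      (\<And>s i. s \<in> closed_segment a t \<Longrightarrow> i \<le> j \<Longrightarrow> cmod ((dx ^^ i) (pdt P u) s) \<le> B) \<Longrightarrow>
      (\<And>i. i < degree P \<Longrightarrow> cmod ((dx ^^ i) u a) \<le> B) \<Longrightarrow> cmod ((dx ^^ j) u t) \<le> C * B"
proof -
  obtain C where C: "C \<ge> 0" "\<forall>u a t B. smooth u \<longrightarrow> \<bar>t - a\<bar> \<le> L \<longrightarrow>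
      (\<forall>s\<in>closed_segment a t. \<forall>i\<le>j. cmod ((dx ^^ i) (pdt P u) s) \<le> B) \<longrightarrow>
      (\<forall>i<degree P. cmod ((dx ^^ i) u a) \<le> B) \<longrightarrow> cmod ((dx ^^ j) u t) \<le> C * B"
    using ode_bound[OF assms, of L j] by (elim exE conjE)
  show ?thesis
    by (rule that[OF C(1)]) (rule C(2)[rule_format])
qed

lemma ode_unique:
  assumes P: "P \<noteq> 0" and u: "smooth u" and a: "\<And>i. i < degree P \<Longrightarrow> (dx ^^ i) u a = 0"
    and rhs: "\<And>s. s \<in> closed_segment a t \<Longrightarrow> pdt P u s = 0"
  shows "u t = 0"
proof -
  obtain C where "C \<ge> 0" and C: "\<And>u a' t' B. smooth u \<Longrightarrow> \<bar>t' - a'\<bar> \<le> \<bar>t - a\<bar> \<Longrightarrow>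
      (\<And>s i. s \<in> closed_segment a' t' \<Longrightarrow> i \<le> 0 \<Longrightarrow> cmod ((dx ^^ i) (pdt P u) s) \<le> B) \<Longrightarrow>
      (\<And>i. i < degree P \<Longrightarrow> cmod ((dx ^^ i) u a') \<le> B) \<Longrightarrow> cmod ((dx ^^ 0) u t') \<le> C * B"
    by (rule ode_boundE[OF P, where L = "\<bar>t - a\<bar>" and j = 0]) blast
  have "cmod ((dx ^^ 0) u t) \<le> C * 0"
    by (rule C[OF u, of _ a]) (use a rhs in auto)
  then show ?thesis by simp
qed

text \<open>Variation of constants: \<open>z s = exp (l (s - a)) (F s - F a)\<close> with \<open>F\<close> an antiderivative of
  \<open>exp (- l (s - a)) g\<close>. The equation then bootstraps differentiability of \<open>z\<close> to all orders.\<close>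

lemma first_order_exists:
  assumes "smooth g"
  shows "\<exists>z. smooth z \<and> (\<forall>x. dx z x - l * z x = g x) \<and> z a = 0"
proof -
  define f where "f = (\<lambda>s. exp (- l * of_real (s - a)) * g s)"
  have "isCont f x" for x
    unfolding f_def by (intro continuous_intros smooth_cont assms)
  then have "\<exists>F. \<forall>x. - \<infinity> < ereal x \<longrightarrow> ereal x < \<infinity> \<longrightarrow> (F has_vector_derivative f x) (at x)"
    by (intro einterval_antiderivative) simp_all
  then obtain F where F: "\<And>x. (F has_vector_derivative f x) (at x)" by auto
  define z where "z = (\<lambda>s. exp (l * of_real (s - a)) * (F s - F a))"
  have dz: "(z has_vector_derivative l * z s + g s) (at s)" for s
  proof -
    have "((\<lambda>s. F s - F a) has_vector_derivative f s) (at s)"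
      using has_vector_derivative_diff[OF F has_vector_derivative_const] by simp
    from has_vector_derivative_mult[OF exp_has_vector_derivative this, of l a]
    have "(z has_vector_derivative exp (l * of_real (s - a)) * f s + l * z s) (at s)"
      unfolding z_def by (simp add: algebra_simps)
    moreover have "exp (l * of_real (s - a)) * f s = g s"
      by (simp add: f_def mult.assoc[symmetric] exp_add[symmetric])
    ultimately show ?thesis by (simp add: add.commute)
  qed
  have "Ck n z" for n
  proof (induction n)
    case 0
    show ?case by (rule Ck_0I[OF dz])
  next
    case (Suc n)
    with assms show ?case
      by (intro Ck_SucI[OF dz] Ck_add Ck_mult Ck_const) (auto simp: smooth_iff_Ck)
  qed
  moreover have "dx z s - l * z s = g s" for s using dx_eqI[OF dz] by simp
  moreover have "z a = 0" by (simp add: z_def)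
  ultimately show ?thesis using smooth_iff_Ck by blast
qed

text \<open>Solve the first-order equation for \<open>z\<close> with \<open>z a = 0\<close>, then \<open>Q(d/dt) u = z\<close>. The induction
  hypothesis provides the initial conditions below the degree of \<open>Q\<close>; the one at that degree
  follows from \<open>z a = 0\<close>, because the leading coefficient is not zero.\<close>

lemma ode_exists:
  assumes "P \<noteq> 0" and "smooth g"
  shows "\<exists>u. smooth u \<and> pdt P u = g \<and> (\<forall>i<degree P. (dx ^^ i) u a = 0)"
  using assms
proof (induction P arbitrary: g rule: complex_poly_linear_induct)
  case (const c)
  then show ?case
    by (intro exI[of _ "\<lambda>x. inverse c * g x"]) (auto simp: pdt_const_poly intro: smooth_cmult)
next
  case (factor l Q)
  obtain z where z: "smooth z" "\<And>x. dx z x - l * z x = g x" "z a = 0"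
    using first_order_exists[OF factor(3)] by blast
  from factor.IH[OF z(1)] obtain u where u: "smooth u" "pdt Q u = z"
    and init: "\<And>i. i < degree Q \<Longrightarrow> (dx ^^ i) u a = 0"
    by blast
  have "lead_coeff Q * (dx ^^ degree Q) u a = pdt Q u a"
  proof -
    have "{..degree Q} = insert (degree Q) {..<degree Q}" by auto
    then show ?thesis using init by (simp add: pdt_def)
  qed
  then have "(dx ^^ degree Q) u a = 0" using u z factor(1) by simp
  with init have "\<forall>i<degree ([:- l, 1:] * Q). (dx ^^ i) u a = 0"
    unfolding degree_linear_factor[OF factor(1)] by (auto simp: less_Suc_eq)
  moreover have "pdt ([:- l, 1:] * Q) u = g"
    unfolding pdt_linear_factor[OF u(1)] u(2) using z(2) by auto
  ultimately show ?case using u(1) by blast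
qed

section \<open>Test functions and continuity of distributions\<close>

text \<open>Compactness of the support appears as a bound on the support, which is easy to carry along
  translations, reflections and derivatives.\<close>

definition testfn :: "(real \<Rightarrow> complex) \<Rightarrow> bool" where
  "testfn h \<longleftrightarrow> smooth h \<and> (\<exists>R. \<forall>x. R < \<bar>x\<bar> \<longrightarrow> h x = 0)"

lemma supp_subset: "closed S \<Longrightarrow> (\<And>x. h x \<noteq> 0 \<Longrightarrow> x \<in> S) \<Longrightarrow> supp h \<subseteq> S"
  unfolding supp_def by (rule closure_minimal) auto

lemma supp_subset_Icc:
  assumes "\<forall>x. R < \<bar>x\<bar> \<longrightarrow> h x = 0"
  shows "supp h \<subseteq> {- R..R}"
proof (rule supp_subset)
  show "x \<in> {- R..R}" if "h x \<noteq> 0" for x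
  proof -
    have "\<not> R < \<bar>x\<bar>" using assms that by blast
    then show ?thesis by auto
  qed
qed simp

lemma in_supp: "h x \<noteq> 0 \<Longrightarrow> x \<in> supp h"
  unfolding supp_def using closure_subset by fastforce

lemma testfn_iff: "testfn h \<longleftrightarrow> smooth h \<and> compact (supp h)"
proof -
  have "compact (supp h)" if "\<forall>x. R < \<bar>x\<bar> \<longrightarrow> h x = 0" for R
  proof -
    have "supp h \<subseteq> {- R..R}" using that by (rule supp_subset_Icc)
    then have "bounded (supp h)" by (rule bounded_subset[rotated]) simp
    then show ?thesis by (simp add: compact_eq_bounded_closed supp_def)
  qed
  moreover have "\<exists>R. \<forall>x. R < \<bar>x\<bar> \<longrightarrow> h x = 0" if c: "compact (supp h)"
  proof -
    obtain R where "\<And>x. x \<in> supp h \<Longrightarrow> norm x \<le> R"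
      using compact_imp_bounded[OF c] unfolding bounded_iff by blast
    then have "h x = 0" if "R < \<bar>x\<bar>" for x using in_supp[of h x] that by fastforce
    then show ?thesis by blast
  qed
  ultimately show ?thesis unfolding testfn_def by blast
qed

lemma tf_mk [simp]: "testfn h \<Longrightarrow> tf (mk_tf h) = h"
  by (rule mk_tf_inverse) (simp add: testfn_iff)

lemma testfn_tf [simp]: "testfn (tf \<phi>)"
  using tf[of \<phi>] by (simp add: testfn_iff)

lemma smooth_tf [simp]: "smooth (tf \<phi>)"
  using testfn_tf testfn_def by blast

lemma testfnI: "smooth h \<Longrightarrow> (\<And>x. R < \<bar>x\<bar> \<Longrightarrow> h x = 0) \<Longrightarrow> testfn h"
  unfolding testfn_def by blast

lemma testfn_smooth: "testfn h \<Longrightarrow> smooth h"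
  by (simp add: testfn_def)

lemma testfn_add:
  assumes "testfn f" "testfn g"
  shows "testfn (\<lambda>x. f x + g x)"
proof -
  obtain R S where "\<And>x. R < \<bar>x\<bar> \<Longrightarrow> f x = 0" "\<And>x. S < \<bar>x\<bar> \<Longrightarrow> g x = 0"
    using assms unfolding testfn_def by blast
  then show ?thesis
    using assms by (intro testfnI[of _ "max R S"]) (auto intro: smooth_add testfn_smooth)
qed

lemma testfn_cmult: "testfn f \<Longrightarrow> testfn (\<lambda>x. c * f x)"
  unfolding testfn_def by (auto intro: smooth_cmult)

lemma testfn_reflect:
  assumes "testfn f"
  shows "testfn (\<lambda>y. f (x - y))"
proof -
  obtain R where "\<And>x. R < \<bar>x\<bar> \<Longrightarrow> f x = 0" using assms unfolding testfn_def by blast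
  then show ?thesis
    using assms by (intro testfnI[of _ "R + \<bar>x\<bar>"]) (auto intro: smooth_reflect testfn_smooth)
qed

lemma smooth_zero_dx_pow_outside:
  assumes "\<And>x. R < \<bar>x\<bar> \<Longrightarrow> h x = 0" and "R < \<bar>x\<bar>"
  shows "(dx ^^ j) h x = 0"
  using assms(2)
proof (induction j arbitrary: x)
  case (Suc j)
  have "((\<lambda>_. 0) has_vector_derivative 0) (at x)" by simp
  then have "((dx ^^ j) h has_vector_derivative 0) (at x)"
  proof (rule has_vector_derivative_transform_within_open[where S = "{y. R < \<bar>y\<bar>}"])
    show "open {y. R < \<bar>y\<bar>}" by (intro open_Collect_less continuous_intros)
  qed (use Suc in auto)
  then show ?case by (simp add: dx_eqI)
qed (use assms in auto)

lemma testfn_dx_pow: "testfn f \<Longrightarrow> testfn ((dx ^^ j) f)"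
  unfolding testfn_def by (blast intro: smooth_dx_pow smooth_zero_dx_pow_outside)

lemma testfn_dx: "testfn f \<Longrightarrow> testfn (dx f)"
  using testfn_dx_pow[of f 1] by simp

lemma testfn_bounded:
  assumes "testfn f"
  shows "\<exists>M. \<forall>x. cmod (f x) \<le> M"
proof -
  obtain R where R: "\<And>x. R < \<bar>x\<bar> \<Longrightarrow> f x = 0" using assms unfolding testfn_def by blast
  have "compact (f ` {-R..R})"
    by (intro compact_continuous_image smooth_continuous_on testfn_smooth assms) auto
  then obtain M where M: "\<And>x. x \<in> {-R..R} \<Longrightarrow> cmod (f x) \<le> M"
    using compact_imp_bounded by (force simp: bounded_iff)
  have "cmod (f x) \<le> max M 0" for x
  proof (cases "R < \<bar>x\<bar>")
    case False
    then have "x \<in> {-R..R}" by auto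
    then show ?thesis using M[of x] by simp
  qed (simp add: R)
  then show ?thesis by blast
qed

lemma testfn_bounded_upto:
  assumes "testfn f"
  shows "\<exists>M\<ge>0. \<forall>j\<le>N. \<forall>x. cmod ((dx ^^ j) f x) \<le> M"
proof -
  have "\<exists>M. \<forall>x. cmod ((dx ^^ j) f x) \<le> M" for j
    by (rule testfn_bounded[OF testfn_dx_pow[OF assms]])
  then obtain M where M: "\<And>j x. cmod ((dx ^^ j) f x) \<le> M j" by metis
  have M0: "M j \<ge> 0" for j using M[of j 0] norm_ge_zero order_trans by blast
  have "cmod ((dx ^^ j) f x) \<le> (\<Sum>j\<le>N. M j)" if "j \<le> N" for j x
    using M[of j x] member_le_sum[of j "{..N}" M] M0 that by auto
  then show ?thesis using M0 by (intro exI[of _ "\<Sum>j\<le>N. M j"]) (auto intro: sum_nonneg)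
qed

lemma testfn_bdd_above: "testfn f \<Longrightarrow> bdd_above (range (\<lambda>x. cmod (f x)))"
  using testfn_bounded[of f] by (auto simp: bdd_above_def)

text \<open>The seminorm estimate restated with an arbitrary common bound \<open>B\<close> of the derivatives in place of
  the sum of suprema, and with symmetric intervals in place of compact sets. In this form the
  estimate can be applied and proved without computing suprema.\<close>

lemma distributions_iff:
  "T \<in> distributions \<longleftrightarrow>
     (\<forall>a b f g. testfn f \<longrightarrow> testfn g \<longrightarrow>
        T (mk_tf (\<lambda>x. a * f x + b * g x)) = a * T (mk_tf f) + b * T (mk_tf g)) \<and>
     (\<forall>L. \<exists>C\<ge>0. \<exists>N. \<forall>h B. testfn h \<longrightarrow> (\<forall>x. L < \<bar>x\<bar> \<longrightarrow> h x = 0) \<longrightarrow>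
        (\<forall>j\<le>N. \<forall>x. cmod ((dx ^^ j) h x) \<le> B) \<longrightarrow> cmod (T (mk_tf h)) \<le> C * B)"
  (is "?l \<longleftrightarrow> ?lin \<and> (\<forall>L. ?cont L)")
proof
  assume T: ?l
  have ?lin
  proof (intro allI impI)
    fix a b f g assume "testfn f" "testfn g"
    then show "T (mk_tf (\<lambda>x. a * f x + b * g x)) = a * T (mk_tf f) + b * T (mk_tf g)"
      using T[unfolded distributions_def, simplified, THEN conjunct1, rule_format, of a "mk_tf f" b "mk_tf g"]
      by simp
  qed
  moreover have "?cont L" for L
  proof -
    have "\<forall>K. compact K \<longrightarrow> (\<exists>C N. \<forall>\<phi>. supp (tf \<phi>) \<subseteq> K \<longrightarrow>
        cmod (T \<phi>) \<le> C * (\<Sum>j\<le>N. SUP x. cmod ((dx ^^ j) (tf \<phi>) x)))"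
      using T unfolding distributions_def by simp
    from this[rule_format, OF compact_Icc[of "- L" L]]
    obtain C N where CN: "\<forall>\<phi>. supp (tf \<phi>) \<subseteq> {-L..L} \<longrightarrow>
        cmod (T \<phi>) \<le> C * (\<Sum>j\<le>N. SUP x. cmod ((dx ^^ j) (tf \<phi>) x))"
      by (elim exE) (rule that)
    have "cmod (T (mk_tf h)) \<le> (\<bar>C\<bar> * real (Suc N)) * B"
      if h: "testfn h" "\<forall>x. L < \<bar>x\<bar> \<longrightarrow> h x = 0" and B: "\<forall>j\<le>N. \<forall>x. cmod ((dx ^^ j) h x) \<le> B"
      for h B
    proof -
      have "supp h \<subseteq> {-L..L}" using h(2) by (rule supp_subset_Icc)
      then have "cmod (T (mk_tf h)) \<le> C * (\<Sum>j\<le>N. SUP x. cmod ((dx ^^ j) h x))"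
        using CN[rule_format, of "mk_tf h"] h by simp
      also have "\<dots> \<le> \<bar>C\<bar> * (\<Sum>j\<le>N. SUP x. cmod ((dx ^^ j) h x))"
      proof (rule mult_right_mono)
        have "0 \<le> (SUP x. cmod ((dx ^^ j) h x))" for j
          by (rule cSUP_upper2[OF testfn_bdd_above[OF testfn_dx_pow[OF h(1)]] UNIV_I]) simp
        then show "0 \<le> (\<Sum>j\<le>N. SUP x. cmod ((dx ^^ j) h x))" by (intro sum_nonneg)
      qed simp
      also have "\<dots> \<le> \<bar>C\<bar> * (\<Sum>j\<le>N. B)"
        using B by (intro mult_left_mono sum_mono cSUP_least) auto
      finally show ?thesis by (simp add: algebra_simps)
    qed
    then show ?thesis by (intro exI[of _ "\<bar>C\<bar> * real (Suc N)"] conjI exI[of _ N]) auto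
  qed
  ultimately show "?lin \<and> (\<forall>L. ?cont L)" by blast
next
  assume *: "?lin \<and> (\<forall>L. ?cont L)"
  have "T (mk_tf (\<lambda>x. a * tf \<phi> x + b * tf \<psi> x)) = a * T \<phi> + b * T \<psi>" for a b \<phi> \<psi>
    using *[THEN conjunct1, rule_format, of "tf \<phi>" "tf \<psi>" a b] by (simp add: tf_inverse)
  moreover have "\<exists>C N. \<forall>\<phi>. supp (tf \<phi>) \<subseteq> K \<longrightarrow>
        cmod (T \<phi>) \<le> C * (\<Sum>j\<le>N. SUP x. cmod ((dx ^^ j) (tf \<phi>) x))" if K: "compact K" for K
  proof -
    obtain L where L: "\<And>x. x \<in> K \<Longrightarrow> norm x \<le> L"
      using compact_imp_bounded[OF K] unfolding bounded_iff by blast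
    obtain C N where CN: "\<And>h B. testfn h \<Longrightarrow> (\<forall>x. L < \<bar>x\<bar> \<longrightarrow> h x = 0) \<Longrightarrow>
        (\<forall>j\<le>N. \<forall>x. cmod ((dx ^^ j) h x) \<le> B) \<Longrightarrow> cmod (T (mk_tf h)) \<le> C * B"
      using *[THEN conjunct2, rule_format, of L] by blast
    have "cmod (T \<phi>) \<le> C * (\<Sum>j\<le>N. SUP x. cmod ((dx ^^ j) (tf \<phi>) x))"
      if s: "supp (tf \<phi>) \<subseteq> K" for \<phi>
    proof -
      let ?S = "\<lambda>j. SUP x. cmod ((dx ^^ j) (tf \<phi>) x)"
      note bdd = testfn_bdd_above[OF testfn_dx_pow[OF testfn_tf]]
      have S0: "0 \<le> ?S j" for j by (rule cSUP_upper2[OF bdd UNIV_I]) simp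
      have "cmod ((dx ^^ j) (tf \<phi>) x) \<le> (\<Sum>j\<le>N. ?S j)" if "j \<le> N" for j x
      proof -
        have "cmod ((dx ^^ j) (tf \<phi>) x) \<le> ?S j" by (rule cSUP_upper[OF UNIV_I bdd])
        also have "\<dots> \<le> (\<Sum>j\<le>N. ?S j)" using that S0 by (intro member_le_sum) auto
        finally show ?thesis .
      qed
      moreover have "\<forall>x. L < \<bar>x\<bar> \<longrightarrow> tf \<phi> x = 0" using in_supp[of "tf \<phi>"] s L by force
      ultimately show ?thesis using CN[of "tf \<phi>" "\<Sum>j\<le>N. ?S j"] by (simp add: tf_inverse)
    qed
    then show ?thesis by blast
  qed
  ultimately show ?l unfolding distributions_def by blast
qed

lemma dist_linear:
  "T \<in> distributions \<Longrightarrow> testfn f \<Longrightarrow> testfn g \<Longrightarrow>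
    T (mk_tf (\<lambda>x. a * f x + b * g x)) = a * T (mk_tf f) + b * T (mk_tf g)"
  unfolding distributions_iff by blast

lemma dist_cmult: "T \<in> distributions \<Longrightarrow> testfn f \<Longrightarrow> T (mk_tf (\<lambda>x. a * f x)) = a * T (mk_tf f)"
  using dist_linear[of T f f a 0] by simp

lemma dist_uminus: "T \<in> distributions \<Longrightarrow> testfn f \<Longrightarrow> T (mk_tf (\<lambda>x. - f x)) = - T (mk_tf f)"
  using dist_cmult[of T f "-1"] by simp

lemma dist_bound:
  assumes "T \<in> distributions"
  obtains C N where "C \<ge> 0" "\<And>h B. testfn h \<Longrightarrow> (\<And>x. L < \<bar>x\<bar> \<Longrightarrow> h x = 0) \<Longrightarrow>
        (\<And>j x. j \<le> N \<Longrightarrow> cmod ((dx ^^ j) h x) \<le> B) \<Longrightarrow> cmod (T (mk_tf h)) \<le> C * B"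
proof -
  obtain C N where CN: "C \<ge> 0" "\<forall>h B. testfn h \<longrightarrow> (\<forall>x. L < \<bar>x\<bar> \<longrightarrow> h x = 0) \<longrightarrow>
        (\<forall>j\<le>N. \<forall>x. cmod ((dx ^^ j) h x) \<le> B) \<longrightarrow> cmod (T (mk_tf h)) \<le> C * B"
    using assms[unfolded distributions_iff, THEN conjunct2, rule_format, of L] by (elim exE conjE)
  show ?thesis
    by (rule that[OF CN(1)]) (rule CN(2)[rule_format])
qed

lemma distributionsI:
  assumes "\<And>a b f g. testfn f \<Longrightarrow> testfn g \<Longrightarrow>
        T (mk_tf (\<lambda>x. a * f x + b * g x)) = a * T (mk_tf f) + b * T (mk_tf g)"
    and "\<And>L. \<exists>C\<ge>0. \<exists>N. \<forall>h B. testfn h \<longrightarrow> (\<forall>x. L < \<bar>x\<bar> \<longrightarrow> h x = 0) \<longrightarrow>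
        (\<forall>j\<le>N. \<forall>x. cmod ((dx ^^ j) h x) \<le> B) \<longrightarrow> cmod (T (mk_tf h)) \<le> C * B"
  shows "T \<in> distributions"
  unfolding distributions_iff using assms by blast

section \<open>Regularization of distributions\<close>

definition tf_deriv :: "test_fun \<Rightarrow> test_fun" where
  "tf_deriv \<phi> = mk_tf (dx (tf \<phi>))"

lemma tf_tf_deriv: "tf (tf_deriv \<phi>) = dx (tf \<phi>)"
  by (simp add: tf_deriv_def testfn_dx)

lemma tf_tf_deriv_pow: "tf ((tf_deriv ^^ j) \<phi>) = (dx ^^ j) (tf \<phi>)"
  by (induction j) (simp_all add: tf_tf_deriv)

lemma has_vector_derivative_quadratic:
  fixes f :: "real \<Rightarrow> complex"
  assumes "\<And>h. \<bar>h\<bar> \<le> 1 \<Longrightarrow> cmod (f (x + h) - f x - of_real h * d) \<le> C * h\<^sup>2"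
  shows "(f has_vector_derivative d) (at x)"
  unfolding has_vector_derivative_def
proof (rule has_derivativeI_sandwich[where e = 1 and H = "\<lambda>y. C * \<bar>y - x\<bar>"])
  show "bounded_linear (\<lambda>h. h *\<^sub>R d)" by (rule bounded_linear_scaleR_left)
  show "cmod (f y - f x - (y - x) *\<^sub>R d) / norm (y - x) \<le> C * \<bar>y - x\<bar>"
    if "y \<noteq> x" "dist y x < 1" for y
    using assms[of "y - x"] that
    by (simp add: dist_real_def scaleR_conv_of_real divide_le_eq power2_eq_square mult.assoc
        abs_mult_self_eq)
  have "((\<lambda>y. C * \<bar>y - x\<bar>) \<longlongrightarrow> C * \<bar>x - x\<bar>) (at x)"
    by (intro tendsto_intros)
  then show "((\<lambda>y. C * \<bar>y - x\<bar>) \<longlongrightarrow> 0) (at x)" by simp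
qed simp

text \<open>Two applications of the mean value inequality: to \<open>h'\<close>, and to
  \<open>s \<mapsto> h s - (s - x) h' x\<close>.\<close>

lemma taylor_quadratic:
  assumes h: "smooth h" and M: "\<And>x. cmod (dx (dx h) x) \<le> M"
  shows "cmod (h (x + r) - h x - of_real r * dx h x) \<le> M * r\<^sup>2"
proof -
  have "cmod ((\<lambda>s. h s - of_real (s - x) * dx h x) (x + r) - (\<lambda>s. h s - of_real (s - x) * dx h x) x)
      \<le> (M * \<bar>r\<bar>) * \<bar>(x + r) - x\<bar>"
  proof (rule mean_value_bound)
    fix s assume s: "s \<in> closed_segment x (x + r)"
    show "((\<lambda>s. h s - of_real (s - x) * dx h x) has_vector_derivative dx h s - dx h x) (at s)"
      by (auto intro!: derivative_eq_intros smooth_has_dx[OF h])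
    have "cmod (dx h s - dx h x) \<le> M * \<bar>s - x\<bar>"
      by (rule mean_value_bound) (use smooth_has_dx[OF smooth_dx[OF h]] M in auto)
    also have "\<dots> \<le> M * \<bar>r\<bar>"
    proof (rule mult_left_mono)
      show "\<bar>s - x\<bar> \<le> \<bar>r\<bar>" using closed_segment_abs_le[OF s] by simp
      show "0 \<le> M" using norm_ge_zero M[of 0] by (rule order_trans)
    qed
    finally show "cmod (dx h s - dx h x) \<le> M * \<bar>r\<bar>" .
  qed
  then show ?thesis by (simp add: power2_eq_square mult.assoc algebra_simps)
qed

text \<open>Apply \<open>T\<close> to the Taylor remainder \<open>\<phi> (x + r - \<cdot>) - \<phi> (x - \<cdot>) - r \<phi>' (x - \<cdot>)\<close>. For
  \<open>\<bar>r\<bar> \<le> 1\<close> its support stays in a fixed interval, and each of its derivatives is bounded by a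
  multiple of \<open>r\<^sup>2\<close>, so continuity of \<open>T\<close> gives a quadratic error.\<close>

lemma conv_tf_has_dx:
  assumes T: "T \<in> distributions"
  shows "(conv_tf T \<phi> has_vector_derivative conv_tf T (tf_deriv \<phi>) x) (at x)"
proof -
  obtain R where R: "\<And>y. R < \<bar>y\<bar> \<Longrightarrow> tf \<phi> y = 0" using testfn_tf unfolding testfn_def by blast
  obtain C N where C: "C \<ge> 0" and bound: "\<And>h B. testfn h \<Longrightarrow> (\<And>y. R + \<bar>x\<bar> + 1 < \<bar>y\<bar> \<Longrightarrow> h y = 0) \<Longrightarrow>
        (\<And>j y. j \<le> N \<Longrightarrow> cmod ((dx ^^ j) h y) \<le> B) \<Longrightarrow> cmod (T (mk_tf h)) \<le> C * B"
    using dist_bound[OF T, of "R + \<bar>x\<bar> + 1"] by blast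
  obtain M where M: "\<And>j y. j \<le> N + 2 \<Longrightarrow> cmod ((dx ^^ j) (tf \<phi>) y) \<le> M"
    using testfn_bounded_upto[OF testfn_tf, of "N + 2" \<phi>] by blast
  show ?thesis
  proof (rule has_vector_derivative_quadratic)
    fix r :: real assume r: "\<bar>r\<bar> \<le> 1"
    define f0 where "f0 = (\<lambda>y. tf \<phi> (x - y))"
    define f1 where "f1 = (\<lambda>y. tf \<phi> (x + r - y))"
    define f2 where "f2 = (\<lambda>y. dx (tf \<phi>) (x - y))"
    have t: "testfn f0" "testfn f1" "testfn f2"
      unfolding f0_def f1_def f2_def by (intro testfn_reflect testfn_dx testfn_tf)+
    define g where "g = (\<lambda>y. 1 * (1 * f1 y + (- 1) * f0 y) + (- of_real r) * f2 y)"
    have "T (mk_tf g) = 1 * (1 * T (mk_tf f1) + (- 1) * T (mk_tf f0)) + (- of_real r) * T (mk_tf f2)"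
      unfolding g_def
      by (subst dist_linear[OF T testfn_add[OF testfn_cmult testfn_cmult]] dist_linear[OF T], (rule t)+)
        (subst dist_linear[OF T], (rule t)+, simp)
    then have eq: "T (mk_tf g) = conv_tf T \<phi> (x + r) - conv_tf T \<phi> x - of_real r * conv_tf T (tf_deriv \<phi>) x"
      by (simp add: conv_tf_def f0_def f1_def f2_def tf_tf_deriv)
    have g: "testfn g"
      unfolding g_def by (intro testfn_add testfn_cmult t)
    have "cmod (T (mk_tf g)) \<le> C * (M * r\<^sup>2)"
    proof (rule bound[OF g])
      fix y assume y: "R + \<bar>x\<bar> + 1 < \<bar>y\<bar>"
      then have "R < \<bar>x - y\<bar>" "R < \<bar>x + r - y\<bar>" using r by linarith+
      then show "g y = 0"
        using R smooth_zero_dx_pow_outside[of R "tf \<phi>" "x - y" 1] by (simp add: g_def f0_def f1_def f2_def)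
    next
      fix j y assume j: "j \<le> N"
      have "(dx ^^ j) g y = (-1) ^ j * ((dx ^^ j) (tf \<phi>) ((x - y) + r) - (dx ^^ j) (tf \<phi>) (x - y)
          - of_real r * dx ((dx ^^ j) (tf \<phi>)) (x - y))"
      proof -
        have "(dx ^^ j) g y = (dx ^^ j) f1 y - (dx ^^ j) f0 y - of_real r * (dx ^^ j) f2 y"
          using t[THEN testfn_smooth] unfolding g_def
          by (simp add: dx_pow_diff dx_pow_cmult smooth_diff smooth_cmult)
        then show ?thesis
          unfolding f0_def f1_def f2_def
          by (simp add: dx_pow_reflect smooth_dx funpow_swap1 algebra_simps)
      qed
      moreover have "cmod \<dots> \<le> M * r\<^sup>2"
        unfolding norm_mult norm_power
        using taylor_quadratic[OF smooth_dx_pow[OF smooth_tf], of j \<phi> M "x - y" r] M[of "j + 2"] j by simp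
      ultimately show "cmod ((dx ^^ j) g y) \<le> M * r\<^sup>2" by simp
    qed
    then show "cmod (conv_tf T \<phi> (x + r) - conv_tf T \<phi> x - of_real r * conv_tf T (tf_deriv \<phi>) x) \<le> (C * M) * r\<^sup>2"
      by (simp add: eq mult.assoc)
  qed
qed

lemma dx_conv_tf: "T \<in> distributions \<Longrightarrow> dx (conv_tf T \<phi>) = conv_tf T (tf_deriv \<phi>)"
  by (rule dx_funeqI) (rule conv_tf_has_dx)

lemma dx_pow_conv_tf: "T \<in> distributions \<Longrightarrow> (dx ^^ j) (conv_tf T \<phi>) = conv_tf T ((tf_deriv ^^ j) \<phi>)"
  by (induction j) (simp_all add: dx_conv_tf)

lemma smooth_conv_tf: "T \<in> distributions \<Longrightarrow> smooth (conv_tf T \<phi>)"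
  unfolding smooth_def
  by (auto simp: dx_pow_conv_tf intro: differentiableI_vector conv_tf_has_dx)

text \<open>The order \<open>N\<close> and the constant are those of \<open>T\<close> on a neighbourhood of \<open>[-L, L]\<close> of size \<open>1\<close>, so
  they serve all \<open>\<phi>\<close> supported in \<open>[-1, 1]\<close>.\<close>

lemma conv_tf_bound:
  assumes "T \<in> distributions"
  obtains C N where "C \<ge> 0" "\<And>\<phi> x B. \<bar>x\<bar> \<le> L \<Longrightarrow> (\<And>y. 1 < \<bar>y\<bar> \<Longrightarrow> tf \<phi> y = 0) \<Longrightarrow>
      (\<And>j y. j \<le> N \<Longrightarrow> cmod ((dx ^^ j) (tf \<phi>) y) \<le> B) \<Longrightarrow> cmod (conv_tf T \<phi> x) \<le> C * B"
proof -
  obtain C N where CN: "C \<ge> 0" "\<And>h B. testfn h \<Longrightarrow> (\<And>x. L + 1 < \<bar>x\<bar> \<Longrightarrow> h x = 0) \<Longrightarrow>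
        (\<And>j x. j \<le> N \<Longrightarrow> cmod ((dx ^^ j) h x) \<le> B) \<Longrightarrow> cmod (T (mk_tf h)) \<le> C * B"
    using dist_bound[OF assms, of "L + 1"] by blast
  show ?thesis
  proof (rule that[OF CN(1)])
    fix \<phi> x B assume *: "\<bar>x\<bar> \<le> L" "\<And>y. 1 < \<bar>y\<bar> \<Longrightarrow> tf \<phi> y = 0"
      "\<And>j y. j \<le> N \<Longrightarrow> cmod ((dx ^^ j) (tf \<phi>) y) \<le> B"
    show "cmod (conv_tf T \<phi> x) \<le> C * B"
      unfolding conv_tf_def
      by (rule CN(2)[OF testfn_reflect[OF testfn_tf]])
        (use * in \<open>auto simp: dx_pow_reflect norm_mult norm_power\<close>)
  qed
qed

lemma conv_tf_vanishes_left:
  assumes "vanishes_on T {..<0}" and "\<And>y. R < \<bar>y\<bar> \<Longrightarrow> tf \<phi> y = 0" and "x < - R"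
  shows "conv_tf T \<phi> x = 0"
proof -
  have "supp (\<lambda>y. tf \<phi> (x - y)) \<subseteq> {..x + R}"
    by (rule supp_subset) (use assms(2) in force)+
  also have "\<dots> \<subseteq> {..<0}" using assms(3) by auto
  finally show ?thesis
    using assms(1) by (simp add: conv_tf_def vanishes_on_def testfn_reflect)
qed

lemma dist_deriv_distributions:
  assumes T: "T \<in> distributions"
  shows "dist_deriv T \<in> distributions"
proof (rule distributionsI)
  fix a b f g assume f: "testfn f" and g: "testfn g"
  have "dx (\<lambda>x. a * f x + b * g x) = (\<lambda>x. a * dx f x + b * dx g x)"
    using f g by (simp add: dx_add dx_cmult testfn_smooth smooth_cmult)
  then show "dist_deriv T (mk_tf (\<lambda>x. a * f x + b * g x)) =
      a * dist_deriv T (mk_tf f) + b * dist_deriv T (mk_tf g)"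
    using f g by (simp add: dist_deriv_def testfn_add testfn_cmult dist_linear[OF T] testfn_dx)
next
  fix L
  obtain C N where CN: "C \<ge> 0" "\<And>h B. testfn h \<Longrightarrow> (\<And>x. L < \<bar>x\<bar> \<Longrightarrow> h x = 0) \<Longrightarrow>
        (\<And>j x. j \<le> N \<Longrightarrow> cmod ((dx ^^ j) h x) \<le> B) \<Longrightarrow> cmod (T (mk_tf h)) \<le> C * B"
    using dist_bound[OF T, of L] by blast
  have "cmod (dist_deriv T (mk_tf h)) \<le> C * B"
    if h: "testfn h" "\<forall>x. L < \<bar>x\<bar> \<longrightarrow> h x = 0" "\<forall>j\<le>Suc N. \<forall>x. cmod ((dx ^^ j) h x) \<le> B" for h B
  proof -
    have "cmod (T (mk_tf (dx h))) \<le> C * B"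
    proof (rule CN(2)[OF testfn_dx[OF h(1)]])
      show "dx h x = 0" if "L < \<bar>x\<bar>" for x
        using smooth_zero_dx_pow_outside[of L h x 1] h(2) that by simp
      show "cmod ((dx ^^ j) (dx h) x) \<le> B" if "j \<le> N" for j x
        using h(3)[rule_format, of "Suc j" x] that by (simp add: funpow_swap1)
    qed
    then show ?thesis using h by (simp add: dist_deriv_def)
  qed
  then show "\<exists>C\<ge>0. \<exists>N. \<forall>h B. testfn h \<longrightarrow> (\<forall>x. L < \<bar>x\<bar> \<longrightarrow> h x = 0) \<longrightarrow>
        (\<forall>j\<le>N. \<forall>x. cmod ((dx ^^ j) h x) \<le> B) \<longrightarrow> cmod (dist_deriv T (mk_tf h)) \<le> C * B"
    using CN(1) by blast
qed

lemma conv_tf_dist_deriv: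
  assumes T: "T \<in> distributions"
  shows "conv_tf (dist_deriv T) \<phi> = dx (conv_tf T \<phi>)"
proof
  fix x
  have "dx (\<lambda>y. tf \<phi> (x - y)) = (\<lambda>y. - dx (tf \<phi>) (x - y))"
    using dx_pow_reflect[OF smooth_tf, of 1 \<phi> x] by simp
  then have "conv_tf (dist_deriv T) \<phi> x = T (mk_tf (\<lambda>y. dx (tf \<phi>) (x - y)))"
    by (simp add: conv_tf_def dist_deriv_def testfn_reflect testfn_dx dist_uminus[OF T])
  also have "\<dots> = dx (conv_tf T \<phi>) x"
    by (subst dx_conv_tf[OF T]) (simp add: conv_tf_def tf_tf_deriv)
  finally show "conv_tf (dist_deriv T) \<phi> x = dx (conv_tf T \<phi>) x" .
qed

lemma dist_deriv_pow_distributions: "T \<in> distributions \<Longrightarrow> (dist_deriv ^^ i) T \<in> distributions"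
  by (induction i) (auto intro: dist_deriv_distributions)

lemma conv_tf_pdt_dist:
  assumes T: "T \<in> distributions"
  shows "conv_tf (pdt_dist P T) \<phi> = pdt P (conv_tf T \<phi>)"
proof -
  have "conv_tf ((dist_deriv ^^ i) T) \<phi> = (dx ^^ i) (conv_tf T \<phi>)" for i
    by (induction i) (simp_all add: conv_tf_dist_deriv dist_deriv_pow_distributions T)
  then show ?thesis
    by (auto simp: fun_eq_iff pdt_def conv_tf_def pdt_dist_def)
qed

text \<open>A distribution is recovered from its regularizations: \<open>T \<phi>\<close> is the value at \<open>0\<close> of \<open>T\<close> convolved
  with the reflection of \<open>\<phi>\<close>. Identities between distributions can thus be checked as identities
  between smooth functions.\<close>

lemma conv_tf_inject:
  assumes "conv_tf S = conv_tf T"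
  shows "S = T"
proof
  fix \<phi>
  have "testfn (\<lambda>y. tf \<phi> (0 - y))" by (intro testfn_reflect testfn_tf)
  from tf_mk[OF this] have *: "T' \<phi> = conv_tf T' (mk_tf (\<lambda>y. tf \<phi> (0 - y))) 0" for T'
    by (simp add: conv_tf_def tf_inverse)
  show "S \<phi> = T \<phi>" unfolding *[of S] *[of T] assms by (rule refl)
qed

lemma conv_tf_dirac: "conv_tf dirac \<phi> = tf \<phi>"
  by (rule ext) (simp add: conv_tf_def dirac_def testfn_reflect)

section \<open>Causal solutions and the Green function\<close>

text \<open>The inverse of \<open>P(d/dt)\<close> on smooth functions that vanish far to the left. It will turn out to be
  convolution with the Green function.\<close>

definition causal_solution :: "complex poly \<Rightarrow> (real \<Rightarrow> complex) \<Rightarrow> real \<Rightarrow> complex" where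
  "causal_solution P g = (THE u. smooth u \<and> pdt P u = g \<and> (\<exists>b. \<forall>x<b. u x = 0))"

text \<open>Two solutions vanish at a common point on the far left, together with all derivatives. To determine
  them up to time \<open>c\<close> from there, only the equation up to time \<open>c\<close> is used.\<close>

lemma causal_unique:
  assumes P: "P \<noteq> 0" and uv: "smooth u" "smooth v"
    and eq: "\<And>s. s \<le> c \<Longrightarrow> pdt P u s = pdt P v s"
    and left: "\<exists>b. \<forall>x<b. u x = 0" "\<exists>b. \<forall>x<b. v x = 0" and t: "t \<le> c"
  shows "u t = v t"
proof -
  obtain b b' where b: "\<forall>x<b. u x = 0" "\<forall>x<b'. v x = 0" using left by blast
  \<comment> \<open>to the left of both supports, and not beyond the time \<open>c\<close> up to which the equations agree\<close>
  define a where "a = min c (min b b' - 1)"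
  have "(\<lambda>x. u x - v x) t = 0"
  proof (rule ode_unique[OF P, of _ a])
    show "smooth (\<lambda>x. u x - v x)" using uv by (rule smooth_diff)
    show "(dx ^^ i) (\<lambda>x. u x - v x) a = 0" for i
      by (rule smooth_zero_dx_pow_left[of "min b b'"]) (use b in \<open>auto simp: a_def\<close>)
    show "pdt P (\<lambda>x. u x - v x) s = 0" if "s \<in> closed_segment a t" for s
    proof -
      have "s \<le> c" using that t by (auto simp: closed_segment_eq_real_ivl a_def split: if_splits)
      then show ?thesis using eq by (simp add: pdt_diff uv)
    qed
  qed
  then show ?thesis by simp
qed

lemma causal_eqI:
  assumes "P \<noteq> 0" "smooth u" "pdt P u = g" "\<forall>x<b. u x = 0"
  shows "causal_solution P g = u"
  unfolding causal_solution_def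
proof (rule the_equality)
  show "v = u" if "smooth v \<and> pdt P v = g \<and> (\<exists>b. \<forall>x<b. v x = 0)" for v
  proof
    show "v x = u x" for x
      by (rule causal_unique[OF assms(1), of v u x]) (use that assms in auto)
  qed
qed (use assms in auto)

lemma causal_props:
  assumes P: "P \<noteq> 0" and g: "smooth g" "\<forall>x<b. g x = 0"
  shows "smooth (causal_solution P g)" "pdt P (causal_solution P g) = g" "x < b \<Longrightarrow> causal_solution P g x = 0"
proof -
  obtain u where u: "smooth u" "pdt P u = g" and init: "\<And>i. i < degree P \<Longrightarrow> (dx ^^ i) u (b - 1) = 0"
    using ode_exists[OF P g(1), of "b - 1"] by blast
  have "u x = 0" if "x < b" for x
  proof (rule ode_unique[OF P u(1) init])
    show "pdt P u s = 0" if "s \<in> closed_segment (b - 1) x" for s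
      using that g(2) \<open>x < b\<close> u(2) by (auto simp: closed_segment_eq_real_ivl split: if_splits)
  qed
  then have left: "\<forall>x<b. u x = 0" by blast
  note eq = causal_eqI[OF P u left]
  show "smooth (causal_solution P g)" "pdt P (causal_solution P g) = g" "x < b \<Longrightarrow> causal_solution P g x = 0"
    using u left by (simp_all add: eq)
qed

text \<open>Causality: the present does not depend on the future values of the right-hand side.\<close>

lemma causal_local:
  assumes P: "P \<noteq> 0" and g: "smooth g" "\<forall>x<b. g x = 0"
    and h: "smooth h" "\<forall>x<d. h x = 0"
    and eq: "\<And>s. s \<le> c \<Longrightarrow> g s = h s" and t: "t \<le> c"
  shows "causal_solution P g t = causal_solution P h t"
  by (rule causal_unique[OF P _ _ _ _ _ t])
    (use causal_props[OF P g] causal_props[OF P h] eq in auto)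

lemma causal_linear:
  assumes P: "P \<noteq> 0" and g: "smooth g" "\<forall>x<b. g x = 0"
    and h: "smooth h" "\<forall>x<d. h x = 0"
  shows "causal_solution P (\<lambda>x. \<alpha> * g x + \<beta> * h x) = (\<lambda>x. \<alpha> * causal_solution P g x + \<beta> * causal_solution P h x)"
  by (rule causal_eqI[OF P, where b = "min b d"])
    (use causal_props[OF P g] causal_props[OF P h] in
      \<open>auto simp: pdt_add pdt_cmult smooth_cmult intro: smooth_add\<close>)

lemma causal_translate:
  assumes P: "P \<noteq> 0" and g: "smooth g" "\<forall>x<b. g x = 0"
  shows "causal_solution P (\<lambda>x. g (a + x)) = (\<lambda>x. causal_solution P g (a + x))"
  by (rule causal_eqI[OF P, where b = "b - a"])
    (use causal_props[OF P g] in \<open>auto simp: pdt_translate intro: smooth_translate\<close>)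

text \<open>For right-hand sides that vanish left of \<open>-L\<close>, the point \<open>- \<bar>L\<bar> - 1\<close> carries zero initial data,
  so the value at \<open>0\<close> is controlled over an interval of fixed length. This is the continuity of the
  Green function.\<close>

lemma causal_bound:
  assumes P: "P \<noteq> 0"
  shows "\<exists>C\<ge>0. \<forall>g B. smooth g \<longrightarrow> (\<forall>x. x < - L \<longrightarrow> g x = 0) \<longrightarrow> (\<forall>x. cmod (g x) \<le> B) \<longrightarrow>
    cmod (causal_solution P g 0) \<le> C * B"
proof -
  obtain C where C: "C \<ge> 0" and bound: "\<And>u a t B. smooth u \<Longrightarrow> \<bar>t - a\<bar> \<le> \<bar>L\<bar> + 1 \<Longrightarrow>
      (\<And>s i. s \<in> closed_segment a t \<Longrightarrow> i \<le> 0 \<Longrightarrow> cmod ((dx ^^ i) (pdt P u) s) \<le> B) \<Longrightarrow>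
      (\<And>i. i < degree P \<Longrightarrow> cmod ((dx ^^ i) u a) \<le> B) \<Longrightarrow> cmod ((dx ^^ 0) u t) \<le> C * B"
    by (rule ode_boundE[OF P, where L = "\<bar>L\<bar> + 1" and j = 0]) blast
  have "cmod (causal_solution P g 0) \<le> C * B"
    if g: "smooth g" "\<forall>x < - L. g x = 0" and B: "\<And>x. cmod (g x) \<le> B" for g B
  proof -
    note u = causal_props[OF P g]
    have "B \<ge> 0" using B[of 0] norm_ge_zero order_trans by blast
    then show ?thesis
      using bound[OF u(1), of 0 "- \<bar>L\<bar> - 1" B] B u smooth_zero_dx_pow_left[of "- L" "causal_solution P g"]
      by simp
  qed
  with C show ?thesis by blast
qed

lemma testfn_left: "testfn f \<Longrightarrow> \<exists>b. \<forall>x<b. f x = 0"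
proof -
  assume "testfn f"
  then obtain R where "\<forall>x. R < \<bar>x\<bar> \<longrightarrow> f x = 0" unfolding testfn_def by blast
  then show ?thesis by (intro exI[of _ "min 0 (- R)"]) auto
qed

text \<open>The Green function must satisfy \<open>G \<star> \<phi> = causal_solution P \<phi>\<close>; evaluated at \<open>0\<close> for the
  reflection of \<open>\<phi>\<close>, this leaves only one candidate.\<close>

definition green_functional :: "complex poly \<Rightarrow> test_fun \<Rightarrow> complex" where
  "green_functional P \<phi> = causal_solution P (\<lambda>x. tf \<phi> (- x)) 0"

text \<open>The operator \<open>P(d/dt)\<close> commutes with translations, and so does its causal inverse.\<close>

lemma conv_tf_green_functional:
  assumes P: "P \<noteq> 0"
  shows "conv_tf (green_functional P) \<phi> = causal_solution P (tf \<phi>)"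
proof
  fix x
  obtain b where b: "\<forall>x<b. tf \<phi> x = 0" using testfn_left[OF testfn_tf] by blast
  show "conv_tf (green_functional P) \<phi> x = causal_solution P (tf \<phi>) x"
    using causal_translate[OF P smooth_tf b, of x]
    by (simp add: conv_tf_def green_functional_def testfn_reflect)
qed

lemma green_functional_distributions:
  assumes P: "P \<noteq> 0"
  shows "green_functional P \<in> distributions"
proof (rule distributionsI)
  fix a b f g assume f: "testfn f" and g: "testfn g"
  have f': "testfn (\<lambda>x. f (- x))" and g': "testfn (\<lambda>x. g (- x))"
    using testfn_reflect[OF f, of 0] testfn_reflect[OF g, of 0] by simp_all
  obtain c d where "\<forall>x<c. f (- x) = 0" "\<forall>x<d. g (- x) = 0"
    using testfn_left[OF f'] testfn_left[OF g'] by blast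
  from causal_linear[OF P testfn_smooth[OF f'] this(1) testfn_smooth[OF g'] this(2)]
  show "green_functional P (mk_tf (\<lambda>x. a * f x + b * g x)) =
      a * green_functional P (mk_tf f) + b * green_functional P (mk_tf g)"
    using f g by (simp add: green_functional_def testfn_add testfn_cmult)
next
  fix L
  obtain C where C: "C \<ge> 0" and bound: "\<And>g B. smooth g \<Longrightarrow> (\<forall>x. x < - \<bar>L\<bar> \<longrightarrow> g x = 0) \<Longrightarrow>
      (\<forall>x. cmod (g x) \<le> B) \<Longrightarrow> cmod (causal_solution P g 0) \<le> C * B"
    using causal_bound[OF P, of "\<bar>L\<bar>"] by blast
  have "cmod (green_functional P (mk_tf h)) \<le> C * B"
    if h: "testfn h" "\<forall>x. L < \<bar>x\<bar> \<longrightarrow> h x = 0" "\<forall>j\<le>0. \<forall>x. cmod ((dx ^^ j) h x) \<le> B" for h B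
    using bound[of "\<lambda>x. h (- x)" B] h smooth_reflect[of h 0] by (simp add: green_functional_def testfn_smooth)
  with C show "\<exists>C\<ge>0. \<exists>N. \<forall>h B. testfn h \<longrightarrow> (\<forall>x. L < \<bar>x\<bar> \<longrightarrow> h x = 0) \<longrightarrow>
      (\<forall>j\<le>N. \<forall>x. cmod ((dx ^^ j) h x) \<le> B) \<longrightarrow> cmod (green_functional P (mk_tf h)) \<le> C * B"
    by blast
qed

text \<open>A distribution supported in \<open>[0, \<infinity>)\<close> is the causal solution of its own equation, after
  regularization.\<close>

lemma conv_tf_causal_eq:
  assumes P: "P \<noteq> 0" and T: "T \<in> distributions" "vanishes_on T {..<0}"
  shows "conv_tf T \<phi> = causal_solution P (conv_tf (pdt_dist P T) \<phi>)"
proof -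
  obtain R where R: "\<And>y. R < \<bar>y\<bar> \<Longrightarrow> tf \<phi> y = 0" using testfn_tf unfolding testfn_def by blast
  have "\<forall>x < - R. conv_tf T \<phi> x = 0" using conv_tf_vanishes_left[OF T(2) R] by blast
  from causal_eqI[OF P smooth_conv_tf[OF T(1)] conv_tf_pdt_dist[OF T(1), symmetric] this]
  show ?thesis by simp
qed

text \<open>The description in \<^const>\<open>green\<close> is satisfied, since after regularization
  \<open>P(d/dt) G = \<delta>\<close> says that the causal solution solves its equation. It is unique, since every
  candidate has the same regularizations.\<close>

lemma green_eq:
  assumes P: "P \<noteq> 0"
  shows "green P = green_functional P"
  unfolding green_def
proof (rule the_equality)
  have "conv_tf (pdt_dist P (green_functional P)) \<phi> = conv_tf dirac \<phi>" for \<phi>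
  proof -
    obtain b where b: "\<forall>x<b. tf \<phi> x = 0" using testfn_left[OF testfn_tf] by blast
    show ?thesis
      by (simp add: conv_tf_pdt_dist green_functional_distributions[OF P] conv_tf_green_functional[OF P]
        causal_props(2)[OF P smooth_tf b] conv_tf_dirac)
  qed
  then have 1: "pdt_dist P (green_functional P) = dirac" by (intro conv_tf_inject) auto
  have "green_functional P \<phi> = 0" if "supp (tf \<phi>) \<subseteq> {..<0}" for \<phi>
  proof (cases "supp (tf \<phi>) = {}")
    case True
    then have "tf \<phi> (- x) = 0" for x using in_supp[of "tf \<phi>"] by blast
    then show ?thesis
      unfolding green_functional_def
      using causal_props(3)[OF P, of "\<lambda>x. tf \<phi> (- x)" 1 0] smooth_reflect[OF smooth_tf, of \<phi> 0] by simp
  next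
    case False
    have "compact (supp (tf \<phi>))" using testfn_tf testfn_iff by blast
    from compact_attains_sup[OF this False] obtain m where
      m: "m \<in> supp (tf \<phi>)" "\<And>x. x \<in> supp (tf \<phi>) \<Longrightarrow> x \<le> m" by blast
    have "m < 0" using m(1) that by auto
    moreover have "tf \<phi> (- x) = 0" if "x < - m" for x
      using that m(2)[of "- x"] in_supp[of "tf \<phi>" "- x"] by auto
    ultimately show ?thesis
      unfolding green_functional_def
      using causal_props(3)[OF P, of "\<lambda>x. tf \<phi> (- x)" "- m" 0] smooth_reflect[OF smooth_tf, of \<phi> 0] by simp
  qed
  then show "green_functional P \<in> distributions \<and> pdt_dist P (green_functional P) = dirac \<and>
      vanishes_on (green_functional P) {..<0}"
    using 1 green_functional_distributions[OF P] by (auto simp: vanishes_on_def)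
next
  fix G assume G: "G \<in> distributions \<and> pdt_dist P G = dirac \<and> vanishes_on G {..<0}"
  then have G1: "G \<in> distributions" and G2: "pdt_dist P G = dirac" and G3: "vanishes_on G {..<0}"
    by blast+
  show "G = green_functional P"
  proof (rule conv_tf_inject, rule ext)
    show "conv_tf G \<phi> = conv_tf (green_functional P) \<phi>" for \<phi>
      unfolding conv_tf_causal_eq[OF P G1 G3] G2 conv_tf_dirac conv_tf_green_functional[OF P]
      by (rule refl)
  qed
qed

text \<open>Regularization turns \<open>G \<star> S\<close> into \<open>G\<close> applied to \<open>z \<mapsto> cutoff z (S \<star> \<phi>) (x - z)\<close>, that is, into
  the value at \<open>0\<close> of the causal solution with right-hand side \<open>cutoff (- z) (S \<star> \<phi>) (x + z)\<close>. By
  causality only \<open>z \<le> 0\<close> matters, where the cutoff factor is \<open>1\<close>.\<close>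

lemma conv_tf_dist_conv_green:
  assumes P: "P \<noteq> 0" and S: "S \<in> dist_plus"
    and cut: "smooth cutoff" "\<And>x. - 1 \<le> x \<Longrightarrow> cutoff x = 1" "\<And>x. x \<le> - 2 \<Longrightarrow> cutoff x = 0"
  shows "conv_tf (dist_conv (green P) S) \<phi> = causal_solution P (conv_tf S \<phi>)"
proof
  fix x
  have SD: "S \<in> distributions" and S0: "vanishes_on S {..<0}"
    using S by (auto simp: dist_plus_def Compl_atLeast)
  obtain R where R: "\<And>y. R < \<bar>y\<bar> \<Longrightarrow> tf \<phi> y = 0" using testfn_tf unfolding testfn_def by blast
  have left: "\<forall>y < - R. conv_tf S \<phi> y = 0"
    using conv_tf_vanishes_left[OF S0 R] by blast
  have sm: "smooth (\<lambda>z. conv_tf S \<phi> (x - z))" "smooth (\<lambda>z. conv_tf S \<phi> (x + z))"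
    by (intro smooth_reflect smooth_translate smooth_conv_tf SD)+
  have inner: "S (mk_tf (\<lambda>y. tf (mk_tf (\<lambda>y. tf \<phi> (x - y))) (z + y))) = conv_tf S \<phi> (x - z)" for z
    by (simp add: conv_tf_def testfn_reflect diff_diff_eq)
  have test: "testfn (\<lambda>z. cutoff z * conv_tf S \<phi> (x - z))"
  proof (rule testfnI[of _ "max 2 (\<bar>x\<bar> + \<bar>R\<bar>)"])
    show "smooth (\<lambda>z. cutoff z * conv_tf S \<phi> (x - z))" by (intro smooth_mult cut sm)
    show "cutoff z * conv_tf S \<phi> (x - z) = 0" if "max 2 (\<bar>x\<bar> + \<bar>R\<bar>) < \<bar>z\<bar>" for z
    proof (cases "z < 0")
      case True
      then show ?thesis using that cut(3)[of z] by simp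
    next
      case False
      then have "x - z < - R" using that by linarith
      then show ?thesis using left by simp
    qed
  qed
  have "conv_tf (dist_conv (green P) S) \<phi> x = dist_conv (green P) S (mk_tf (\<lambda>y. tf \<phi> (x - y)))"
    by (simp add: conv_tf_def)
  also have "\<dots> = green_functional P (mk_tf (\<lambda>z. cutoff z * conv_tf S \<phi> (x - z)))"
    unfolding dist_conv_def green_eq[OF P] inner by (rule refl)
  also have "\<dots> = causal_solution P (\<lambda>z. cutoff (- z) * conv_tf S \<phi> (x + z)) 0"
    by (simp add: green_functional_def test)
  also have "\<dots> = causal_solution P (\<lambda>z. conv_tf S \<phi> (x + z)) 0"
  proof (rule causal_local[OF P, where b = "- R - x" and d = "- R - x" and c = 0])
    show "smooth (\<lambda>z. cutoff (- z) * conv_tf S \<phi> (x + z))"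
      using smooth_reflect[OF cut(1), of 0] by (intro smooth_mult sm) simp
  qed (use left sm cut in auto)
  also have "\<dots> = causal_solution P (conv_tf S \<phi>) x"
    using causal_translate[OF P smooth_conv_tf[OF SD] left, of x] by simp
  finally show "conv_tf (dist_conv (green P) S) \<phi> x = causal_solution P (conv_tf S \<phi>) x" .
qed

section \<open>Regular distributions and the cutoff function\<close>

lemma integrable_compact_support:
  fixes F :: "real \<Rightarrow> complex"
  assumes "\<And>x. isCont F x" and "\<And>x. R < \<bar>x\<bar> \<Longrightarrow> F x = 0"
  shows "integrable lborel F"
proof -
  have "F = (\<lambda>x. indicator {-R..R} x *\<^sub>R F x)"
    using assms(2) by (auto simp: fun_eq_iff indicator_def abs_if split: if_splits)
  moreover have "integrable lborel (\<lambda>x. indicator {-R..R} x *\<^sub>R F x)"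
    by (rule borel_integrable_compact) (auto intro: continuous_at_imp_continuous_on assms(1))
  ultimately show ?thesis by simp
qed

lemma integral_compact_support_bound:
  fixes F :: "real \<Rightarrow> complex"
  assumes "\<And>x. isCont F x" and "\<And>x. R < \<bar>x\<bar> \<Longrightarrow> F x = 0"
    and "\<And>x. cmod (F x) \<le> M" and "R \<ge> 0"
  shows "cmod (LINT x|lborel. F x) \<le> M * (2 * R)"
proof -
  have "cmod (LINT x|lborel. F x) \<le> (LINT x|lborel. M * indicator {-R..R} x)"
  proof (rule Bochner_Integration.integral_norm_bound_integral)
    show "integrable lborel F" by (rule integrable_compact_support) (use assms in auto)
    show "integrable lborel (\<lambda>x. M * indicator {-R..R} x)"
      by (intro integrable_mult_right integrable_real_indicator) (auto simp: emeasure_lborel_Icc_eq)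
    show "cmod (F x) \<le> M * indicator {-R..R} x" for x
      using assms(2,3)[of x] by (auto simp: indicator_def)
  qed
  also have "\<dots> = M * (2 * R)" using assms(4) by simp
  finally show ?thesis .
qed

lemma integral_derivative:
  fixes F :: "real \<Rightarrow> complex"
  assumes "\<And>x. (F has_vector_derivative f x) (at x)" and "\<And>x. isCont f x"
    and "\<And>x. x \<notin> {a..b} \<Longrightarrow> f x = 0" and "a \<le> b"
  shows "(LINT x|lborel. f x) = F b - F a"
proof -
  have "(LINT x|lborel. indicator {a..b} x *\<^sub>R f x) = F b - F a"
    by (rule integral_FTC_Icc)
      (use assms in \<open>auto intro: has_vector_derivative_at_within continuous_at_imp_continuous_on\<close>)
  moreover have "(\<lambda>x. indicator {a..b} x *\<^sub>R f x) = f"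
    using assms(3) by (auto simp: fun_eq_iff indicator_def)
  ultimately show ?thesis by simp
qed

lemma integrable_smooth_testfn: "smooth h \<Longrightarrow> testfn f \<Longrightarrow> integrable lborel (\<lambda>x. h x * f x)"
proof -
  assume h: "smooth h" and f: "testfn f"
  then obtain R where "\<And>x. R < \<bar>x\<bar> \<Longrightarrow> f x = 0" unfolding testfn_def by blast
  then show ?thesis
    by (intro integrable_compact_support[of _ R]) (auto intro: smooth_cont smooth_mult h testfn_smooth f)
qed

lemma regular_dist_distributions:
  assumes h: "smooth h"
  shows "regular_dist h \<in> distributions"
proof (rule distributionsI)
  fix a b f g assume f: "testfn f" and g: "testfn g"
  show "regular_dist h (mk_tf (\<lambda>x. a * f x + b * g x)) =
      a * regular_dist h (mk_tf f) + b * regular_dist h (mk_tf g)"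
    using f g integrable_smooth_testfn[OF h f] integrable_smooth_testfn[OF h g]
    by (simp add: regular_dist_def testfn_add testfn_cmult distrib_left mult.left_commute)
next
  fix L :: real
  have "compact (h ` {-L..L})"
    by (intro compact_continuous_image smooth_continuous_on h) auto
  then obtain M where M: "\<And>x. x \<in> {-L..L} \<Longrightarrow> cmod (h x) \<le> M"
    using compact_imp_bounded by (force simp: bounded_iff)
  have "cmod (regular_dist h (mk_tf f)) \<le> (\<bar>M\<bar> * (2 * \<bar>L\<bar>)) * B"
    if f: "testfn f" "\<forall>x. L < \<bar>x\<bar> \<longrightarrow> f x = 0" and B: "\<forall>j\<le>0. \<forall>x. cmod ((dx ^^ j) f x) \<le> B" for f B
  proof -
    have B': "cmod (f x) \<le> B" for x using B by simp
    then have "B \<ge> 0" using norm_ge_zero order_trans by blast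
    have "cmod (LINT x|lborel. h x * f x) \<le> (\<bar>M\<bar> * B) * (2 * \<bar>L\<bar>)"
    proof (rule integral_compact_support_bound)
      show "isCont (\<lambda>x. h x * f x) x" for x by (intro smooth_cont smooth_mult h testfn_smooth f)
      show "h x * f x = 0" if "\<bar>L\<bar> < \<bar>x\<bar>" for x using f(2) that by auto
      show "cmod (h x * f x) \<le> \<bar>M\<bar> * B" for x
      proof (cases "L < \<bar>x\<bar>")
        case False
        then have "x \<in> {-L..L}" by auto
        then have "cmod (h x) \<le> \<bar>M\<bar>" using M[of x] by simp
        then show ?thesis unfolding norm_mult using B' \<open>B \<ge> 0\<close> by (intro mult_mono) auto
      qed (use f(2) \<open>B \<ge> 0\<close> in auto)
    qed simp
    then show ?thesis using f(1) by (simp add: regular_dist_def mult_ac)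
  qed
  then show "\<exists>C\<ge>0. \<exists>N. \<forall>f B. testfn f \<longrightarrow> (\<forall>x. L < \<bar>x\<bar> \<longrightarrow> f x = 0) \<longrightarrow>
      (\<forall>j\<le>N. \<forall>x. cmod ((dx ^^ j) f x) \<le> B) \<longrightarrow> cmod (regular_dist h (mk_tf f)) \<le> C * B"
    by (intro exI[of _ "\<bar>M\<bar> * (2 * \<bar>L\<bar>)"] conjI exI[of _ 0]) auto
qed

lemma conv_tf_regular: "conv_tf (regular_dist h) \<phi> x = (LINT y|lborel. h y * tf \<phi> (x - y))"
  by (simp add: conv_tf_def regular_dist_def testfn_reflect)

text \<open>Integration by parts moves the derivative from \<open>\<phi>\<close> to \<open>h\<close>.\<close>

lemma dx_conv_tf_regular:
  assumes h: "smooth h"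
  shows "dx (conv_tf (regular_dist h) \<phi>) = conv_tf (regular_dist (dx h)) \<phi>"
proof
  fix x
  obtain R where R: "\<And>y. R < \<bar>y\<bar> \<Longrightarrow> tf \<phi> y = 0" using testfn_tf unfolding testfn_def by blast
  define L where "L = \<bar>x\<bar> + \<bar>R\<bar> + 1"
  have D: "((\<lambda>y. h y * tf \<phi> (x - y)) has_vector_derivative
      dx h y * tf \<phi> (x - y) - h y * dx (tf \<phi>) (x - y)) (at y)" for y
    using has_vector_derivative_mult[OF smooth_has_dx[OF h] has_dx_affine[OF smooth_tf], of \<phi> x "-1" y]
    by (simp add: algebra_simps)
  have far: "tf \<phi> (x - y) = 0" "dx (tf \<phi>) (x - y) = 0" if "L \<le> \<bar>y\<bar>" for y
  proof -
    have "R < \<bar>x - y\<bar>" using that unfolding L_def by linarith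
    then show "tf \<phi> (x - y) = 0" "dx (tf \<phi>) (x - y) = 0"
      using R smooth_zero_dx_pow_outside[of R "tf \<phi>" "x - y" 1] by auto
  qed
  have "(LINT y|lborel. dx h y * tf \<phi> (x - y) - h y * dx (tf \<phi>) (x - y))
      = h L * tf \<phi> (x - L) - h (- L) * tf \<phi> (x - - L)"
  proof (rule integral_derivative[OF D])
    show "isCont (\<lambda>y. dx h y * tf \<phi> (x - y) - h y * dx (tf \<phi>) (x - y)) y" for y
      by (intro smooth_cont smooth_diff smooth_mult smooth_dx h smooth_reflect smooth_tf)
    show "dx h y * tf \<phi> (x - y) - h y * dx (tf \<phi>) (x - y) = 0" if "y \<notin> {- L..L}" for y
    proof -
      have "L \<le> \<bar>y\<bar>" using that by auto
      then show ?thesis using far by simp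
    qed
  qed (simp add: L_def)
  also have "\<dots> = 0" using far[of L] far[of "- L"] by (simp add: L_def)
  finally have "(LINT y|lborel. dx h y * tf \<phi> (x - y)) = (LINT y|lborel. h y * dx (tf \<phi>) (x - y))"
    using integrable_smooth_testfn[OF smooth_dx[OF h] testfn_reflect[OF testfn_tf], of \<phi> x]
      integrable_smooth_testfn[OF h testfn_reflect[OF testfn_dx[OF testfn_tf]], of \<phi> x]
    by simp
  then show "dx (conv_tf (regular_dist h) \<phi>) x = conv_tf (regular_dist (dx h)) \<phi> x"
    unfolding dx_conv_tf[OF regular_dist_distributions[OF h]] conv_tf_regular tf_tf_deriv by simp
qed

lemma dx_pow_conv_tf_regular:
  "smooth h \<Longrightarrow> (dx ^^ j) (conv_tf (regular_dist h) \<phi>) = conv_tf (regular_dist ((dx ^^ j) h)) \<phi>"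
  by (induction j) (simp_all add: dx_conv_tf_regular smooth_dx_pow)

text \<open>Solutions of the homogeneous equation remain solutions after regularization.\<close>

lemma pdt_conv_tf_regular:
  assumes h: "smooth h"
  shows "pdt P (conv_tf (regular_dist h) \<phi>) = conv_tf (regular_dist (pdt P h)) \<phi>"
proof
  fix x
  have int: "integrable lborel (\<lambda>y. (dx ^^ i) h y * tf \<phi> (x - y))" for i
    by (intro integrable_smooth_testfn smooth_dx_pow h testfn_reflect testfn_tf)
  have "(LINT y|lborel. (\<Sum>i\<le>degree P. coeff P i * ((dx ^^ i) h y * tf \<phi> (x - y))))
      = (\<Sum>i\<le>degree P. coeff P i * (LINT y|lborel. (dx ^^ i) h y * tf \<phi> (x - y)))"
    using int by (subst Bochner_Integration.integral_sum) auto
  then show "pdt P (conv_tf (regular_dist h) \<phi>) x = conv_tf (regular_dist (pdt P h)) \<phi> x"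
    by (simp add: conv_tf_regular pdt_def dx_pow_conv_tf_regular h sum_distrib_right mult.assoc)
qed

text \<open>A cutoff function is an antiderivative of a function with integral \<open>1\<close> and support inside
  \<open>(-2, -1)\<close>, and such a function is obtained by rescaling a test function with integral \<open>1\<close>. The
  antiderivative that vanishes on the left is a causal solution for the polynomial \<open>x\<close>.\<close>

lemma cutoff_props:
  assumes \<phi>: "\<And>x. 1 < \<bar>x\<bar> \<Longrightarrow> tf \<phi> x = 0" "(LINT x|lborel. tf \<phi> x) = 1"
  shows "smooth cutoff" "- 1 \<le> x \<Longrightarrow> cutoff x = 1" "x \<le> - 2 \<Longrightarrow> cutoff x = 0"
proof -
  \<comment> \<open>\<open>6 + 4 x\<close> maps \<open>[-7/4, -5/4]\<close> onto \<open>[-1, 1]\<close>\<close>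
  define \<psi> where "\<psi> = (\<lambda>x. 4 * tf \<phi> (6 + 4 * x))"
  have sm: "smooth \<psi>" unfolding \<psi>_def by (intro smooth_cmult smooth_affine smooth_tf)
  have zero: "\<psi> x = 0" if "x < - 7 / 4 \<or> - 5 / 4 < x" for x
    using that by (auto simp: \<psi>_def intro!: \<phi>(1))
  define u where "u = causal_solution [:0, 1:] \<psi>"
  have "\<forall>x < - 7 / 4. \<psi> x = 0" using zero by blast
  from causal_props[OF _ sm this, of "[:0, 1:]"] have u: "smooth u" "pdt [:0, 1:] u = \<psi>"
    and left: "\<And>x. x < - 7 / 4 \<Longrightarrow> u x = 0"
    unfolding u_def by auto
  have du: "dx u = \<psi>"
    unfolding u(2)[symmetric] by (rule ext) (simp add: pdt_pCons pdt_const_poly)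
  have "(LINT x|lborel. \<psi> x) = 1"
    using lborel_integral_real_affine[of 4 "tf \<phi>" 6] \<phi>(2)
    by (simp add: \<psi>_def scaleR_conv_of_real)
  moreover have "(LINT x|lborel. \<psi> x) = u x - u (- 2)" if "- 1 \<le> x" for x
    by (rule integral_derivative)
      (use that smooth_has_dx[OF u(1)] zero sm in \<open>auto simp: du intro: smooth_cont\<close>)
  ultimately have "u x = 1" if "- 1 \<le> x" for x
    using that left[of "- 2"] by simp
  then have "smooth u \<and> (\<forall>x\<ge>- 1. u x = 1) \<and> (\<forall>x\<le>- 2. u x = 0)"
    using u left by auto
  then have "smooth cutoff \<and> (\<forall>x\<ge>- 1. cutoff x = 1) \<and> (\<forall>x\<le>- 2. cutoff x = 0)"
    unfolding cutoff_def by (rule someI[where P = "\<lambda>h. smooth h \<and> (\<forall>x\<ge>- 1. h x = 1) \<and> (\<forall>x\<le>- 2. h x = 0)"])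
  then show "smooth cutoff" "- 1 \<le> x \<Longrightarrow> cutoff x = 1" "x \<le> - 2 \<Longrightarrow> cutoff x = 0"
    by auto
qed

section \<open>The radius of a test function\<close>

lemma radius_bound: "radius \<phi> < \<bar>x\<bar> \<Longrightarrow> tf \<phi> x = 0"
proof (rule ccontr)
  assume *: "radius \<phi> < \<bar>x\<bar>" "tf \<phi> x \<noteq> 0"
  obtain R where R: "\<And>y. R < \<bar>y\<bar> \<Longrightarrow> tf \<phi> y = 0" using testfn_tf unfolding testfn_def by blast
  have "\<bar>x\<bar> \<le> Sup {\<bar>x\<bar> | x. tf \<phi> x \<noteq> 0}"
  proof (rule cSup_upper)
    show "bdd_above {\<bar>x\<bar> | x. tf \<phi> x \<noteq> 0}"
      by (rule bdd_aboveI[of _ R]) (use R not_le in blast)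
  qed (use * in auto)
  then show False using * by (auto simp: radius_def split: if_splits)
qed

text \<open>By continuity, a test function that is not zero cannot be supported at \<open>0\<close> alone.\<close>

lemma radius_pos: "0 < radius \<phi>"
proof (cases "\<forall>x. tf \<phi> x = 0")
  case False
  then obtain x where x: "tf \<phi> x \<noteq> 0" by blast
  show ?thesis
  proof (rule ccontr)
    assume "\<not> 0 < radius \<phi>"
    then have zero: "tf \<phi> y = 0" if "y \<noteq> 0" for y using radius_bound[of \<phi> y] that by auto
    have "(tf \<phi> \<longlongrightarrow> tf \<phi> 0) (at 0)" using smooth_cont[OF smooth_tf] by (simp add: isCont_def)
    moreover have "(tf \<phi> \<longlongrightarrow> 0) (at 0)"
      by (rule tendsto_eventually) (auto simp: eventually_at_filter zero)
    ultimately have "tf \<phi> 0 = 0" using tendsto_unique trivial_limit_at by blast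
    then show False using x zero by metis
  qed
qed (simp add: radius_def)

section \<open>Quotients of rings of functions\<close>

text \<open>The rings of nets are subrings of rings of functions with pointwise operations. The passage to
  quotients is done here once for both.\<close>

definition pointwise_ring :: "'a::comm_ring_1 set \<Rightarrow> 'a ring" where
  "pointwise_ring S = \<lparr>carrier = S, mult = (*), one = 1, zero = 0, add = (+)\<rparr>"

lemma pointwise_ring_simps [simp]:
  "carrier (pointwise_ring S) = S" "x \<otimes>\<^bsub>pointwise_ring S\<^esub> y = x * y"
  "x \<oplus>\<^bsub>pointwise_ring S\<^esub> y = x + y" "\<one>\<^bsub>pointwise_ring S\<^esub> = 1" "\<zero>\<^bsub>pointwise_ring S\<^esub> = 0"
  by (simp_all add: pointwise_ring_def)

locale subring_ideal =
  fixes S I :: "'a::comm_ring_1 set"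
  assumes one_S: "1 \<in> S"
    and add_S: "x \<in> S \<Longrightarrow> y \<in> S \<Longrightarrow> x + y \<in> S"
    and mult_S: "x \<in> S \<Longrightarrow> y \<in> S \<Longrightarrow> x * y \<in> S"
    and uminus_S: "x \<in> S \<Longrightarrow> - x \<in> S"
    and zero_I: "0 \<in> I"
    and add_I: "x \<in> I \<Longrightarrow> y \<in> I \<Longrightarrow> x + y \<in> I"
    and mult_I: "x \<in> S \<Longrightarrow> y \<in> I \<Longrightarrow> x * y \<in> I"
    and I_S: "I \<subseteq> S"
begin

abbreviation R :: "'a ring" where "R \<equiv> pointwise_ring S"

lemma zero_S: "0 \<in> S"
  using zero_I I_S by blast

lemma uminus_I: "x \<in> I \<Longrightarrow> - x \<in> I"
  using mult_I[OF uminus_S[OF one_S], of x] by simp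

lemma diff_I: "x \<in> I \<Longrightarrow> y \<in> I \<Longrightarrow> x - y \<in> I"
  using add_I[OF _ uminus_I, of x y] by simp

lemma cring_R: "cring R"
proof (rule cringI)
  show "abelian_group R"
  proof (rule abelian_groupI)
    show "\<exists>y\<in>carrier R. y \<oplus>\<^bsub>R\<^esub> x = \<zero>\<^bsub>R\<^esub>" if "x \<in> carrier R" for x
      using that uminus_S by (intro bexI[of _ "- x"]) auto
  qed (auto simp: add_S zero_S add_ac)
  show "comm_monoid R"
    by (rule comm_monoidI) (auto simp: mult_S one_S mult_ac)
qed (auto simp: distrib_right)

lemma a_inv_R: "x \<in> S \<Longrightarrow> \<ominus>\<^bsub>R\<^esub> x = - x"
proof -
  interpret cring R by (rule cring_R)
  show "x \<in> S \<Longrightarrow> \<ominus>\<^bsub>R\<^esub> x = - x"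
    by (rule minus_equality) (auto intro: uminus_S)
qed

lemma ideal_R: "ideal I R"
proof (rule idealI)
  interpret cring R by (rule cring_R)
  show "ring R" by (rule ring_axioms)
  show "subgroup I (add_monoid R)"
  proof (rule group.subgroupI)
    show "Group.group (add_monoid R)" by (rule add.group_axioms)
    show "inv\<^bsub>add_monoid R\<^esub> a \<in> I" if "a \<in> I" for a
      using a_inv_R[of a] uminus_I[OF that] I_S that unfolding a_inv_def by auto
  qed (use I_S zero_I add_I in auto)
  show "a \<otimes>\<^bsub>R\<^esub> x \<in> I" if "a \<in> I" "x \<in> carrier R" for a x
    using mult_I[of x a] that by (simp add: mult.commute)
qed (simp add: mult_I)

text \<open>Cosets are described by differences, which is how the choice of a representative is shown to be
  immaterial.\<close>

lemma coset_mem: "y \<in> I +>\<^bsub>R\<^esub> x \<longleftrightarrow> y - x \<in> I"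
proof -
  have "(\<exists>h\<in>I. y = h + x) \<longleftrightarrow> y - x \<in> I"
    by (metis add_diff_cancel_right' diff_add_cancel)
  then show ?thesis by (simp add: a_r_coset_def')
qed

lemma coset_eq_iff: "I +>\<^bsub>R\<^esub> x = I +>\<^bsub>R\<^esub> y \<longleftrightarrow> x - y \<in> I"
proof
  assume "I +>\<^bsub>R\<^esub> x = I +>\<^bsub>R\<^esub> y"
  moreover have "x \<in> I +>\<^bsub>R\<^esub> x" by (simp add: coset_mem zero_I)
  ultimately show "x - y \<in> I" by (simp add: coset_mem)
next
  assume *: "x - y \<in> I"
  have "z - x \<in> I \<longleftrightarrow> z - y \<in> I" for z
    using add_I[OF _ *, of "z - x"] diff_I[OF _ *, of "z - y"] by auto
  then show "I +>\<^bsub>R\<^esub> x = I +>\<^bsub>R\<^esub> y" by (auto simp: coset_mem)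
qed

lemma rep_coset: "rep (I +>\<^bsub>R\<^esub> x) - x \<in> I"
proof -
  have "x \<in> I +>\<^bsub>R\<^esub> x" by (simp add: coset_mem zero_I)
  then have "rep (I +>\<^bsub>R\<^esub> x) \<in> I +>\<^bsub>R\<^esub> x" unfolding rep_def by (rule someI)
  then show ?thesis by (simp add: coset_mem)
qed

lemma carrier_Quot: "carrier (R Quot I) = (\<lambda>x. I +>\<^bsub>R\<^esub> x) ` S"
  by (auto simp: FactRing_def A_RCOSETS_def')

lemma hom_Quot: "ring_hom_cring R (R Quot I) (\<lambda>x. I +>\<^bsub>R\<^esub> x)"
  using ideal.rcos_ring_hom_cring[OF ideal_R cring_R] .

lemma finsum_R:
  assumes "finite A" "f ` A \<subseteq> S"
  shows "finsum R f A = sum f A"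
proof -
  interpret cring R by (rule cring_R)
  show ?thesis
    using assms
  proof (induction A rule: finite_induct)
    case (insert a A)
    then have "f \<in> A \<rightarrow> carrier R" by auto
    then show ?case using insert by simp
  qed simp
qed

lemma finprod_R:
  assumes "finite A" "f ` A \<subseteq> S"
  shows "finprod R f A = prod f A"
proof -
  interpret cring R by (rule cring_R)
  show ?thesis
    using assms
  proof (induction A rule: finite_induct)
    case (insert a A)
    then have "f \<in> A \<rightarrow> carrier R" by auto
    then show ?case using insert by simp
  qed simp
qed

lemma sum_S: "f ` A \<subseteq> S \<Longrightarrow> sum f A \<in> S"
  by (induction A rule: infinite_finite_induct) (auto simp: zero_S add_S)

lemma prod_S: "f ` A \<subseteq> S \<Longrightarrow> prod f A \<in> S"
  by (induction A rule: infinite_finite_induct) (auto simp: one_S mult_S)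

lemma finsum_Quot:
  assumes "finite A" "f ` A \<subseteq> S"
  shows "(\<Oplus>\<^bsub>R Quot I\<^esub>i\<in>A. I +>\<^bsub>R\<^esub> f i) = I +>\<^bsub>R\<^esub> sum f A"
proof -
  interpret ring_hom_cring R "R Quot I" "\<lambda>x. I +>\<^bsub>R\<^esub> x" by (rule hom_Quot)
  show ?thesis
    using hom_finsum[of f A] assms by (auto simp: finsum_R o_def)
qed

lemma finprod_Quot:
  assumes "finite A" "f ` A \<subseteq> S"
  shows "(\<Otimes>\<^bsub>R Quot I\<^esub>i\<in>A. I +>\<^bsub>R\<^esub> f i) = I +>\<^bsub>R\<^esub> prod f A"
proof -
  interpret ring_hom_cring R "R Quot I" "\<lambda>x. I +>\<^bsub>R\<^esub> x" by (rule hom_Quot)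
  show ?thesis
    using hom_finprod[of f A] assms by (auto simp: finprod_R o_def)
qed

context
begin

interpretation q: ring_hom_cring R "R Quot I" "\<lambda>x. I +>\<^bsub>R\<^esub> x"
  by (rule hom_Quot)

lemma mult_Quot:
  "x \<in> S \<Longrightarrow> y \<in> S \<Longrightarrow> (I +>\<^bsub>R\<^esub> x) \<otimes>\<^bsub>R Quot I\<^esub> (I +>\<^bsub>R\<^esub> y) = I +>\<^bsub>R\<^esub> (x * y)"
  using q.hom_mult[of x y] by simp

lemma add_Quot:
  "x \<in> S \<Longrightarrow> y \<in> S \<Longrightarrow> (I +>\<^bsub>R\<^esub> x) \<oplus>\<^bsub>R Quot I\<^esub> (I +>\<^bsub>R\<^esub> y) = I +>\<^bsub>R\<^esub> (x + y)"
  using q.hom_add[of x y] by simp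

lemma one_Quot: "\<one>\<^bsub>R Quot I\<^esub> = I +>\<^bsub>R\<^esub> 1"
  using q.hom_one by simp

lemma zero_Quot: "\<zero>\<^bsub>R Quot I\<^esub> = I +>\<^bsub>R\<^esub> 0"
  using q.hom_zero by simp

lemma uminus_Quot: "x \<in> S \<Longrightarrow> \<ominus>\<^bsub>R Quot I\<^esub> (I +>\<^bsub>R\<^esub> x) = I +>\<^bsub>R\<^esub> (- x)"
  using q.hom_a_inv[of x] by (simp add: a_inv_R)

end

lemma cring_Quot: "cring (R Quot I)"
  using ring_hom_cring.axioms(2)[OF hom_Quot] .

lemma inverse_Quot:
  assumes "x \<in> S" "y \<in> S" "x * y - 1 \<in> I"
  shows "inv\<^bsub>R Quot I\<^esub> (I +>\<^bsub>R\<^esub> x) = I +>\<^bsub>R\<^esub> y"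
proof -
  interpret Q: cring "R Quot I" by (rule cring_Quot)
  have "(I +>\<^bsub>R\<^esub> x) \<otimes>\<^bsub>R Quot I\<^esub> (I +>\<^bsub>R\<^esub> y) = \<one>\<^bsub>R Quot I\<^esub>"
    using assms by (simp add: mult_Quot one_Quot coset_eq_iff)
  then show ?thesis
    using assms by (intro Q.comm_inv_char) (auto simp: carrier_Quot)
qed

lemma sign_Quot:
  assumes "x \<in> S"
  shows "[sign p] \<cdot>\<^bsub>R Quot I\<^esub> (I +>\<^bsub>R\<^esub> x) = I +>\<^bsub>R\<^esub> (of_int (sign p) * x)"
proof -
  interpret Q: cring "R Quot I" by (rule cring_Quot)
  have c: "I +>\<^bsub>R\<^esub> x \<in> carrier (R Quot I)" using assms by (simp add: carrier_Quot)
  have 1: "[(1::int)] \<cdot>\<^bsub>R Quot I\<^esub> (I +>\<^bsub>R\<^esub> x) = I +>\<^bsub>R\<^esub> x"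
    using Q.add.int_pow_1[of "I +>\<^bsub>R\<^esub> x"] c by (simp add: add_pow_def)
  have "[(- 1::int)] \<cdot>\<^bsub>R Quot I\<^esub> (I +>\<^bsub>R\<^esub> x) = \<ominus>\<^bsub>R Quot I\<^esub> ([(1::int)] \<cdot>\<^bsub>R Quot I\<^esub> (I +>\<^bsub>R\<^esub> x))"
    using Q.add.int_pow_neg[of "I +>\<^bsub>R\<^esub> x" 1] c by (simp add: add_pow_def a_inv_def)
  then show ?thesis
    using 1 assms by (cases "sign p = 1") (auto simp: sign_def uminus_Quot)
qed

text \<open>A determinant is a polynomial in its entries, so it is computed on representatives.\<close>

lemma ring_det_Quot:
  assumes "\<And>i n. i \<in> {1..k} \<Longrightarrow> n \<in> {1..k} \<Longrightarrow> A i n \<in> S"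
  shows "ring_det (R Quot I) k (\<lambda>i n. I +>\<^bsub>R\<^esub> A i n)
    = I +>\<^bsub>R\<^esub> (\<Sum>p | p permutes {1..k}. of_int (sign p) * (\<Prod>i\<in>{1..k}. A i (p i)))"
proof -
  interpret Q: cring "R Quot I" by (rule cring_Quot)
  have sub: "(\<lambda>i. A i (p i)) ` {1..k} \<subseteq> S" if "p permutes {1..k}" for p
    using assms permutes_in_image[OF that] by auto
  have sgn_S: "of_int (sign p) * x \<in> S" if "x \<in> S" for x and p :: "nat \<Rightarrow> nat"
    using that uminus_S by (cases "sign p = 1") (auto simp: sign_def)
  have summand: "[sign p] \<cdot>\<^bsub>R Quot I\<^esub> (\<Otimes>\<^bsub>R Quot I\<^esub>i\<in>{1..k}. I +>\<^bsub>R\<^esub> A i (p i))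
      = I +>\<^bsub>R\<^esub> (of_int (sign p) * (\<Prod>i\<in>{1..k}. A i (p i)))" if "p permutes {1..k}" for p
    using sub[OF that] by (simp add: finprod_Quot sign_Quot prod_S)
  have elem: "of_int (sign p) * (\<Prod>i\<in>{1..k}. A i (p i)) \<in> S" if "p permutes {1..k}" for p
    using sgn_S[OF prod_S[OF sub[OF that]]] .
  have "ring_det (R Quot I) k (\<lambda>i n. I +>\<^bsub>R\<^esub> A i n)
      = (\<Oplus>\<^bsub>R Quot I\<^esub>p\<in>{p. p permutes {1..k}}. I +>\<^bsub>R\<^esub> (of_int (sign p) * (\<Prod>i\<in>{1..k}. A i (p i))))"
    unfolding ring_det_def
  proof (rule Q.finsum_cong')
    show "(\<lambda>p. I +>\<^bsub>R\<^esub> (of_int (sign p) * (\<Prod>i\<in>{1..k}. A i (p i))))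
        \<in> {p. p permutes {1..k}} \<rightarrow> carrier (R Quot I)"
      unfolding carrier_Quot using elem by blast
  qed (unfold mem_Collect_eq, rule refl, rule summand)
  also have "\<dots> = I +>\<^bsub>R\<^esub> (\<Sum>p | p permutes {1..k}. of_int (sign p) * (\<Prod>i\<in>{1..k}. A i (p i)))"
  proof (rule finsum_Quot)
    show "finite {p. p permutes {1..k}}" by (simp add: finite_permutations)
  qed (use elem in blast)
  finally show ?thesis .
qed

end

lemma DD_deriv_bound:
  "\<phi> \<in> DD (Suc n) \<Longrightarrow> j \<le> Suc n \<Longrightarrow> cmod ((dx ^^ j) (tf \<phi>) x) \<le> 1 / radius \<phi> ^ (2 * (j + 1))"
  by (simp add: DD_def del: mult_Suc_right)

section \<open>Moderate and negligible nets\<close>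

text \<open>The properties of the ultrafilter that enter the estimates: almost every \<open>\<phi>\<close> lies in each
  \<^const>\<open>DD\<close> \<open>n\<close>, and the filter is proper.\<close>

locale gauge_filter =
  fixes U :: "test_fun filter"
  assumes DD_ev: "\<And>n. \<forall>\<^sub>F \<phi> in U. \<phi> \<in> DD n"
    and nontriv: "U \<noteq> bot"
begin

lemma radius_le: "\<forall>\<^sub>F \<phi> in U. radius \<phi> \<le> 1 / real (Suc n)"
  using DD_ev[of "Suc n"] by eventually_elim (simp add: DD_def)

lemma radius_le_1: "\<forall>\<^sub>F \<phi> in U. radius \<phi> \<le> 1"
  using radius_le[of 0] by simp

lemma radius_small: "\<forall>\<^sub>F \<phi> in U. C * radius \<phi> \<le> 1"
proof -
  obtain n where n: "C \<le> real (Suc n)" by (meson real_arch_simple le_Suc_eq of_nat_mono order_trans le_refl lessI less_imp_le)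
  show ?thesis
    using radius_le[of n]
  proof eventually_elim
    case (elim \<phi>)
    have "C * radius \<phi> \<le> real (Suc n) * radius \<phi>"
      using n radius_pos[of \<phi>] by (intro mult_right_mono) auto
    also have "\<dots> \<le> real (Suc n) * (1 / real (Suc n))" by (intro mult_left_mono elim) auto
    finally show ?case by simp
  qed
qed

definition moderate_on :: "'x set \<Rightarrow> (test_fun \<Rightarrow> 'x \<Rightarrow> complex) \<Rightarrow> bool" where
  "moderate_on X F \<longleftrightarrow> (\<exists>m::nat. \<forall>\<^sub>F \<phi> in U. \<forall>x\<in>X. cmod (F \<phi> x) \<le> 1 / radius \<phi> ^ m)"

definition negligible_on :: "'x set \<Rightarrow> (test_fun \<Rightarrow> 'x \<Rightarrow> complex) \<Rightarrow> bool" where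
  "negligible_on X F \<longleftrightarrow> (\<forall>p::nat. \<forall>\<^sub>F \<phi> in U. \<forall>x\<in>X. cmod (F \<phi> x) \<le> radius \<phi> ^ p)"

text \<open>Constant factors are absorbed into one more power of the radius, as the radius tends to \<open>0\<close>.\<close>

lemma moderate_onI:
  assumes "\<forall>\<^sub>F \<phi> in U. \<forall>x\<in>X. cmod (F \<phi> x) \<le> C / radius \<phi> ^ m"
  shows "moderate_on X F"
  unfolding moderate_on_def
proof (intro exI[of _ "Suc m"])
  show "\<forall>\<^sub>F \<phi> in U. \<forall>x\<in>X. cmod (F \<phi> x) \<le> 1 / radius \<phi> ^ Suc m"
    using assms radius_small[of C]
  proof eventually_elim
    case (elim \<phi>)
    have "C / radius \<phi> ^ m \<le> 1 / radius \<phi> ^ Suc m"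
      using elim(2) radius_pos[of \<phi>] by (simp add: field_simps)
    with elim(1) show ?case using order_trans by blast
  qed
qed

lemma negligible_onI:
  assumes "\<And>p. \<forall>\<^sub>F \<phi> in U. \<forall>x\<in>X. cmod (F \<phi> x) \<le> C * radius \<phi> ^ p"
  shows "negligible_on X F"
  unfolding negligible_on_def
proof
  fix p
  show "\<forall>\<^sub>F \<phi> in U. \<forall>x\<in>X. cmod (F \<phi> x) \<le> radius \<phi> ^ p"
    using assms[of "Suc p"] radius_small[of C]
  proof eventually_elim
    case (elim \<phi>)
    have "C * radius \<phi> ^ Suc p \<le> radius \<phi> ^ p"
      using mult_right_mono[OF elim(2), of "radius \<phi> ^ p"] radius_pos[of \<phi>] by (simp add: mult_ac)
    with elim(1) show ?case using order_trans by blast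
  qed
qed

lemma inverse_radius_mono: "radius \<phi> \<le> 1 \<Longrightarrow> m \<le> n \<Longrightarrow> 1 / radius \<phi> ^ m \<le> 1 / radius \<phi> ^ n"
  using radius_pos[of \<phi>] by (intro divide_left_mono power_decreasing) auto

lemma moderate_on_add:
  assumes "moderate_on X F" "moderate_on X G"
  shows "moderate_on X (\<lambda>\<phi> x. F \<phi> x + G \<phi> x)"
proof -
  obtain m n where "\<forall>\<^sub>F \<phi> in U. \<forall>x\<in>X. cmod (F \<phi> x) \<le> 1 / radius \<phi> ^ m"
    "\<forall>\<^sub>F \<phi> in U. \<forall>x\<in>X. cmod (G \<phi> x) \<le> 1 / radius \<phi> ^ n"
    using assms unfolding moderate_on_def by blast
  then have "\<forall>\<^sub>F \<phi> in U. \<forall>x\<in>X. cmod (F \<phi> x + G \<phi> x) \<le> 2 / radius \<phi> ^ (m + n)"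
    using radius_le_1
  proof eventually_elim
    case (elim \<phi>)
    show ?case
    proof
      fix x assume "x \<in> X"
      then show "cmod (F \<phi> x + G \<phi> x) \<le> 2 / radius \<phi> ^ (m + n)"
        using elim inverse_radius_mono[of \<phi> m "m + n"] inverse_radius_mono[of \<phi> n "m + n"]
          norm_triangle_ineq[of "F \<phi> x" "G \<phi> x"] by fastforce
    qed
  qed
  then show ?thesis by (rule moderate_onI)
qed

lemma moderate_on_mult:
  assumes "moderate_on X F" "moderate_on X G"
  shows "moderate_on X (\<lambda>\<phi> x. F \<phi> x * G \<phi> x)"
proof -
  obtain m n where "\<forall>\<^sub>F \<phi> in U. \<forall>x\<in>X. cmod (F \<phi> x) \<le> 1 / radius \<phi> ^ m"
    "\<forall>\<^sub>F \<phi> in U. \<forall>x\<in>X. cmod (G \<phi> x) \<le> 1 / radius \<phi> ^ n"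
    using assms unfolding moderate_on_def by blast
  then have "\<forall>\<^sub>F \<phi> in U. \<forall>x\<in>X. cmod (F \<phi> x * G \<phi> x) \<le> 1 / radius \<phi> ^ (m + n)"
  proof eventually_elim
    case (elim \<phi>)
    show ?case
    proof
      fix x assume "x \<in> X"
      then have "cmod (F \<phi> x) * cmod (G \<phi> x) \<le> (1 / radius \<phi> ^ m) * (1 / radius \<phi> ^ n)"
        using elim radius_pos[of \<phi>] by (intro mult_mono) auto
      then show "cmod (F \<phi> x * G \<phi> x) \<le> 1 / radius \<phi> ^ (m + n)"
        by (simp add: norm_mult power_add)
    qed
  qed
  then show ?thesis unfolding moderate_on_def by blast
qed

lemma moderate_on_uminus: "moderate_on X F \<Longrightarrow> moderate_on X (\<lambda>\<phi> x. - F \<phi> x)"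
  by (simp add: moderate_on_def)

lemma moderate_on_bounded:
  assumes "\<forall>\<^sub>F \<phi> in U. \<forall>x\<in>X. cmod (F \<phi> x) \<le> C"
  shows "moderate_on X F"
  using moderate_onI[of X F C 0] assms by simp

lemma negligible_on_add:
  assumes "negligible_on X F" "negligible_on X G"
  shows "negligible_on X (\<lambda>\<phi> x. F \<phi> x + G \<phi> x)"
proof (rule negligible_onI)
  fix p
  show "\<forall>\<^sub>F \<phi> in U. \<forall>x\<in>X. cmod (F \<phi> x + G \<phi> x) \<le> 2 * radius \<phi> ^ p"
    using assms[unfolded negligible_on_def, rule_format, of p]
  proof eventually_elim
    case (elim \<phi>)
    show ?case
    proof
      fix x assume "x \<in> X"
      then show "cmod (F \<phi> x + G \<phi> x) \<le> 2 * radius \<phi> ^ p"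
        using elim norm_triangle_ineq[of "F \<phi> x" "G \<phi> x"] by fastforce
    qed
  qed
qed

lemma negligible_on_mult:
  assumes "moderate_on X F" "negligible_on X G"
  shows "negligible_on X (\<lambda>\<phi> x. F \<phi> x * G \<phi> x)"
  unfolding negligible_on_def
proof
  fix p
  obtain m where "\<forall>\<^sub>F \<phi> in U. \<forall>x\<in>X. cmod (F \<phi> x) \<le> 1 / radius \<phi> ^ m"
    using assms(1) unfolding moderate_on_def by blast
  moreover have "\<forall>\<^sub>F \<phi> in U. \<forall>x\<in>X. cmod (G \<phi> x) \<le> radius \<phi> ^ (p + m)"
    using assms(2) unfolding negligible_on_def by blast
  ultimately show "\<forall>\<^sub>F \<phi> in U. \<forall>x\<in>X. cmod (F \<phi> x * G \<phi> x) \<le> radius \<phi> ^ p"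
  proof eventually_elim
    case (elim \<phi>)
    show ?case
    proof
      fix x assume "x \<in> X"
      then have "cmod (F \<phi> x) * cmod (G \<phi> x) \<le> (1 / radius \<phi> ^ m) * radius \<phi> ^ (p + m)"
        using elim radius_pos[of \<phi>] by (intro mult_mono) auto
      then show "cmod (F \<phi> x * G \<phi> x) \<le> radius \<phi> ^ p"
        using radius_pos[of \<phi>] by (simp add: norm_mult power_add)
    qed
  qed
qed

lemma negligible_on_eventually_0:
  assumes "\<forall>\<^sub>F \<phi> in U. \<forall>x\<in>X. F \<phi> x = 0"
  shows "negligible_on X F"
  unfolding negligible_on_def
  using assms by (auto elim!: eventually_mono simp: less_imp_le[OF radius_pos])

lemma negligible_imp_moderate_on: "negligible_on X F \<Longrightarrow> moderate_on X F"
  unfolding negligible_on_def moderate_on_def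
  by (rule exI[of _ 0], drule spec[of _ 0]) simp

lemma C_moderate_iff: "A \<in> C_moderate U \<longleftrightarrow> moderate_on {0::real} (\<lambda>\<phi> _. A \<phi>)"
  by (simp add: C_moderate_def moderate_on_def)

lemma C_negligible_iff: "A \<in> C_negligible U \<longleftrightarrow> negligible_on {0::real} (\<lambda>\<phi> _. A \<phi>)"
  by (simp add: C_negligible_def negligible_on_def)

lemma E_moderate_iff:
  "f \<in> E_moderate U \<longleftrightarrow> (\<forall>\<phi>. smooth (f \<phi>)) \<and>
     (\<forall>j K. compact K \<longrightarrow> moderate_on K (\<lambda>\<phi>. (dx ^^ j) (f \<phi>)))"
  by (auto simp: E_moderate_def moderate_on_def)

lemma E_negligible_iff:
  "f \<in> E_negligible U \<longleftrightarrow> (\<forall>\<phi>. smooth (f \<phi>)) \<and>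
     (\<forall>j K. compact K \<longrightarrow> negligible_on K (\<lambda>\<phi>. (dx ^^ j) (f \<phi>)))"
  by (auto simp: E_negligible_def negligible_on_def)

lemma E_moderate_smooth: "f \<in> E_moderate U \<Longrightarrow> smooth (f \<phi>)"
  by (simp add: E_moderate_iff)

lemma E_negligible_smooth: "f \<in> E_negligible U \<Longrightarrow> smooth (f \<phi>)"
  by (simp add: E_negligible_iff)

lemma E_moderate_dx: "f \<in> E_moderate U \<Longrightarrow> (\<lambda>\<phi>. dx (f \<phi>)) \<in> E_moderate U"
  unfolding E_moderate_iff
proof (intro conjI allI impI)
  fix j and K :: "real set"
  assume *: "(\<forall>\<phi>. smooth (f \<phi>)) \<and>
     (\<forall>j K. compact K \<longrightarrow> moderate_on K (\<lambda>\<phi>. (dx ^^ j) (f \<phi>)))" and "compact K"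
  then show "moderate_on K (\<lambda>\<phi>. (dx ^^ j) (dx (f \<phi>)))"
    using *[THEN conjunct2, rule_format, of K "Suc j"] by (simp add: funpow_swap1)
qed (simp add: smooth_dx)

lemma E_negligible_dx: "f \<in> E_negligible U \<Longrightarrow> (\<lambda>\<phi>. dx (f \<phi>)) \<in> E_negligible U"
  unfolding E_negligible_iff
proof (intro conjI allI impI)
  fix j and K :: "real set"
  assume *: "(\<forall>\<phi>. smooth (f \<phi>)) \<and>
     (\<forall>j K. compact K \<longrightarrow> negligible_on K (\<lambda>\<phi>. (dx ^^ j) (f \<phi>)))" and "compact K"
  then show "negligible_on K (\<lambda>\<phi>. (dx ^^ j) (dx (f \<phi>)))"
    using *[THEN conjunct2, rule_format, of K "Suc j"] by (simp add: funpow_swap1)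
qed (simp add: smooth_dx)

lemma E_moderate_dx_pow: "f \<in> E_moderate U \<Longrightarrow> (\<lambda>\<phi>. (dx ^^ j) (f \<phi>)) \<in> E_moderate U"
  by (induction j) (auto intro: E_moderate_dx)

lemma E_moderate_0: "f \<in> E_moderate U \<Longrightarrow> compact K \<Longrightarrow> moderate_on K f"
  unfolding E_moderate_iff by (metis (no_types, lifting) ext funpow_0)

lemma E_negligible_0: "f \<in> E_negligible U \<Longrightarrow> compact K \<Longrightarrow> negligible_on K f"
  unfolding E_negligible_iff by (metis (no_types, lifting) ext funpow_0)

lemma E_moderate_add:
  "f \<in> E_moderate U \<Longrightarrow> g \<in> E_moderate U \<Longrightarrow> (\<lambda>\<phi> x. f \<phi> x + g \<phi> x) \<in> E_moderate U"
  unfolding E_moderate_iff by (simp add: dx_pow_add smooth_add moderate_on_add)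

lemma E_negligible_add:
  "f \<in> E_negligible U \<Longrightarrow> g \<in> E_negligible U \<Longrightarrow> (\<lambda>\<phi> x. f \<phi> x + g \<phi> x) \<in> E_negligible U"
  unfolding E_negligible_iff by (simp add: dx_pow_add smooth_add negligible_on_add)

lemma E_moderate_uminus: "f \<in> E_moderate U \<Longrightarrow> (\<lambda>\<phi> x. - f \<phi> x) \<in> E_moderate U"
  unfolding E_moderate_iff by (simp add: dx_pow_uminus smooth_uminus moderate_on_uminus)

text \<open>By induction on the order of the derivative with the product rule, for all pairs of factors at once.\<close>

lemma E_moderate_mult:
  assumes "f \<in> E_moderate U" "g \<in> E_moderate U"
  shows "(\<lambda>\<phi> x. f \<phi> x * g \<phi> x) \<in> E_moderate U"
proof -
  have "moderate_on K (\<lambda>\<phi>. (dx ^^ j) (\<lambda>x. f \<phi> x * g \<phi> x))"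
    if K: "compact K" and "f \<in> E_moderate U" "g \<in> E_moderate U" for j f g and K :: "real set"
    using that(2,3)
  proof (induction j arbitrary: f g)
    case 0
    then show ?case by (simp add: moderate_on_mult E_moderate_0 K)
  next
    case (Suc j)
    then show ?case
      using moderate_on_add[OF Suc.IH[OF Suc(2) E_moderate_dx[OF Suc(3)]] Suc.IH[OF E_moderate_dx[OF Suc(2)] Suc(3)]]
      by (simp add: funpow_Suc_right dx_mult dx_pow_add smooth_mult smooth_dx E_moderate_smooth del: funpow.simps)
  qed
  then show ?thesis using assms unfolding E_moderate_iff[of "\<lambda>\<phi> x. f \<phi> x * g \<phi> x"]
    by (simp add: smooth_mult E_moderate_smooth)
qed

lemma E_negligible_mult:
  assumes "f \<in> E_moderate U" "g \<in> E_negligible U"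
  shows "(\<lambda>\<phi> x. f \<phi> x * g \<phi> x) \<in> E_negligible U"
proof -
  have "negligible_on K (\<lambda>\<phi>. (dx ^^ j) (\<lambda>x. f \<phi> x * g \<phi> x))"
    if K: "compact K" and "f \<in> E_moderate U" "g \<in> E_negligible U" for j f g and K :: "real set"
    using that(2,3)
  proof (induction j arbitrary: f g)
    case 0
    then show ?case by (simp add: negligible_on_mult E_moderate_0 E_negligible_0 K)
  next
    case (Suc j)
    then show ?case
      using negligible_on_add[OF Suc.IH[OF Suc(2) E_negligible_dx[OF Suc(3)]] Suc.IH[OF E_moderate_dx[OF Suc(2)] Suc(3)]]
      by (simp add: funpow_Suc_right dx_mult dx_pow_add smooth_mult smooth_dx E_moderate_smooth E_negligible_smooth del: funpow.simps)
  qed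
  then show ?thesis using assms unfolding E_negligible_iff[of "\<lambda>\<phi> x. f \<phi> x * g \<phi> x"]
    by (simp add: smooth_mult E_moderate_smooth E_negligible_smooth)
qed

lemma E_moderate_const: "A \<in> C_moderate U \<Longrightarrow> (\<lambda>\<phi> x. A \<phi>) \<in> E_moderate U"
  unfolding E_moderate_iff C_moderate_iff
proof (intro conjI allI impI)
  fix j and K :: "real set"
  assume A: "moderate_on {0::real} (\<lambda>\<phi> _. A \<phi>)"
  show "moderate_on K (\<lambda>\<phi>. (dx ^^ j) (\<lambda>x. A \<phi>))"
  proof (cases "j = 0")
    case True
    then show ?thesis using A unfolding moderate_on_def by (auto elim!: eventually_mono)
  next
    case False
    then show ?thesis by (intro moderate_on_bounded[of _ _ 0]) (simp add: dx_pow_const)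
  qed
qed simp

lemma E_negligible_const: "A \<in> C_negligible U \<Longrightarrow> (\<lambda>\<phi> x. A \<phi>) \<in> E_negligible U"
  unfolding E_negligible_iff C_negligible_iff
proof (intro conjI allI impI)
  fix j and K :: "real set"
  assume A: "negligible_on {0::real} (\<lambda>\<phi> _. A \<phi>)"
  show "negligible_on K (\<lambda>\<phi>. (dx ^^ j) (\<lambda>x. A \<phi>))"
  proof (cases "j = 0")
    case True
    then show ?thesis using A unfolding negligible_on_def by (auto elim!: eventually_mono)
  next
    case False
    then show ?thesis by (intro negligible_on_eventually_0) (simp add: dx_pow_const)
  qed
qed simp

lemma C_moderate_const: "(\<lambda>_. c) \<in> C_moderate U"
  unfolding C_moderate_iff by (rule moderate_on_bounded[of _ _ "cmod c"]) simp

lemma E_moderate_eval: "f \<in> E_moderate U \<Longrightarrow> (\<lambda>\<phi>. f \<phi> x) \<in> C_moderate U"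
  using E_moderate_0[of f "{x}"] by (simp add: C_moderate_iff moderate_on_def)

lemma E_negligible_eval: "f \<in> E_negligible U \<Longrightarrow> (\<lambda>\<phi>. f \<phi> x) \<in> C_negligible U"
  using E_negligible_0[of f "{x}"] by (simp add: C_negligible_iff negligible_on_def)

sublocale C: subring_ideal "C_moderate U" "C_negligible U"
proof
  show "(1 :: test_fun \<Rightarrow> complex) \<in> C_moderate U"
    using C_moderate_const[of 1] by (simp add: one_fun_def)
  show "0 \<in> C_negligible U"
    unfolding C_negligible_iff by (rule negligible_on_eventually_0) simp
  show "C_negligible U \<subseteq> C_moderate U"
    by (auto simp: C_moderate_iff C_negligible_iff negligible_imp_moderate_on)
qed (simp_all add: C_moderate_iff C_negligible_iff moderate_on_add moderate_on_mult
    moderate_on_uminus negligible_on_add negligible_on_mult fun_Compl_def)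

sublocale E: subring_ideal "E_moderate U" "E_negligible U"
proof
  show "(1 :: test_fun \<Rightarrow> real \<Rightarrow> complex) \<in> E_moderate U"
    using E_moderate_const[OF C_moderate_const[of 1]] by (simp add: one_fun_def)
  show "(0 :: test_fun \<Rightarrow> real \<Rightarrow> complex) \<in> E_negligible U"
    using E_negligible_const[OF C.zero_I] by (simp add: zero_fun_def)
  show "E_negligible U \<subseteq> E_moderate U"
    by (auto simp: E_moderate_iff E_negligible_iff negligible_imp_moderate_on)
  show "x + y \<in> E_moderate U" if "x \<in> E_moderate U" "y \<in> E_moderate U" for x y
    using E_moderate_add[OF that] by (simp add: plus_fun_def)
  show "x * y \<in> E_moderate U" if "x \<in> E_moderate U" "y \<in> E_moderate U" for x y
    using E_moderate_mult[OF that] by (simp add: times_fun_def)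
  show "- x \<in> E_moderate U" if "x \<in> E_moderate U" for x
    using E_moderate_uminus[OF that] by (simp add: fun_Compl_def)
  show "x + y \<in> E_negligible U" if "x \<in> E_negligible U" "y \<in> E_negligible U" for x y
    using E_negligible_add[OF that] by (simp add: plus_fun_def)
  show "x * y \<in> E_negligible U" if "x \<in> E_moderate U" "y \<in> E_negligible U" for x y
    using E_negligible_mult[OF that] by (simp add: times_fun_def)
qed

section \<open>Computing with classes of nets\<close>

lemma C_nets_eq: "C_nets U = C.R"
  by (simp add: C_nets_def pointwise_ring_def fun_eq_iff)

lemma E_nets_eq: "E_nets U = E.R"
  by (simp add: E_nets_def pointwise_ring_def fun_eq_iff)

lemma C_hat_eq: "C_hat U = C.R Quot C_negligible U"
  by (simp add: C_hat_def C_nets_eq)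

lemma E_hat_eq: "E_hat U = E.R Quot E_negligible U"
  by (simp add: E_hat_def E_nets_eq)

lemma C_class_eq: "C_class U A = C_negligible U +>\<^bsub>C.R\<^esub> A"
  by (simp add: C_class_def C_nets_eq)

lemma E_class_eq: "E_class U f = E_negligible U +>\<^bsub>E.R\<^esub> f"
  by (simp add: E_class_def E_nets_eq)

lemmas hat_simps = C_hat_eq E_hat_eq C_class_eq E_class_eq

lemma E_class_eq_iff: "E_class U f = E_class U g \<longleftrightarrow> (\<lambda>\<phi> x. f \<phi> x - g \<phi> x) \<in> E_negligible U"
  by (simp add: hat_simps E.coset_eq_iff fun_diff_def)

lemma C_class_eq_iff: "C_class U A = C_class U B \<longleftrightarrow> (\<lambda>\<phi>. A \<phi> - B \<phi>) \<in> C_negligible U"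
  by (simp add: hat_simps C.coset_eq_iff fun_diff_def)

lemma E_carrier: "F \<in> carrier (E_hat U) \<longleftrightarrow> (\<exists>f\<in>E_moderate U. F = E_class U f)"
  by (auto simp: hat_simps E.carrier_Quot)

lemma C_carrier: "\<alpha> \<in> carrier (C_hat U) \<longleftrightarrow> (\<exists>A\<in>C_moderate U. \<alpha> = C_class U A)"
  by (auto simp: hat_simps C.carrier_Quot)

lemma rep_E_class: "(\<lambda>\<phi> x. rep (E_class U f) \<phi> x - f \<phi> x) \<in> E_negligible U"
  using E.rep_coset[of f] by (simp add: hat_simps fun_diff_def)

lemma rep_C_class: "(\<lambda>\<phi>. rep (C_class U A) \<phi> - A \<phi>) \<in> C_negligible U"
  using C.rep_coset[of A] by (simp add: hat_simps fun_diff_def)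

lemma rep_E_moderate: "f \<in> E_moderate U \<Longrightarrow> rep (E_class U f) \<in> E_moderate U"
  using E.add_S[OF _ subsetD[OF E.I_S rep_E_class], of f f] by (simp add: plus_fun_def)

text \<open>Derivatives of negligible nets are negligible, so the representative chosen by \<^const>\<open>rep\<close> does not
  matter. The same holds for point values and constants below.\<close>

lemma E_deriv_class:
  assumes "f \<in> E_moderate U"
  shows "E_deriv U (E_class U f) = E_class U (\<lambda>\<phi>. dx (f \<phi>))"
  unfolding E_deriv_def E_class_eq_iff
proof -
  have "smooth (f \<phi>)" "smooth (rep (E_class U f) \<phi>)" for \<phi>
    using assms rep_E_moderate E_moderate_smooth by auto
  then have "dx (\<lambda>x. rep (E_class U f) \<phi> x - f \<phi> x) = (\<lambda>x. dx (rep (E_class U f) \<phi>) x - dx (f \<phi>) x)" for \<phi>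
    using dx_pow_diff[of "rep (E_class U f) \<phi>" "f \<phi>" 1] by simp
  then show "(\<lambda>\<phi> x. dx (rep (E_class U f) \<phi>) x - dx (f \<phi>) x) \<in> E_negligible U"
    using E_negligible_dx[OF rep_E_class[of f]] by simp
qed

lemma E_deriv_pow_class:
  "f \<in> E_moderate U \<Longrightarrow> (E_deriv U ^^ j) (E_class U f) = E_class U (\<lambda>\<phi>. (dx ^^ j) (f \<phi>))"
  by (induction j) (simp_all add: E_deriv_class E_moderate_dx_pow)

lemma E_eval_class: "E_eval U (E_class U f) x = C_class U (\<lambda>\<phi>. f \<phi> x)"
  unfolding E_eval_def C_class_eq_iff
  using E_negligible_eval[OF rep_E_class[of f], of x] by simp

lemma const_E_class: "const_E U (C_class U A) = E_class U (\<lambda>\<phi> x. A \<phi>)"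
  unfolding const_E_def E_class_eq_iff
  using E_negligible_const[OF rep_C_class[of A]] by simp

lemma E_mult_class:
  "f \<in> E_moderate U \<Longrightarrow> g \<in> E_moderate U \<Longrightarrow>
    E_class U f \<otimes>\<^bsub>E_hat U\<^esub> E_class U g = E_class U (\<lambda>\<phi> x. f \<phi> x * g \<phi> x)"
  by (simp add: hat_simps E.mult_Quot times_fun_def)

lemma E_add_class:
  "f \<in> E_moderate U \<Longrightarrow> g \<in> E_moderate U \<Longrightarrow>
    E_class U f \<oplus>\<^bsub>E_hat U\<^esub> E_class U g = E_class U (\<lambda>\<phi> x. f \<phi> x + g \<phi> x)"
  by (simp add: hat_simps E.add_Quot plus_fun_def)

lemma sum_fun_apply2: "(\<Sum>i\<in>A. f i) \<phi> x = (\<Sum>i\<in>A. f i \<phi> x)"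
  for f :: "'i \<Rightarrow> test_fun \<Rightarrow> real \<Rightarrow> complex"
  by (induction A rule: infinite_finite_induct) simp_all

lemma prod_fun_apply2: "(\<Prod>i\<in>A. f i) \<phi> x = (\<Prod>i\<in>A. f i \<phi> x)"
  for f :: "'i \<Rightarrow> test_fun \<Rightarrow> real \<Rightarrow> complex"
  by (induction A rule: infinite_finite_induct) simp_all

lemma E_sum_class:
  assumes "finite A" "\<And>i. i \<in> A \<Longrightarrow> f i \<in> E_moderate U"
  shows "(\<Oplus>\<^bsub>E_hat U\<^esub>i\<in>A. E_class U (f i)) = E_class U (\<lambda>\<phi> x. \<Sum>i\<in>A. f i \<phi> x)"
proof -
  have "(\<lambda>\<phi> x. \<Sum>i\<in>A. f i \<phi> x) = sum f A" by (simp add: fun_eq_iff sum_fun_apply2)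
  then show ?thesis using assms by (simp add: hat_simps E.finsum_Quot image_subset_iff)
qed

lemma E_moderate_sum:
  assumes "\<And>i. i \<in> A \<Longrightarrow> f i \<in> E_moderate U"
  shows "(\<lambda>\<phi> x. \<Sum>i\<in>A. f i \<phi> x) \<in> E_moderate U"
proof -
  have "(\<lambda>\<phi> x. \<Sum>i\<in>A. f i \<phi> x) = sum f A" by (simp add: fun_eq_iff sum_fun_apply2)
  then show ?thesis using assms E.sum_S[of f A] by auto
qed

lemma E_cring: "cring (E_hat U)"
  unfolding E_hat_eq by (rule E.cring_Quot)

lemma E_class_carrier: "f \<in> E_moderate U \<Longrightarrow> E_class U f \<in> carrier (E_hat U)"
  using E_carrier by blast

lemma pdt_E_class:
  assumes f: "f \<in> E_moderate U"
  shows "pdt_E U P (E_class U f) = E_class U (\<lambda>\<phi>. pdt P (f \<phi>))"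
proof -
  have m: "(\<lambda>\<phi> x. coeff P i * (dx ^^ i) (f \<phi>) x) \<in> E_moderate U" for i
    by (intro E_moderate_mult E_moderate_const C_moderate_const E_moderate_dx_pow f)
  have "const_E U (C_class U (\<lambda>\<phi>. coeff P i)) \<otimes>\<^bsub>E_hat U\<^esub> (E_deriv U ^^ i) (E_class U f)
      = E_class U (\<lambda>\<phi> x. coeff P i * (dx ^^ i) (f \<phi>) x)" for i
    by (simp add: const_E_class E_deriv_pow_class f E_mult_class E_moderate_const C_moderate_const
        E_moderate_dx_pow)
  then show ?thesis
    using E_sum_class[of "{..degree P}" "\<lambda>i \<phi> x. coeff P i * (dx ^^ i) (f \<phi>) x"] m
    by (simp add: pdt_E_def pdt_def)
qed

lemma wronskian_class:
  assumes "\<And>n. n \<in> {1..k} \<Longrightarrow> f n \<in> E_moderate U"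
    and "\<And>n. n \<in> {1..k} \<Longrightarrow> F n = E_class U (f n)"
  shows "wronskian U k F = E_class U (\<lambda>\<phi> x. \<Sum>p | p permutes {1..k}.
      of_int (sign p) * (\<Prod>i\<in>{1..k}. (dx ^^ (i - 1)) (f (p i) \<phi>) x))"
proof -
  define A where "A i n = (\<lambda>\<phi>. (dx ^^ (i - 1)) (f n \<phi>))" for i n
  have A: "A i n \<in> E_moderate U" if "n \<in> {1..k}" for i n
    unfolding A_def by (intro E_moderate_dx_pow assms that)
  interpret Q: cring "E_hat U" by (rule E_cring)
  have entry: "(E_deriv U ^^ (i - 1)) (F (p i)) = E_class U (A i (p i))"
    if "p permutes {1..k}" "i \<in> {1..k}" for p i
  proof -
    have "p i \<in> {1..k}" using permutes_in_image[OF that(1)] that(2) by blast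
    then show ?thesis by (simp add: assms E_deriv_pow_class A_def)
  qed
  have sub: "p i \<in> {1..k}" if "p permutes {1..k}" "i \<in> {1..k}" for p i
    using permutes_in_image[OF that(1)] that(2) by blast
  have fac: "(\<lambda>i. E_class U (A i (p i))) \<in> {1..k} \<rightarrow> carrier (E_hat U)" if "p permutes {1..k}" for p
    using A sub[OF that] by (blast intro: E_class_carrier)
  have prod: "(\<Otimes>\<^bsub>E_hat U\<^esub>i\<in>{1..k}. (E_deriv U ^^ (i - 1)) (F (p i)))
      = (\<Otimes>\<^bsub>E_hat U\<^esub>i\<in>{1..k}. E_class U (A i (p i)))" if "p permutes {1..k}" for p
    by (rule Q.finprod_cong'[OF refl fac[OF that] entry[OF that]])
  have "wronskian U k F = ring_det (E_hat U) k (\<lambda>i n. E_class U (A i n))"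
    unfolding wronskian_def ring_det_def
  proof (rule Q.finsum_cong')
    show "(\<lambda>p. [sign p] \<cdot>\<^bsub>E_hat U\<^esub> (\<Otimes>\<^bsub>E_hat U\<^esub>i\<in>{1..k}. E_class U (A i (p i))))
        \<in> {p. p permutes {1..k}} \<rightarrow> carrier (E_hat U)"
    proof
      fix p assume "p \<in> {p. p permutes {1..k}}"
      then have "(\<Otimes>\<^bsub>E_hat U\<^esub>i\<in>{1..k}. E_class U (A i (p i))) \<in> carrier (E_hat U)"
        by (intro Q.finprod_closed fac) (unfold mem_Collect_eq)
      then
      show "[sign p] \<cdot>\<^bsub>E_hat U\<^esub> (\<Otimes>\<^bsub>E_hat U\<^esub>i\<in>{1..k}. E_class U (A i (p i))) \<in> carrier (E_hat U)"
        by (rule Q.add.int_pow_closed)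
    qed
  next
    fix p assume "p \<in> {p. p permutes {1..k}}"
    then have p: "p permutes {1..k}" by (unfold mem_Collect_eq)
    show "[sign p] \<cdot>\<^bsub>E_hat U\<^esub> (\<Otimes>\<^bsub>E_hat U\<^esub>i\<in>{1..k}. (E_deriv U ^^ (i - 1)) (F (p i)))
        = [sign p] \<cdot>\<^bsub>E_hat U\<^esub> (\<Otimes>\<^bsub>E_hat U\<^esub>i\<in>{1..k}. E_class U (A i (p i)))"
      unfolding prod[OF p] by (rule refl)
  qed (rule refl)
  also have "\<dots> = E_class U (\<Sum>p | p permutes {1..k}. of_int (sign p) * (\<Prod>i\<in>{1..k}. A i (p i)))"
    unfolding hat_simps by (rule E.ring_det_Quot) (rule A)
  also have "(\<Sum>p | p permutes {1..k}. of_int (sign p) * (\<Prod>i\<in>{1..k}. A i (p i)))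
      = (\<lambda>\<phi> x. \<Sum>p | p permutes {1..k}. of_int (sign p) * (\<Prod>i\<in>{1..k}. (dx ^^ (i - 1)) (f (p i) \<phi>) x))"
  proof -
    have "(of_int (sign p) :: test_fun \<Rightarrow> real \<Rightarrow> complex) \<phi> x = of_int (sign p)"
      for p :: "nat \<Rightarrow> nat" and \<phi> x
      by (cases "sign p = 1") (auto simp: sign_def)
    then show ?thesis by (simp add: fun_eq_iff sum_fun_apply2 prod_fun_apply2 A_def)
  qed
  finally show ?thesis .
qed

text \<open>On a compact set, \<open>T\<close> involves only derivatives of \<open>\<phi>\<close> up to some order \<open>N\<close>, and for
  \<open>\<phi>\<close> in \<^const>\<open>DD\<close> \<open>n\<close> with \<open>n > N + j\<close> those of order at most \<open>N + j\<close> are bounded by a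
  power of the inverse radius.\<close>

lemma conv_tf_moderate:
  assumes T: "T \<in> distributions"
  shows "conv_tf T \<in> E_moderate U"
  unfolding E_moderate_iff
proof (intro conjI allI impI)
  fix j and K :: "real set" assume "compact K"
  then obtain L where L: "\<And>x. x \<in> K \<Longrightarrow> \<bar>x\<bar> \<le> L"
    using compact_imp_bounded by (force simp: bounded_iff)
  obtain C N where C: "C \<ge> 0" and bound: "\<And>\<phi> x B. \<bar>x\<bar> \<le> L \<Longrightarrow> (\<And>y. 1 < \<bar>y\<bar> \<Longrightarrow> tf \<phi> y = 0) \<Longrightarrow>
      (\<And>j y. j \<le> N \<Longrightarrow> cmod ((dx ^^ j) (tf \<phi>) y) \<le> B) \<Longrightarrow> cmod (conv_tf T \<phi> x) \<le> C * B"
    using conv_tf_bound[OF T, of L] by blast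
  \<comment> \<open>the exponent in \<^const>\<open>DD\<close> for derivatives of order \<open>N + j\<close>\<close>
  define m where "m = 2 * (N + j + 1)"
  have "\<forall>\<^sub>F \<phi> in U. \<forall>x\<in>K. cmod ((dx ^^ j) (conv_tf T \<phi>) x) \<le> C / radius \<phi> ^ m"
    using DD_ev[of "Suc (N + j)"] radius_le_1
  proof eventually_elim
    case (elim \<phi>)
    show ?case
    proof
      fix x assume x: "x \<in> K"
      have "cmod (conv_tf T ((tf_deriv ^^ j) \<phi>) x) \<le> C * (1 / radius \<phi> ^ m)"
      proof (rule bound)
        show "tf ((tf_deriv ^^ j) \<phi>) y = 0" if "1 < \<bar>y\<bar>" for y
          unfolding tf_tf_deriv_pow
          by (rule smooth_zero_dx_pow_outside[of 1]) (use that radius_bound elim(2) in force)+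
        fix i y assume i: "i \<le> N"
        have "cmod ((dx ^^ (i + j)) (tf \<phi>) y) \<le> 1 / radius \<phi> ^ (2 * ((i + j) + 1))"
          using DD_deriv_bound[OF elim(1), of "i + j"] i by simp
        also have "\<dots> \<le> 1 / radius \<phi> ^ m"
          using i by (intro inverse_radius_mono elim(2)) (simp add: m_def)
        finally show "cmod ((dx ^^ i) (tf ((tf_deriv ^^ j) \<phi>)) y) \<le> 1 / radius \<phi> ^ m"
          by (simp add: tf_tf_deriv_pow funpow_add)
      qed (rule L[OF x])
      then show "cmod ((dx ^^ j) (conv_tf T \<phi>) x) \<le> C / radius \<phi> ^ m"
        by (simp add: dx_pow_conv_tf[OF T])
    qed
  qed
  then show "moderate_on K (\<lambda>\<phi>. (dx ^^ j) (conv_tf T \<phi>))" by (rule moderate_onI)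
qed (rule smooth_conv_tf[OF T])

lemma lin_comb_class:
  assumes "\<And>n. n \<in> {1..m} \<Longrightarrow> \<alpha> n = C_class U (a n)" "\<And>n. n \<in> {1..m} \<Longrightarrow> a n \<in> C_moderate U"
    and "\<And>n. n \<in> {1..m} \<Longrightarrow> conv_tf (T n) \<in> E_moderate U"
  shows "lin_comb U m \<alpha> T = E_class U (\<lambda>\<phi> x. \<Sum>n=1..m. a n \<phi> * conv_tf (T n) \<phi> x)"
proof -
  interpret Q: cring "E_hat U" by (rule E_cring)
  have m: "(\<lambda>\<phi> x. a n \<phi> * conv_tf (T n) \<phi> x) \<in> E_moderate U" if "n \<in> {1..m}" for n
    by (intro E_moderate_mult E_moderate_const assms that)
  have "lin_comb U m \<alpha> T = (\<Oplus>\<^bsub>E_hat U\<^esub>n\<in>{1..m}. E_class U (\<lambda>\<phi> x. a n \<phi> * conv_tf (T n) \<phi> x))"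
    unfolding lin_comb_def
    by (rule Q.finsum_cong')
      (use m assms in \<open>auto simp: iota_def const_E_class E_mult_class E_moderate_const intro!: E_class_carrier\<close>)
  also have "\<dots> = E_class U (\<lambda>\<phi> x. \<Sum>n=1..m. a n \<phi> * conv_tf (T n) \<phi> x)"
    using E_sum_class[of "{1..m}" "\<lambda>n \<phi> x. a n \<phi> * conv_tf (T n) \<phi> x"] m by simp
  finally show ?thesis .
qed

end

section \<open>Determinants and Cramer's rule\<close>

text \<open>The Leibniz formula over \<open>{1..k}\<close>, the complex counterpart of \<^const>\<open>ring_det\<close>.\<close>

definition leibniz_det :: "nat \<Rightarrow> (nat \<Rightarrow> nat \<Rightarrow> complex) \<Rightarrow> complex" where
  "leibniz_det k A = (\<Sum>p | p permutes {1..k}. of_int (sign p) * (\<Prod>i\<in>{1..k}. A i (p i)))"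

abbreviation leibniz_mat :: "nat \<Rightarrow> (nat \<Rightarrow> nat \<Rightarrow> complex) \<Rightarrow> complex mat" where
  "leibniz_mat k A \<equiv> Matrix.mat k k (\<lambda>(i, j). A (Suc i) (Suc j))"

text \<open>Shifting the index set from \<open>{1..k}\<close> to \<open>{0..<k}\<close> conjugates permutations by the successor
  function, which preserves signs.\<close>

lemma leibniz_det_eq_det: "leibniz_det k A = Determinant.det (leibniz_mat k A)"
proof -
  let ?m = "map_permutation {0..<k} Suc"
  have bij: "bij_betw Suc {0..<k} {1..k}"
    by (rule bij_betwI[where g = "\<lambda>n. n - 1"]) auto
  have img: "Suc ` {0..<k} = {1..k}" using bij by (simp add: bij_betw_def)
  have "?m = (\<lambda>\<pi> x. if x \<in> {1..k} then Suc (\<pi> (inv_into {0..<k} Suc x)) else x)"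
    unfolding map_permutation_def img by (auto simp: fun_eq_iff restrict_id_def)
  then have bij_m: "bij_betw ?m {p. p permutes {0..<k}} {p. p permutes {1..k}}"
    using bij_betw_permutations[OF bij] by simp
  have "leibniz_det k A = (\<Sum>p | p permutes {0..<k}. of_int (sign (?m p)) * (\<Prod>i\<in>{1..k}. A i (?m p i)))"
    unfolding leibniz_det_def by (rule sum.reindex_bij_betw[OF bij_m, symmetric])
  also have "\<dots> = (\<Sum>p | p permutes {0..<k}. of_int (sign p) * (\<Prod>i = 0..<k. leibniz_mat k A $$ (i, p i)))"
  proof (rule sum.cong[OF refl])
    fix p assume "p \<in> {p. p permutes {0..<k}}"
    then have p: "p permutes {0..<k}" by simp
    have "(\<Prod>i\<in>{1..k}. A i (?m p i)) = (\<Prod>i = 0..<k. A (Suc i) (?m p (Suc i)))"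
      by (rule prod.reindex_bij_betw[OF bij, symmetric])
    also have "\<dots> = (\<Prod>i = 0..<k. leibniz_mat k A $$ (i, p i))"
    proof (rule prod.cong[OF refl])
      fix i assume i: "i \<in> {0..<k}"
      then have "p i < k" using permutes_in_image[OF p, of i] by auto
      moreover have "?m p (Suc i) = Suc (p i)"
        using i p by (intro map_permutation_apply) auto
      ultimately show "A (Suc i) (?m p (Suc i)) = leibniz_mat k A $$ (i, p i)"
        using i by simp
    qed
    finally show "of_int (sign (?m p)) * (\<Prod>i\<in>{1..k}. A i (?m p i)) =
        of_int (sign p) * (\<Prod>i = 0..<k. leibniz_mat k A $$ (i, p i))"
      using p by (simp add: sign_map_permutation)
  qed
  also have "\<dots> = Determinant.det (leibniz_mat k A)"
    by (rule det_def'[symmetric]) simp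
  finally show ?thesis .
qed

lemma sum_shift1: "(\<Sum>n=1..k. f n) = (\<Sum>n = 0..<k. f (Suc n))" for f :: "nat \<Rightarrow> complex"
  using sum.shift_bounds_Suc_ivl[of f 0 k] by (simp add: atLeastLessThanSuc_atLeastAtMost)

lemma leibniz_mat_vec:
  "i < k \<Longrightarrow> vec_index (mult_mat_vec (leibniz_mat k A) (Matrix.vec k x)) i = (\<Sum>n = 0..<k. A (Suc i) (Suc n) * x n)"
  by (simp add: scalar_prod_def)

lemma leibniz_det_eq_0_kernel:
  assumes "leibniz_det k A = 0"
  obtains a where "\<exists>n\<in>{1..k}. a n \<noteq> 0" "\<And>i. i \<in> {1..k} \<Longrightarrow> (\<Sum>n=1..k. A i n * a n) = 0"
proof -
  have M: "leibniz_mat k A \<in> carrier_mat k k" by simp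
  obtain v where v: "v \<in> carrier_vec k" "v \<noteq> 0\<^sub>v k" "mult_mat_vec (leibniz_mat k A) v = 0\<^sub>v k"
    using assms det_0_iff_vec_prod_zero_field[OF M] unfolding leibniz_det_eq_det by blast
  define a where "a n = vec_index v (n - 1)" for n
  have va: "v = Matrix.vec k (\<lambda>n. a (Suc n))"
    using v(1) by (intro eq_vecI) (auto simp: a_def)
  show ?thesis
  proof (rule that[of a])
    show "\<exists>n\<in>{1..k}. a n \<noteq> 0"
    proof (rule ccontr)
      assume "\<not> (\<exists>n\<in>{1..k}. a n \<noteq> 0)"
      then have "v = 0\<^sub>v k" unfolding va by (intro eq_vecI) auto
      with v(2) show False by simp
    qed
    show "(\<Sum>n=1..k. A i n * a n) = 0" if "i \<in> {1..k}" for i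
    proof -
      have i: "i - 1 < k" "Suc (i - 1) = i" using that by auto
      have "(\<Sum>n = 0..<k. A (Suc (i - 1)) (Suc n) * a (Suc n))
          = vec_index (mult_mat_vec (leibniz_mat k A) (Matrix.vec k (\<lambda>n. a (Suc n)))) (i - 1)"
        by (rule leibniz_mat_vec[OF i(1), symmetric])
      also have "\<dots> = 0" unfolding va[symmetric] v(3) using i(1) by simp
      finally show ?thesis unfolding sum_shift1 i(2) .
    qed
  qed
qed

text \<open>The solution is \<open>x = (1 / det A) adj A b\<close>; the quotients of determinants are its coordinates.\<close>

lemma leibniz_det_cramer:
  assumes nz: "leibniz_det k A \<noteq> 0" and i: "i \<in> {1..k}"
  shows "(\<Sum>n=1..k. A i n * (leibniz_det k (\<lambda>i m. if m = n then b i else A i m) / leibniz_det k A)) = b i"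
proof -
  let ?M = "leibniz_mat k A" and ?b = "Matrix.vec k (\<lambda>i. b (Suc i))"
  \<comment> \<open>\<open>x\<close> solves \<open>A x = b\<close> by the adjugate identity; its coordinates are then given by Cramer's rule\<close>
  define d where "d = Determinant.det ?M"
  have d: "d \<noteq> 0" "leibniz_det k A = d" using nz by (simp_all add: leibniz_det_eq_det d_def)
  have M: "?M \<in> carrier_mat k k" and bv: "?b \<in> carrier_vec k" by simp_all
  note adj = adj_mat[OF M]
  define x where "x = (1 / d) \<cdot>\<^sub>v (mult_mat_vec (adj_mat ?M) ?b)"
  have x: "x \<in> carrier_vec k" unfolding x_def using adj(1) bv by auto
  have "mult_mat_vec ?M x = (1 / d) \<cdot>\<^sub>v (mult_mat_vec ?M (mult_mat_vec (adj_mat ?M) ?b))"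
    unfolding x_def by (rule mult_mat_vec[OF M]) (use adj(1) bv in auto)
  also have "mult_mat_vec ?M (mult_mat_vec (adj_mat ?M) ?b) = mult_mat_vec (d \<cdot>\<^sub>m 1\<^sub>m k) ?b"
    unfolding assoc_mult_mat_vec[OF M adj(1) bv, symmetric] adj(2) d_def by (rule refl)
  also have "(1 / d) \<cdot>\<^sub>v \<dots> = ?b"
    using d by (intro eq_vecI) (auto simp: scalar_prod_def mult_delta_left mult_delta_right)
  finally have Mx: "mult_mat_vec ?M x = ?b" .
  have xn: "leibniz_det k (\<lambda>i m. if m = Suc n then b i else A i m) / leibniz_det k A = vec_index x n" if "n < k" for n
  proof -
    have "replace_col ?M ?b n = leibniz_mat k (\<lambda>i m. if m = Suc n then b i else A i m)"
      unfolding replace_col_def by (intro eq_matI) auto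
    then have "leibniz_det k (\<lambda>i m. if m = Suc n then b i else A i m) = vec_index x n * d"
      using cramer_lemma_mat[OF M x that] unfolding Mx by (simp add: leibniz_det_eq_det d_def)
    then show ?thesis using d by simp
  qed
  obtain j where j: "i = Suc j" "j < k" using i by (cases i) auto
  have "(\<Sum>n=1..k. A i n * (leibniz_det k (\<lambda>i m. if m = n then b i else A i m) / leibniz_det k A))
      = (\<Sum>n = 0..<k. A (Suc j) (Suc n) * vec_index x n)"
    unfolding sum_shift1 j(1) by (rule sum.cong[OF refl]) (simp only: xn atLeastLessThan_iff)
  also have "\<dots> = vec_index (mult_mat_vec ?M (Matrix.vec k (vec_index x))) j"
    by (rule leibniz_mat_vec[OF j(2), symmetric])
  also have "Matrix.vec k (vec_index x) = x" using x by (intro eq_vecI) auto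
  also have "vec_index (mult_mat_vec ?M x) j = b i" unfolding Mx using j by simp
  finally show ?thesis .
qed

context gauge_filter
begin

section \<open>The initial value problem for nets\<close>

lemma compact_segments:
  fixes K :: "real set"
  assumes "compact K"
  obtains L where "\<And>x. x \<in> K \<Longrightarrow> \<bar>x - a\<bar> \<le> L" "\<And>x s. x \<in> K \<Longrightarrow> s \<in> closed_segment a x \<Longrightarrow> s \<in> {a - L..a + L}"
proof -
  obtain L where L: "\<And>x. x \<in> K \<Longrightarrow> \<bar>x\<bar> \<le> L"
    using compact_imp_bounded[OF assms] by (force simp: bounded_iff)
  have *: "\<bar>x - a\<bar> \<le> L + \<bar>a\<bar>" if "x \<in> K" for x using L[OF that] by linarith
  show ?thesis
  proof (rule that[of "L + \<bar>a\<bar>"])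
    show "s \<in> {a - (L + \<bar>a\<bar>)..a + (L + \<bar>a\<bar>)}" if "x \<in> K" "s \<in> closed_segment a x" for x s
      using closed_segment_abs_le[OF that(2)] *[OF that(1)] by auto
  qed (rule *)
qed

text \<open>The bound of \<open>ode_bound\<close> for all \<open>\<phi>\<close> at once. The majorant \<open>b\<close> is arbitrary, so the same statement
  serves for moderate and for negligible data.\<close>

lemma ode_net_bound:
  fixes u :: "test_fun \<Rightarrow> real \<Rightarrow> complex"
  assumes P: "P \<noteq> 0" and u: "\<And>\<phi>. smooth (u \<phi>)" and K: "compact K"
  obtains C K' where "C \<ge> 0" "compact K'"
    "\<forall>b. (\<forall>i\<le>j. \<forall>\<^sub>F \<phi> in U. \<forall>s\<in>K'. cmod ((dx ^^ i) (pdt P (u \<phi>)) s) \<le> b \<phi>) \<longrightarrow>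
      (\<forall>i<degree P. \<forall>\<^sub>F \<phi> in U. cmod ((dx ^^ i) (u \<phi>) a) \<le> b \<phi>) \<longrightarrow>
      (\<forall>\<^sub>F \<phi> in U. \<forall>x\<in>K. cmod ((dx ^^ j) (u \<phi>) x) \<le> C * b \<phi>)"
proof -
  obtain L where L: "\<And>x. x \<in> K \<Longrightarrow> \<bar>x - a\<bar> \<le> L"
    "\<And>x s. x \<in> K \<Longrightarrow> s \<in> closed_segment a x \<Longrightarrow> s \<in> {a - L..a + L}"
    using compact_segments[OF K] by blast
  obtain C where C: "C \<ge> 0" and bound: "\<And>u a t B. smooth u \<Longrightarrow> \<bar>t - a\<bar> \<le> L \<Longrightarrow>
      (\<And>s i. s \<in> closed_segment a t \<Longrightarrow> i \<le> j \<Longrightarrow> cmod ((dx ^^ i) (pdt P u) s) \<le> B) \<Longrightarrow>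
      (\<And>i. i < degree P \<Longrightarrow> cmod ((dx ^^ i) u a) \<le> B) \<Longrightarrow> cmod ((dx ^^ j) u t) \<le> C * B"
    by (rule ode_boundE[OF P, where L = L and j = j]) blast
  show ?thesis
  proof (rule that[OF C, of "{a - L..a + L}"], simp, intro allI impI)
    fix b :: "test_fun \<Rightarrow> real"
    assume rhs: "\<forall>i\<le>j. \<forall>\<^sub>F \<phi> in U. \<forall>s\<in>{a - L..a + L}. cmod ((dx ^^ i) (pdt P (u \<phi>)) s) \<le> b \<phi>"
      and init: "\<forall>i<degree P. \<forall>\<^sub>F \<phi> in U. cmod ((dx ^^ i) (u \<phi>) a) \<le> b \<phi>"
    have "\<forall>\<^sub>F \<phi> in U. \<forall>i\<in>{..j}. \<forall>s\<in>{a - L..a + L}. cmod ((dx ^^ i) (pdt P (u \<phi>)) s) \<le> b \<phi>"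
      using rhs by (intro eventually_ball_finite) auto
    moreover have "\<forall>\<^sub>F \<phi> in U. \<forall>i\<in>{..<degree P}. cmod ((dx ^^ i) (u \<phi>) a) \<le> b \<phi>"
      using init by (intro eventually_ball_finite) auto
    ultimately show "\<forall>\<^sub>F \<phi> in U. \<forall>x\<in>K. cmod ((dx ^^ j) (u \<phi>) x) \<le> C * b \<phi>"
    proof eventually_elim
      case (elim \<phi>)
      show ?case
      proof
        fix x assume x: "x \<in> K"
        show "cmod ((dx ^^ j) (u \<phi>) x) \<le> C * b \<phi>"
          by (rule bound[OF u L(1)[OF x]]) (use elim L(2)[OF x] in auto)
      qed
    qed
  qed
qed

lemma ode_negligible:
  assumes P: "P \<noteq> 0" and u: "\<And>\<phi>. smooth (u \<phi>)"
    and rhs: "(\<lambda>\<phi>. pdt P (u \<phi>)) \<in> E_negligible U"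
    and init: "\<And>i. i < degree P \<Longrightarrow> (\<lambda>\<phi>. (dx ^^ i) (u \<phi>) a) \<in> C_negligible U"
  shows "u \<in> E_negligible U"
  unfolding E_negligible_iff
proof (intro conjI allI impI)
  fix j and K :: "real set" assume K: "compact K"
  obtain C K' where "C \<ge> 0" and K': "compact K'"
    and bound: "\<forall>b. (\<forall>i\<le>j. \<forall>\<^sub>F \<phi> in U. \<forall>s\<in>K'. cmod ((dx ^^ i) (pdt P (u \<phi>)) s) \<le> b \<phi>) \<longrightarrow>
      (\<forall>i<degree P. \<forall>\<^sub>F \<phi> in U. cmod ((dx ^^ i) (u \<phi>) a) \<le> b \<phi>) \<longrightarrow>
      (\<forall>\<^sub>F \<phi> in U. \<forall>x\<in>K. cmod ((dx ^^ j) (u \<phi>) x) \<le> C * b \<phi>)"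
    by (rule ode_net_bound[OF P u K, where j = j and a = a]) (rule that)
  show "negligible_on K (\<lambda>\<phi>. (dx ^^ j) (u \<phi>))"
  proof (rule negligible_onI)
    fix p
    show "\<forall>\<^sub>F \<phi> in U. \<forall>x\<in>K. cmod ((dx ^^ j) (u \<phi>) x) \<le> C * radius \<phi> ^ p"
    proof (rule bound[rule_format])
      show "\<forall>\<^sub>F \<phi> in U. \<forall>s\<in>K'. cmod ((dx ^^ i) (pdt P (u \<phi>)) s) \<le> radius \<phi> ^ p" for i
        using rhs K' unfolding E_negligible_iff negligible_on_def by blast
      show "\<forall>\<^sub>F \<phi> in U. cmod ((dx ^^ i) (u \<phi>) a) \<le> radius \<phi> ^ p" if "i < degree P" for i
        using init[OF that] unfolding C_negligible_def by blast
    qed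
  qed
qed (rule u)

text \<open>Moderateness provides one exponent for each derivative; finitely many are replaced by a common one.\<close>

lemma eventually_common_exponent:
  assumes "finite I" and "\<And>i. i \<in> I \<Longrightarrow> \<exists>m::nat. \<forall>\<^sub>F \<phi> in U. Q i \<phi> (1 / radius \<phi> ^ m)"
    and mono: "\<And>i \<phi> B B'. Q i \<phi> B \<Longrightarrow> B \<le> B' \<Longrightarrow> Q i \<phi> B'"
  shows "\<exists>m::nat. \<forall>n\<ge>m. \<forall>i\<in>I. \<forall>\<^sub>F \<phi> in U. Q i \<phi> (1 / radius \<phi> ^ n)"
proof -
  obtain m where m: "\<And>i. i \<in> I \<Longrightarrow> \<forall>\<^sub>F \<phi> in U. Q i \<phi> (1 / radius \<phi> ^ m i)"
    using assms(2) by metis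
  have "\<forall>\<^sub>F \<phi> in U. Q i \<phi> (1 / radius \<phi> ^ n)" if "i \<in> I" "sum m I \<le> n" for i n
    using m[OF that(1)] radius_le_1
  proof eventually_elim
    case (elim \<phi>)
    have "m i \<le> sum m I" using assms(1) that by (intro member_le_sum) auto
    then show ?case using that by (intro mono[OF elim(1)] inverse_radius_mono elim(2)) simp
  qed
  then show ?thesis by blast
qed

lemma ode_moderate:
  assumes P: "P \<noteq> 0" and u: "\<And>\<phi>. smooth (u \<phi>)"
    and rhs: "(\<lambda>\<phi>. pdt P (u \<phi>)) \<in> E_moderate U"
    and init: "\<And>i. i < degree P \<Longrightarrow> (\<lambda>\<phi>. (dx ^^ i) (u \<phi>) a) \<in> C_moderate U"
  shows "u \<in> E_moderate U"
  unfolding E_moderate_iff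
proof (intro conjI allI impI)
  fix j and K :: "real set" assume K: "compact K"
  obtain C K' where "C \<ge> 0" and K': "compact K'"
    and bound: "\<forall>b. (\<forall>i\<le>j. \<forall>\<^sub>F \<phi> in U. \<forall>s\<in>K'. cmod ((dx ^^ i) (pdt P (u \<phi>)) s) \<le> b \<phi>) \<longrightarrow>
      (\<forall>i<degree P. \<forall>\<^sub>F \<phi> in U. cmod ((dx ^^ i) (u \<phi>) a) \<le> b \<phi>) \<longrightarrow>
      (\<forall>\<^sub>F \<phi> in U. \<forall>x\<in>K. cmod ((dx ^^ j) (u \<phi>) x) \<le> C * b \<phi>)"
    by (rule ode_net_bound[OF P u K, where j = j and a = a]) (rule that)
  have "\<exists>m::nat. \<forall>n\<ge>m. \<forall>i\<in>{..j}. \<forall>\<^sub>F \<phi> in U. \<forall>s\<in>K'. cmod ((dx ^^ i) (pdt P (u \<phi>)) s) \<le> 1 / radius \<phi> ^ n"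
    by (rule eventually_common_exponent)
      (use rhs K' in \<open>auto simp: E_moderate_def intro: order_trans\<close>)
  moreover have "\<exists>m::nat. \<forall>n\<ge>m. \<forall>i\<in>{..<degree P}. \<forall>\<^sub>F \<phi> in U. cmod ((dx ^^ i) (u \<phi>) a) \<le> 1 / radius \<phi> ^ n"
    by (rule eventually_common_exponent)
      (use init in \<open>auto simp: C_moderate_def intro: order_trans\<close>)
  ultimately obtain m m' where m:
    "\<forall>n\<ge>m. \<forall>i\<in>{..j}. \<forall>\<^sub>F \<phi> in U. \<forall>s\<in>K'. cmod ((dx ^^ i) (pdt P (u \<phi>)) s) \<le> 1 / radius \<phi> ^ n"
    "\<forall>n\<ge>m'. \<forall>i\<in>{..<degree P}. \<forall>\<^sub>F \<phi> in U. cmod ((dx ^^ i) (u \<phi>) a) \<le> 1 / radius \<phi> ^ n"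
    by blast
  have "\<forall>\<^sub>F \<phi> in U. \<forall>x\<in>K. cmod ((dx ^^ j) (u \<phi>) x) \<le> C * (1 / radius \<phi> ^ (m + m'))"
    by (rule bound[rule_format]) (use m in auto)
  then show "moderate_on K (\<lambda>\<phi>. (dx ^^ j) (u \<phi>))"
    by (intro moderate_onI) simp
qed (rule u)

lemma C_zero: "\<zero>\<^bsub>C_hat U\<^esub> = C_class U (\<lambda>_. 0)"
  by (simp add: hat_simps C.zero_Quot zero_fun_def)

lemma ivp_solution_class:
  assumes u: "u \<in> E_moderate U"
  shows "ivp_solution U P (E_class U f) (E_class U u) \<longleftrightarrow>
    (\<lambda>\<phi> x. pdt P (u \<phi>) x - f \<phi> x) \<in> E_negligible U \<and>
    (\<forall>j<degree P. (\<lambda>\<phi>. (dx ^^ j) (u \<phi>) 0) \<in> C_negligible U)"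
  using u by (auto simp: ivp_solution_def E_class_carrier pdt_E_class E_class_eq_iff
      E_deriv_pow_class E_eval_class C_zero C_class_eq_iff)

lemma C_negligible_diff:
  "A \<in> C_negligible U \<Longrightarrow> B \<in> C_negligible U \<Longrightarrow> (\<lambda>\<phi>. A \<phi> - B \<phi>) \<in> C_negligible U"
  using C.diff_I[of A B] by (simp add: fun_diff_def)

lemma E_negligible_diff:
  "f \<in> E_negligible U \<Longrightarrow> g \<in> E_negligible U \<Longrightarrow> (\<lambda>\<phi> x. f \<phi> x - g \<phi> x) \<in> E_negligible U"
  using E.diff_I[of f g] by (simp add: fun_diff_def)

lemma ivp_unique:
  assumes P: "P \<noteq> 0" and y: "ivp_solution U P F y" and z: "ivp_solution U P F z"
    and F: "F \<in> carrier (E_hat U)"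
  shows "y = z"
proof -
  obtain f where f: "f \<in> E_moderate U" "F = E_class U f" using F E_carrier by blast
  obtain u where u: "u \<in> E_moderate U" "y = E_class U u"
    using y E_carrier unfolding ivp_solution_def by blast
  obtain v where v: "v \<in> E_moderate U" "z = E_class U v"
    using z E_carrier unfolding ivp_solution_def by blast
  note u' = y[unfolded u(2) f(2) ivp_solution_class[OF u(1)]]
  note v' = z[unfolded v(2) f(2) ivp_solution_class[OF v(1)]]
  have sm: "smooth (u \<phi>)" "smooth (v \<phi>)" for \<phi> using u v E_moderate_smooth by auto
  have "(\<lambda>\<phi> x. u \<phi> x - v \<phi> x) \<in> E_negligible U"
  proof (rule ode_negligible[OF P, where a = 0])
    show "smooth (\<lambda>x. u \<phi> x - v \<phi> x)" for \<phi> by (intro smooth_diff sm)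
    show "(\<lambda>\<phi>. pdt P (\<lambda>x. u \<phi> x - v \<phi> x)) \<in> E_negligible U"
      using E_negligible_diff[OF u'[THEN conjunct1] v'[THEN conjunct1]] by (simp add: pdt_diff sm)
    show "(\<lambda>\<phi>. (dx ^^ i) (\<lambda>x. u \<phi> x - v \<phi> x) 0) \<in> C_negligible U" if "i < degree P" for i
      using C_negligible_diff[of "\<lambda>\<phi>. (dx ^^ i) (u \<phi>) 0" "\<lambda>\<phi>. (dx ^^ i) (v \<phi>) 0"] u' v' that
      by (simp add: dx_pow_diff sm)
  qed
  then show ?thesis using u v by (simp add: E_class_eq_iff)
qed

lemma ivp_exists:
  assumes P: "P \<noteq> 0" and F: "F \<in> carrier (E_hat U)"
  shows "\<exists>y. ivp_solution U P F y"
proof -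
  obtain f where f: "f \<in> E_moderate U" "F = E_class U f" using F E_carrier by blast
  have "\<exists>v. smooth v \<and> pdt P v = f \<phi> \<and> (\<forall>i<degree P. (dx ^^ i) v 0 = 0)" for \<phi>
    by (rule ode_exists[OF P E_moderate_smooth[OF f(1)]])
  then obtain u where u: "\<And>\<phi>. smooth (u \<phi>)" "\<And>\<phi>. pdt P (u \<phi>) = f \<phi>"
    "\<And>\<phi> i. i < degree P \<Longrightarrow> (dx ^^ i) (u \<phi>) 0 = 0"
    by metis
  have "u \<in> E_moderate U"
    by (rule ode_moderate[OF P u(1), where a = 0]) (use u f C_moderate_const in simp_all)
  then have "ivp_solution U P F (E_class U u)"
    using u C.zero_I E.zero_I by (simp add: f(2) ivp_solution_class zero_fun_def)
  then show ?thesis by blast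
qed

section \<open>Convolution with the Green function\<close>

lemma cutoff_properties:
  shows "smooth cutoff" "- 1 \<le> x \<Longrightarrow> cutoff x = 1" "x \<le> - 2 \<Longrightarrow> cutoff x = 0"
proof -
  obtain \<phi> where \<phi>: "\<phi> \<in> DD (Suc 0)"
    using eventually_happens[OF DD_ev[of "Suc 0"]] nontriv by blast
  have "tf \<phi> x = 0" if "1 < \<bar>x\<bar>" for x
    using \<phi> that by (intro radius_bound) (simp add: DD_def)
  moreover have "(LINT x|lborel. tf \<phi> x) = 1" using \<phi> by (simp add: DD_def)
  ultimately show "smooth cutoff" "- 1 \<le> x \<Longrightarrow> cutoff x = 1" "x \<le> - 2 \<Longrightarrow> cutoff x = 0"
    using cutoff_props[of \<phi>] by auto
qed

lemma conv_tf_green: "P \<noteq> 0 \<Longrightarrow> S \<in> dist_plus \<Longrightarrow>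
    conv_tf (dist_conv (green P) S) = (\<lambda>\<phi>. causal_solution P (conv_tf S \<phi>))"
  by (rule ext) (rule conv_tf_dist_conv_green[OF _ _ cutoff_properties])

text \<open>For \<open>radius \<phi> \<le> 1\<close> the regularization of a distribution supported in \<open>[0, \<infinity>)\<close> vanishes left of
  \<open>-1\<close>, hence so does the causal solution. The point \<open>-2\<close> therefore carries zero initial data,
  simultaneously for almost every \<open>\<phi>\<close>.\<close>

lemma causal_conv_tf:
  assumes P: "P \<noteq> 0" and S: "S \<in> dist_plus"
  shows "smooth (causal_solution P (conv_tf S \<phi>))" "pdt P (causal_solution P (conv_tf S \<phi>)) = conv_tf S \<phi>"
    "radius \<phi> \<le> 1 \<Longrightarrow> (dx ^^ i) (causal_solution P (conv_tf S \<phi>)) (- 2) = 0"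
proof -
  have S': "S \<in> distributions" "vanishes_on S {..<0}"
    using S by (auto simp: dist_plus_def Compl_atLeast)
  have left: "\<forall>x < - radius \<phi>. conv_tf S \<phi> x = 0"
    using conv_tf_vanishes_left[OF S'(2) radius_bound] by blast
  note c = causal_props[OF P smooth_conv_tf[OF S'(1)] left]
  show "smooth (causal_solution P (conv_tf S \<phi>))" "pdt P (causal_solution P (conv_tf S \<phi>)) = conv_tf S \<phi>"
    by (rule c)+
  show "(dx ^^ i) (causal_solution P (conv_tf S \<phi>)) (- 2) = 0" if "radius \<phi> \<le> 1"
    by (rule smooth_zero_dx_pow_left[of "- radius \<phi>"]) (use c(3) that in auto)
qed

lemma causal_conv_tf_moderate:
  assumes P: "P \<noteq> 0" and S: "S \<in> dist_plus"
  shows "(\<lambda>\<phi>. causal_solution P (conv_tf S \<phi>)) \<in> E_moderate U"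
proof (rule ode_moderate[OF P, where a = "- 2"])
  show "(\<lambda>\<phi>. pdt P (causal_solution P (conv_tf S \<phi>))) \<in> E_moderate U"
    using S by (simp add: causal_conv_tf[OF P S] conv_tf_moderate dist_plus_def)
  show "(\<lambda>\<phi>. (dx ^^ i) (causal_solution P (conv_tf S \<phi>)) (- 2)) \<in> C_moderate U" for i
    unfolding C_moderate_iff
  proof (rule moderate_on_bounded[of _ _ 0])
    show "\<forall>\<^sub>F \<phi> in U. \<forall>_\<in>{0::real}. cmod ((dx ^^ i) (causal_solution P (conv_tf S \<phi>)) (- 2)) \<le> 0"
      using radius_le_1 by eventually_elim (simp add: causal_conv_tf(3)[OF P S])
  qed
qed (rule causal_conv_tf[OF P S])

text \<open>On representatives, convolution with the Green function is an exact right inverse of \<open>P(d/dt)\<close>, with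
  zero initial data at \<open>-2\<close>.\<close>

lemma lin_comb_green:
  assumes P: "P \<noteq> 0"
    and \<alpha>S: "\<forall>n\<in>{1..m}. \<alpha> n \<in> carrier (C_hat U) \<and> S n \<in> dist_plus"
  obtains f h where "f \<in> E_moderate U" "lin_comb U m \<alpha> S = E_class U f"
    "h \<in> E_moderate U" "lin_comb U m \<alpha> (\<lambda>n. dist_conv (green P) (S n)) = E_class U h"
    "\<And>\<phi>. pdt P (h \<phi>) = f \<phi>"
    "\<And>i. \<forall>\<^sub>F \<phi> in U. (dx ^^ i) (h \<phi>) (- 2) = 0"
proof -
  have S: "S n \<in> dist_plus" if "n \<in> {1..m}" for n using \<alpha>S that by blast
  have "\<exists>A\<in>C_moderate U. \<alpha> n = C_class U A" if "n \<in> {1..m}" for n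
    using \<alpha>S that C_carrier by blast
  then obtain a where a: "\<And>n. n \<in> {1..m} \<Longrightarrow> a n \<in> C_moderate U"
    "\<And>n. n \<in> {1..m} \<Longrightarrow> \<alpha> n = C_class U (a n)"
    by metis
  define f where "f = (\<lambda>\<phi> x. \<Sum>n=1..m. a n \<phi> * conv_tf (S n) \<phi> x)"
  define h where "h = (\<lambda>\<phi> x. \<Sum>n=1..m. a n \<phi> * causal_solution P (conv_tf (S n) \<phi>) x)"
  have Sm: "conv_tf (S n) \<in> E_moderate U" if "n \<in> {1..m}" for n
    using S[OF that] by (simp add: conv_tf_moderate dist_plus_def)
  have Gm: "conv_tf (dist_conv (green P) (S n)) \<in> E_moderate U" if "n \<in> {1..m}" for n
    unfolding conv_tf_green[OF P S[OF that]] by (rule causal_conv_tf_moderate[OF P S[OF that]])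
  have sm: "smooth (\<lambda>x. a n \<phi> * causal_solution P (conv_tf (S n) \<phi>) x)" if "n \<in> {1..m}" for n \<phi>
    by (intro smooth_cmult causal_conv_tf[OF P S[OF that]])
  show ?thesis
  proof (rule that[of f h])
    show "f \<in> E_moderate U" unfolding f_def
      by (intro E_moderate_sum E_moderate_mult E_moderate_const a Sm)
    show "h \<in> E_moderate U" unfolding h_def
      by (intro E_moderate_sum E_moderate_mult E_moderate_const a causal_conv_tf_moderate[OF P] S)
    show "lin_comb U m \<alpha> S = E_class U f"
      unfolding f_def by (rule lin_comb_class[OF a(2,1) Sm])
    have "lin_comb U m \<alpha> (\<lambda>n. dist_conv (green P) (S n))
        = E_class U (\<lambda>\<phi> x. \<Sum>n=1..m. a n \<phi> * conv_tf (dist_conv (green P) (S n)) \<phi> x)"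
      by (rule lin_comb_class[OF a(2,1) Gm])
    also have "(\<lambda>\<phi> x. \<Sum>n=1..m. a n \<phi> * conv_tf (dist_conv (green P) (S n)) \<phi> x) = h"
      unfolding h_def by (intro ext sum.cong refl) (simp only: conv_tf_green[OF P S])
    finally show "lin_comb U m \<alpha> (\<lambda>n. dist_conv (green P) (S n)) = E_class U h" .
    show "pdt P (h \<phi>) = f \<phi>" for \<phi>
    proof -
      have "pdt P (h \<phi>) = (\<lambda>x. \<Sum>n=1..m. pdt P (\<lambda>x. a n \<phi> * causal_solution P (conv_tf (S n) \<phi>) x) x)"
        unfolding h_def by (rule pdt_sum) (rule sm)
      also have "\<dots> = f \<phi>" unfolding f_def
        by (intro ext sum.cong refl) (simp add: pdt_cmult causal_conv_tf[OF P S] del: One_nat_def)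
      finally show ?thesis .
    qed
    show "\<forall>\<^sub>F \<phi> in U. (dx ^^ i) (h \<phi>) (- 2) = 0" for i
      using radius_le_1
    proof eventually_elim
      case (elim \<phi>)
      have "(dx ^^ i) (h \<phi>) = (\<lambda>x. \<Sum>n=1..m. (dx ^^ i) (\<lambda>x. a n \<phi> * causal_solution P (conv_tf (S n) \<phi>) x) x)"
        unfolding h_def by (rule dx_pow_sum) (rule sm)
      moreover have "(dx ^^ i) (\<lambda>x. a n \<phi> * causal_solution P (conv_tf (S n) \<phi>) x) (- 2) = 0" if "n \<in> {1..m}" for n
        by (simp add: dx_pow_cmult causal_conv_tf[OF P S[OF that]] elim)
      ultimately show ?case by simp
    qed
  qed
qed

text \<open>Independence of the representation of \<open>F\<close> as a linear combination: the functions \<open>h\<close> and \<open>h'\<close>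
  obtained from two representations satisfy \<open>P(d/dt) (h' - h) = f' - f\<close>, which is negligible, and
  have zero initial data at \<open>-2\<close>; so \<open>h' - h\<close> is negligible.\<close>

lemma conv_hat_green:
  assumes P: "P \<noteq> 0" and F: "F \<in> hat_span U dist_plus"
  obtains f h where "f \<in> E_moderate U" "F = E_class U f"
    "h \<in> E_moderate U" "conv_hat U (green P) F = E_class U h"
    "\<And>\<phi>. pdt P (h \<phi>) = f \<phi>"
proof -
  obtain m \<alpha> S where rep: "F = lin_comb U m \<alpha> S"
    "\<forall>n\<in>{1..m}. \<alpha> n \<in> carrier (C_hat U) \<and> S n \<in> dist_plus"
    using F unfolding hat_span_def by blast
  obtain f h where fh: "f \<in> E_moderate U" "lin_comb U m \<alpha> S = E_class U f"
    "h \<in> E_moderate U" "lin_comb U m \<alpha> (\<lambda>n. dist_conv (green P) (S n)) = E_class U h"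
    "\<And>\<phi>. pdt P (h \<phi>) = f \<phi>" "\<And>i. \<forall>\<^sub>F \<phi> in U. (dx ^^ i) (h \<phi>) (- 2) = 0"
    by (rule lin_comb_green[OF P rep(2)]) blast
  have "conv_hat U (green P) F = E_class U h"
    unfolding conv_hat_def
  proof (rule the_equality)
    show "\<exists>m \<alpha> S. (\<forall>n\<in>{1..m}. \<alpha> n \<in> carrier (C_hat U) \<and> S n \<in> dist_plus) \<and> F = lin_comb U m \<alpha> S \<and>
        E_class U h = lin_comb U m \<alpha> (\<lambda>n. dist_conv (green P) (S n))"
      using rep fh(4) by metis
  next
    fix g assume "\<exists>m \<alpha> S. (\<forall>n\<in>{1..m}. \<alpha> n \<in> carrier (C_hat U) \<and> S n \<in> dist_plus) \<and> F = lin_comb U m \<alpha> S \<and>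
        g = lin_comb U m \<alpha> (\<lambda>n. dist_conv (green P) (S n))"
    then obtain m' \<alpha>' S' where rep': "F = lin_comb U m' \<alpha>' S'"
      "g = lin_comb U m' \<alpha>' (\<lambda>n. dist_conv (green P) (S' n))"
      "\<forall>n\<in>{1..m'}. \<alpha>' n \<in> carrier (C_hat U) \<and> S' n \<in> dist_plus"
      by blast
    obtain f' h' where fh': "f' \<in> E_moderate U" "lin_comb U m' \<alpha>' S' = E_class U f'"
      "h' \<in> E_moderate U" "lin_comb U m' \<alpha>' (\<lambda>n. dist_conv (green P) (S' n)) = E_class U h'"
      "\<And>\<phi>. pdt P (h' \<phi>) = f' \<phi>" "\<And>i. \<forall>\<^sub>F \<phi> in U. (dx ^^ i) (h' \<phi>) (- 2) = 0"
      by (rule lin_comb_green[OF P rep'(3)]) blast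
    have sm: "smooth (h \<phi>)" "smooth (h' \<phi>)" for \<phi> using fh fh' E_moderate_smooth by auto
    have "(\<lambda>\<phi> x. h' \<phi> x - h \<phi> x) \<in> E_negligible U"
    proof (rule ode_negligible[OF P, where a = "- 2"])
      show "smooth (\<lambda>x. h' \<phi> x - h \<phi> x)" for \<phi> by (intro smooth_diff sm)
      have "E_class U f' = E_class U f" using rep(1) rep'(1) fh(2) fh'(2) by simp
      then show "(\<lambda>\<phi>. pdt P (\<lambda>x. h' \<phi> x - h \<phi> x)) \<in> E_negligible U"
        by (simp add: pdt_diff sm fh(5) fh'(5) E_class_eq_iff)
      show "(\<lambda>\<phi>. (dx ^^ i) (\<lambda>x. h' \<phi> x - h \<phi> x) (- 2)) \<in> C_negligible U" for i
        unfolding C_negligible_iff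
      proof (rule negligible_on_eventually_0)
        show "\<forall>\<^sub>F \<phi> in U. \<forall>_\<in>{0::real}. (dx ^^ i) (\<lambda>x. h' \<phi> x - h \<phi> x) (- 2) = 0"
          using fh(6)[of i] fh'(6)[of i] by eventually_elim (simp add: dx_pow_diff sm)
      qed
    qed
    then show "g = E_class U h" by (simp add: rep'(2) fh'(4) E_class_eq_iff)
  qed
  with fh rep(1) that show ?thesis by metis
qed

section \<open>The solution formula\<close>

text \<open>The test functions form an approximate identity: their integrals are \<open>1\<close>, their \<open>L\<^sup>1\<close> norms are at
  most \<open>2\<close>, and their supports shrink to \<open>0\<close>.\<close>

lemma conv_tf_regular_tendsto:
  assumes h: "smooth h"
  shows "((\<lambda>\<phi>. conv_tf (regular_dist h) \<phi> 0) \<longlongrightarrow> h 0) U"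
proof (rule tendstoI)
  fix e :: real assume e: "e > 0"
  from smooth_cont[OF h, of 0, unfolded continuous_at_eps_delta, rule_format, of "e / 4"] e
  obtain \<delta> where \<delta>: "\<delta> > 0" "\<And>y. dist y 0 < \<delta> \<Longrightarrow> dist (h y) (h 0) < e / 4" by auto
  show "\<forall>\<^sub>F \<phi> in U. dist (conv_tf (regular_dist h) \<phi> 0) (h 0) < e"
    using DD_ev[of "Suc 0"] radius_small[of "2 / \<delta>"]
  proof eventually_elim
    case (elim \<phi>)
    have \<phi>: "tf \<phi> (- x) = tf \<phi> x" "(LINT x|lborel. tf \<phi> x) = 1" "(LINT x|lborel. cmod (tf \<phi> x)) \<le> 2" for x
      using elim(1) by (auto simp: DD_def)
    have int: "integrable lborel (\<lambda>x. g x * tf \<phi> x)" if "smooth g" for g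
      by (rule integrable_smooth_testfn[OF that testfn_tf])
    have int1: "integrable lborel (tf \<phi>)" using int[of "\<lambda>_. 1"] by simp
    have "conv_tf (regular_dist h) \<phi> 0 - h 0
        = (LINT x|lborel. h x * tf \<phi> x) - (LINT x|lborel. h 0 * tf \<phi> x)"
      using \<phi> by (simp add: conv_tf_regular)
    also have "\<dots> = (LINT x|lborel. (h x - h 0) * tf \<phi> x)"
      using int[OF h] int[OF smooth_const] by (simp add: left_diff_distrib del: integral_mult_right_zero)
    finally have "cmod (conv_tf (regular_dist h) \<phi> 0 - h 0) = cmod (LINT x|lborel. (h x - h 0) * tf \<phi> x)"
      by simp
    also have "\<dots> \<le> (LINT x|lborel. e / 4 * cmod (tf \<phi> x))"
    proof (rule Bochner_Integration.integral_norm_bound_integral)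
      show "integrable lborel (\<lambda>x. (h x - h 0) * tf \<phi> x)" by (intro int smooth_diff h smooth_const)
      show "integrable lborel (\<lambda>x. e / 4 * cmod (tf \<phi> x))" using int1 by simp
      show "cmod ((h x - h 0) * tf \<phi> x) \<le> e / 4 * cmod (tf \<phi> x)" for x
      proof (cases "tf \<phi> x = 0")
        case False
        then have "\<bar>x\<bar> \<le> radius \<phi>" using radius_bound[of \<phi> x] by linarith
        also have "\<dots> < \<delta>" using elim(2) \<delta>(1) radius_pos[of \<phi>] by (simp add: field_simps)
        finally have "cmod (h x - h 0) \<le> e / 4" using \<delta>(2)[of x] by (simp add: dist_norm)
        then show ?thesis unfolding norm_mult by (rule mult_right_mono) simp
      qed simp
    qed
    also have "\<dots> \<le> e / 4 * 2" using \<phi>(3) e by simp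
    finally show ?case using e by (simp add: dist_norm)
  qed
qed

lemma dx_pow_conv_tf_regular_tendsto:
  "smooth h \<Longrightarrow> ((\<lambda>\<phi>. (dx ^^ j) (conv_tf (regular_dist h) \<phi>) 0) \<longlongrightarrow> (dx ^^ j) h 0) U"
  by (simp add: dx_pow_conv_tf_regular conv_tf_regular_tendsto smooth_dx_pow)

text \<open>A net of constants with a limit different from \<open>0\<close> is bounded away from \<open>0\<close> almost everywhere.\<close>

lemma inverse_moderate:
  assumes "(W \<longlongrightarrow> w) U" "w \<noteq> 0"
  shows "\<forall>\<^sub>F \<phi> in U. W \<phi> \<noteq> 0" "(\<lambda>\<phi>. 1 / W \<phi>) \<in> C_moderate U"
proof -
  have "\<forall>\<^sub>F \<phi> in U. dist (W \<phi>) w < cmod w / 2"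
    using assms by (intro tendstoD) auto
  then have *: "\<forall>\<^sub>F \<phi> in U. cmod w / 2 \<le> cmod (W \<phi>)"
  proof eventually_elim
    case (elim \<phi>)
    then show ?case using norm_triangle_ineq2[of w "w - W \<phi>"] by (simp add: dist_norm norm_minus_commute)
  qed
  then show "\<forall>\<^sub>F \<phi> in U. W \<phi> \<noteq> 0"
    by eventually_elim (use assms(2) in auto)
  show "(\<lambda>\<phi>. 1 / W \<phi>) \<in> C_moderate U"
    unfolding C_moderate_iff
  proof (rule moderate_on_bounded)
    show "\<forall>\<^sub>F \<phi> in U. \<forall>_\<in>{0::real}. cmod (1 / W \<phi>) \<le> 1 / (cmod w / 2)"
      using *
    proof eventually_elim
      case (elim \<phi>)
      have w: "0 < cmod w" using assms(2) by simp
      then have "1 / cmod (W \<phi>) \<le> 1 / (cmod w / 2)"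
        using elim by (intro divide_left_mono mult_pos_pos) auto
      then show ?case by (simp only: norm_divide norm_one ball_simps)
    qed
  qed
qed

end

text \<open>If the Wronskian vanished at \<open>0\<close>, a nontrivial linear combination of the \<open>y\<^sub>n\<close> would have zero
  initial data at \<open>0\<close> and would be zero by uniqueness.\<close>

lemma fundamental_wronskian:
  assumes P: "P \<noteq> 0" and deg: "degree P = k" and fs: "fundamental_system P k ys"
  shows "leibniz_det k (\<lambda>i n. (dx ^^ (i - 1)) (ys n) 0) \<noteq> 0"
proof
  assume "leibniz_det k (\<lambda>i n. (dx ^^ (i - 1)) (ys n) 0) = 0"
  then obtain a where a: "\<exists>n\<in>{1..k}. a n \<noteq> 0"
    "\<And>i. i \<in> {1..k} \<Longrightarrow> (\<Sum>n=1..k. (dx ^^ (i - 1)) (ys n) 0 * a n) = 0"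
    by (rule leibniz_det_eq_0_kernel) blast
  have ys: "smooth (ys n)" "pdt P (ys n) x = 0" if "n \<in> {1..k}" for n x
    using fs that unfolding fundamental_system_def by blast+
  have sm: "smooth (\<lambda>x. a n * ys n x)" if "n \<in> {1..k}" for n by (intro smooth_cmult ys that)
  define u where "u = (\<lambda>x. \<Sum>n=1..k. a n * ys n x)"
  have u: "smooth u" unfolding u_def by (intro smooth_sum sm)
  have du: "(dx ^^ j) u = (\<lambda>x. \<Sum>n=1..k. a n * (dx ^^ j) (ys n) x)" for j
    unfolding u_def by (subst dx_pow_sum, erule sm) (intro ext sum.cong refl, simp add: dx_pow_cmult ys del: One_nat_def)
  have "u x = 0" for x
  proof (rule ode_unique[OF P u, of 0])
    show "(dx ^^ i) u 0 = 0" if "i < degree P" for i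
      using a(2)[of "Suc i"] that by (simp add: du deg mult.commute)
    show "pdt P u s = 0" for s
      unfolding u_def by (subst pdt_sum, erule sm) (rule sum.neutral, simp add: pdt_cmult ys del: One_nat_def)
  qed
  then have "\<forall>n\<in>{1..k}. a n = 0"
    using fs unfolding fundamental_system_def u_def by blast
  then show False using a(1) by blast
qed

context gauge_filter
begin

text \<open>For every \<open>\<phi>\<close> the function \<open>\<Sum> c\<^sub>n (y\<^sub>n \<star> \<phi>) + h\<close> solves the equation exactly, whatever the
  constants are. For almost every \<open>\<phi>\<close> the matrix \<open>A \<phi>\<close> of the initial values of the
  \<open>y\<^sub>n \<star> \<phi>\<close> is invertible, because \<open>W = det A\<close> has a nonzero limit, and then Cramer's rule
  makes the initial values vanish exactly.\<close>

lemma solution_formula: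
  assumes P: "P \<noteq> 0" and deg: "degree P = k" and fs: "fundamental_system P k ys"
    and f: "f \<in> E_moderate U" and h: "h \<in> E_moderate U" and hf: "\<And>\<phi>. pdt P (h \<phi>) = f \<phi>"
  shows "ivp_solution U P (E_class U f)
    (lin_comb U k (cramer_coeff U k ys (E_class U h)) (\<lambda>n. regular_dist (ys n)) \<oplus>\<^bsub>E_hat U\<^esub> E_class U h)"
proof -
  have ys: "smooth (ys n)" "pdt P (ys n) = (\<lambda>_. 0)" if "n \<in> {1..k}" for n
    using fs that unfolding fundamental_system_def by auto
  define Y where "Y n = conv_tf (regular_dist (ys n))" for n
  have Y: "Y n \<in> E_moderate U" if "n \<in> {1..k}" for n
    unfolding Y_def by (intro conv_tf_moderate regular_dist_distributions ys that)
  define A where "A \<phi> i n = (dx ^^ (i - 1)) (Y n \<phi>) 0" for \<phi> i n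
  define b where "b \<phi> i = (dx ^^ (i - 1)) (h \<phi>) 0" for \<phi> i
  define W where "W \<phi> = leibniz_det k (A \<phi>)" for \<phi>
  \<comment> \<open>\<open>W\<close> and \<open>N n\<close> represent the denominator and the numerator of the \<open>n\<close>-th coefficient\<close>
  define N where "N n \<phi> = leibniz_det k (\<lambda>i m. if m = n then b \<phi> i else A \<phi> i m)" for n \<phi>
  have leibniz_det_moderate: "(\<lambda>\<phi>. leibniz_det k (\<lambda>i n. B i n \<phi>)) \<in> C_moderate U"
    if B: "\<And>i n. i \<in> {1..k} \<Longrightarrow> n \<in> {1..k} \<Longrightarrow> B i n \<in> C_moderate U" for B
  proof -
    have prod: "(\<lambda>\<phi>. \<Prod>i\<in>I. g i \<phi>) \<in> C_moderate U" if "\<And>i. i \<in> I \<Longrightarrow> g i \<in> C_moderate U"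
      for I :: "nat set" and g
      using that
      by (induction I rule: infinite_finite_induct)
        (auto simp: C_moderate_const intro: C.mult_S[unfolded times_fun_def])
    have sum: "(\<lambda>\<phi>. \<Sum>i\<in>I. g i \<phi>) \<in> C_moderate U" if "\<And>i. i \<in> I \<Longrightarrow> g i \<in> C_moderate U"
      for I :: "(nat \<Rightarrow> nat) set" and g
      using that
      by (induction I rule: infinite_finite_induct)
        (auto simp: C_moderate_const intro: C.add_S[unfolded plus_fun_def])
    show ?thesis unfolding leibniz_det_def
    proof (rule sum)
      fix p assume "p \<in> {p. p permutes {1..k}}"
      then have p: "p i \<in> {1..k}" if "i \<in> {1..k}" for i
        using permutes_in_image[of p "{1..k}" i] that by blast
      show "(\<lambda>\<phi>. of_int (sign p) * (\<Prod>i = 1..k. B i (p i) \<phi>)) \<in> C_moderate U"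
        by (rule C.mult_S[unfolded times_fun_def, OF C_moderate_const prod]) (use p B in blast)
    qed
  qed
  have Am: "(\<lambda>\<phi>. A \<phi> i n) \<in> C_moderate U" if "n \<in> {1..k}" for i n
    unfolding A_def by (intro E_moderate_eval[OF E_moderate_dx_pow] Y that)
  have bm: "(\<lambda>\<phi>. b \<phi> i) \<in> C_moderate U" for i
    unfolding b_def by (intro E_moderate_eval[OF E_moderate_dx_pow] h)
  have Wm: "W \<in> C_moderate U"
    using leibniz_det_moderate[of "\<lambda>i n \<phi>. A \<phi> i n"] Am unfolding W_def by simp
  have Nm: "N n \<in> C_moderate U" for n
  proof -
    have "(\<lambda>\<phi>. if m = n then b \<phi> i else A \<phi> i m) \<in> C_moderate U" if "m \<in> {1..k}" for i m
      using Am[OF that] bm by (cases "m = n") auto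
    then show ?thesis using leibniz_det_moderate[of "\<lambda>i m \<phi>. if m = n then b \<phi> i else A \<phi> i m"] unfolding N_def by simp
  qed
  have "((\<lambda>\<phi>. W \<phi>) \<longlongrightarrow> leibniz_det k (\<lambda>i n. (dx ^^ (i - 1)) (ys n) 0)) U"
    unfolding W_def leibniz_det_def A_def Y_def
  proof (intro tendsto_sum tendsto_mult tendsto_const tendsto_prod dx_pow_conv_tf_regular_tendsto ys)
    show "p i \<in> {1..k}" if "p \<in> {p. p permutes {1..k}}" "i \<in> {1..k}" for p i
      using permutes_in_image[of p "{1..k}" i] that by blast
  qed
  note inv = inverse_moderate[OF this fundamental_wronskian[OF P deg fs]]
  define c where "c n \<phi> = - (N n \<phi> * (1 / W \<phi>))" for n \<phi>
  have NW: "(\<lambda>\<phi>. N n \<phi> * (1 / W \<phi>)) \<in> C_moderate U" for n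
    using C.mult_S[OF Nm inv(2)] by (simp add: times_fun_def)
  have cm: "c n \<in> C_moderate U" for n
  proof -
    have "c n = - (\<lambda>\<phi>. N n \<phi> * (1 / W \<phi>))" by (simp add: fun_eq_iff c_def)
    then show ?thesis using C.uminus_S[OF NW[of n]] by simp
  qed
  have coeff: "cramer_coeff U k ys (E_class U h) n = C_class U (c n)" if n: "n \<in> {1..k}" for n
  proof -
    have w1: "wronskian U k (\<lambda>i. iota U (regular_dist (ys i))) =
        E_class U (\<lambda>\<phi> x. \<Sum>p | p permutes {1..k}. of_int (sign p) * (\<Prod>i\<in>{1..k}. (dx ^^ (i - 1)) (Y (p i) \<phi>) x))"
      by (rule wronskian_class) (auto simp: iota_def Y_def intro: Y[unfolded Y_def])
    have w2: "wronskian U k ((\<lambda>i. iota U (regular_dist (ys i)))(n := E_class U h)) =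
        E_class U (\<lambda>\<phi> x. \<Sum>p | p permutes {1..k}. of_int (sign p) * (\<Prod>i\<in>{1..k}. (dx ^^ (i - 1)) ((Y(n := h)) (p i) \<phi>) x))"
      by (rule wronskian_class) (auto simp: iota_def Y_def h intro: Y[unfolded Y_def])
    have e1: "E_eval U (wronskian U k (\<lambda>i. iota U (regular_dist (ys i)))) 0 = C_class U W"
      unfolding w1 E_eval_class W_def leibniz_det_def A_def by (rule refl)
    have e2: "E_eval U (wronskian U k ((\<lambda>i. iota U (regular_dist (ys i)))(n := E_class U h))) 0 = C_class U (N n)"
    proof -
      have "(dx ^^ (i - 1)) ((Y(n := h)) m \<phi>) 0 = (if m = n then b \<phi> i else A \<phi> i m)" for i m \<phi>
        by (simp add: A_def b_def)
      then show ?thesis unfolding w2 E_eval_class N_def leibniz_det_def by simp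
    qed
    have i: "inv\<^bsub>C_hat U\<^esub> (C_class U W) = C_class U (\<lambda>\<phi>. 1 / W \<phi>)"
      unfolding hat_simps
    proof (rule C.inverse_Quot[OF Wm inv(2)])
      show "W * (\<lambda>\<phi>. 1 / W \<phi>) - 1 \<in> C_negligible U"
        unfolding C_negligible_iff
        by (rule negligible_on_eventually_0) (use inv(1) in eventually_elim, simp)
    qed
    show ?thesis
      unfolding cramer_coeff_def Let_def e1 e2 i c_def
      unfolding hat_simps C.mult_Quot[OF Nm inv(2)] times_fun_def C.uminus_Quot[OF NW] fun_Compl_def
      by (rule refl)
  qed
  have lc: "lin_comb U k (cramer_coeff U k ys (E_class U h)) (\<lambda>n. regular_dist (ys n))
      = E_class U (\<lambda>\<phi> x. \<Sum>n=1..k. c n \<phi> * Y n \<phi> x)"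
    unfolding Y_def by (rule lin_comb_class[OF coeff cm Y[unfolded Y_def]])
  define v where "v = (\<lambda>\<phi> x. \<Sum>n=1..k. c n \<phi> * Y n \<phi> x)"
  have v: "v \<in> E_moderate U"
    unfolding v_def by (intro E_moderate_sum E_moderate_mult E_moderate_const cm Y)
  have smY: "smooth (\<lambda>x. c n \<phi> * Y n \<phi> x)" if "n \<in> {1..k}" for n \<phi>
    by (intro smooth_cmult E_moderate_smooth[OF Y[OF that]])
  have pv: "pdt P (v \<phi>) = (\<lambda>_. 0)" for \<phi>
  proof -
    have summand: "pdt P (\<lambda>x. c n \<phi> * Y n \<phi> x) x = 0" if n: "n \<in> {1..k}" for n x
    proof -
      have "pdt P (Y n \<phi>) x = 0"
        unfolding Y_def by (simp add: pdt_conv_tf_regular ys[OF n] conv_tf_regular)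
      then show ?thesis by (simp add: pdt_cmult E_moderate_smooth[OF Y[OF n]])
    qed
    show ?thesis
      unfolding v_def
      by (subst pdt_sum, erule smY) (intro ext sum.neutral ballI, erule summand)
  qed
  have smv: "smooth (v \<phi>)" "smooth (h \<phi>)" for \<phi> using v h E_moderate_smooth by auto
  have init: "\<forall>\<^sub>F \<phi> in U. (dx ^^ j) (\<lambda>x. v \<phi> x + h \<phi> x) 0 = 0" if j: "j < k" for j
    using inv(1)
  proof eventually_elim
    case (elim \<phi>)
    have i: "Suc j \<in> {1..k}" using j by auto
    have "(dx ^^ j) (v \<phi>) 0 = (\<Sum>n=1..k. (dx ^^ j) (\<lambda>x. c n \<phi> * Y n \<phi> x) 0)"
      unfolding v_def by (subst dx_pow_sum, erule smY) (rule refl)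
    also have "\<dots> = - (\<Sum>n=1..k. A \<phi> (Suc j) n * (N n \<phi> / W \<phi>))"
      unfolding sum_negf[symmetric]
    proof (rule sum.cong[OF refl])
      fix n assume "n \<in> {1..k}"
      then have "(dx ^^ j) (\<lambda>x. c n \<phi> * Y n \<phi> x) 0 = c n \<phi> * (dx ^^ j) (Y n \<phi>) 0"
        using dx_pow_cmult[OF E_moderate_smooth[OF Y]] by simp
      then show "(dx ^^ j) (\<lambda>x. c n \<phi> * Y n \<phi> x) 0 = - (A \<phi> (Suc j) n * (N n \<phi> / W \<phi>))"
        by (simp add: A_def c_def)
    qed
    also have "\<dots> = - b \<phi> (Suc j)"
      using leibniz_det_cramer[OF elim[unfolded W_def] i, of "b \<phi>"] unfolding W_def N_def by simp
    finally show ?case by (simp add: dx_pow_add smv b_def)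
  qed
  have "ivp_solution U P (E_class U f) (E_class U (\<lambda>\<phi> x. v \<phi> x + h \<phi> x))"
    unfolding ivp_solution_class[OF E_moderate_add[OF v h]]
  proof (intro conjI allI impI)
    show "(\<lambda>\<phi> x. pdt P (\<lambda>x. v \<phi> x + h \<phi> x) x - f \<phi> x) \<in> E_negligible U"
      using E.zero_I by (simp add: pdt_add smv pv hf zero_fun_def)
    show "(\<lambda>\<phi>. (dx ^^ j) (\<lambda>x. v \<phi> x + h \<phi> x) 0) \<in> C_negligible U" if "j < degree P" for j
      unfolding C_negligible_iff
      by (rule negligible_on_eventually_0) (use init[of j] that deg in simp)
  qed
  then show ?thesis
    unfolding lc v_def[symmetric] E_add_class[OF v h] .
qed

end

theorem theorem8:
  fixes U :: "test_fun filter"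
    and P :: "complex poly"
    and k :: nat
    and f :: "(test_fun \<Rightarrow> real \<Rightarrow> complex) set"
  assumes "tv_ultrafilter U"
    and "P \<noteq> 0" and "degree P = k"
    and "f \<in> hat_span U dist_plus"
  shows "(\<exists>!y. ivp_solution U P f y) \<and>
    (\<forall>y ys. ivp_solution U P f y \<longrightarrow> fundamental_system P k ys \<longrightarrow>
      y = lin_comb U k (cramer_coeff U k ys (conv_hat U (green P) f)) (\<lambda>n. regular_dist (ys n))
            \<oplus>\<^bsub>E_hat U\<^esub> conv_hat U (green P) f)"
proof -
  interpret gauge_filter U
    using assms(1) by unfold_locales (auto simp: tv_ultrafilter_def ultrafilter_def)
  obtain F h where Fh: "F \<in> E_moderate U" "f = E_class U F"
    "h \<in> E_moderate U" "conv_hat U (green P) f = E_class U h" "\<And>\<phi>. pdt P (h \<phi>) = F \<phi>"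
    by (rule conv_hat_green[OF assms(2,4)]) blast
  have f: "f \<in> carrier (E_hat U)" using Fh E_carrier by blast
  note unique = ivp_unique[OF assms(2) _ _ f]
  have "\<exists>!y. ivp_solution U P f y"
    using ivp_exists[OF assms(2) f] unique by blast
  moreover have "y = lin_comb U k (cramer_coeff U k ys (conv_hat U (green P) f)) (\<lambda>n. regular_dist (ys n))
            \<oplus>\<^bsub>E_hat U\<^esub> conv_hat U (green P) f"
    if "ivp_solution U P f y" "fundamental_system P k ys" for y ys
    using unique[OF that(1) solution_formula[OF assms(2,3) that(2) Fh(1,3,5), folded Fh(2)]]
    unfolding Fh(4) .
  ultimately show ?thesis by blast
qed

end
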